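(* Let $\mathbb{L}$ be a connected affine complex algebraic group defined over $\mathbb{R}$, and let $L \subset \mathbb{L}(\mathbb{R})$ be the connected component, containing the identity element, of the locus of real points $\mathbb{L}(\mathbb{R})$. Let $\mathbb{X}$ be an irreducible complex algebraic variety defined over $\mathbb{R}$, and let $X$ be a connected component of the set $\mathbb{X}(\mathbb{R})$ of real points of $\mathbb{X}$. Let $\phi : L \times X \longrightarrow X$ be an action of $L$ on $X$ satisfying the following condition: there is an algebraic action $\mathbb{L} \times \mathbb{X} \longrightarrow \mathbb{X}$ defined over $\mathbb{R}$ that induces $\phi$. Then $L$ has a closed orbit in $X$, i.e. there is a point $x_0 \in X$ such that the orbit $L \cdot x_0$ is a closed subset of $X$.
   Context: Connected components of $\mathbb{L}(\mathbb{R})$ and $\mathbb{X}(\mathbb{R})$, and closedness of orbits in $X$, are taken with respect to the Euclidean (real analytic) topology on real points. In particular $X$ is nonempty. That the algebraic action induces $\phi$ means that $\phi$ is the restriction of the algebraic action $\mathbb{L} \times \mathbb{X} \to \mathbb{X}$ to $L \times X$. *)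

theory Defs
  imports "HOL-Analysis.Analysis" "HOL-Algebra.Group_Action"
begin

section \<open>Algebraic subsets of affine space\<close>

text \<open>
  Throughout, \<open>K\<close> is a subfield of the complex numbers; only \<open>K = \<real>\<close> and \<open>K = UNIV\<close> are used.
  Points are always complex points; \<open>K\<close> is the field in which the coefficients of all
  polynomials lie.
\<close>

inductive_set polyfun :: "complex set \<Rightarrow> (complex ^ 'i \<Rightarrow> complex) set" for K where
  const: "c \<in> K \<Longrightarrow> (\<lambda>z. c) \<in> polyfun K"
| coord: "(\<lambda>z. z $ k) \<in> polyfun K"
| add: "p \<in> polyfun K \<Longrightarrow> q \<in> polyfun K \<Longrightarrow> (\<lambda>z. p z + q z) \<in> polyfun K"
| mult: "p \<in> polyfun K \<Longrightarrow> q \<in> polyfun K \<Longrightarrow> (\<lambda>z. p z * q z) \<in> polyfun K"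

definition algebraic_set :: "complex set \<Rightarrow> (complex ^ 'i) set \<Rightarrow> bool" where
  "algebraic_set K Z \<longleftrightarrow> (\<exists>P \<subseteq> polyfun K. Z = {z. \<forall>p\<in>P. p z = 0})"

definition join_vec :: "'c ^ 'i \<Rightarrow> 'c ^ 'j \<Rightarrow> 'c ^ ('i + 'j)" where
  "join_vec u v = (\<chi> k. case k of Inl i \<Rightarrow> u $ i | Inr j \<Rightarrow> v $ j)"


section \<open>Varieties\<close>

text \<open>
  A variety is glued from finitely many affine varieties (the classical definition of Weil and
  Serre). It is presented by a finite atlas of charts \<open>(U, \<phi>)\<close>, where \<open>\<phi>\<close> identifies \<open>U\<close> with a
  Zariski closed subset of affine space. Since the atlas is finite, all its charts may be taken
  in one affine space \<open>complex ^ 'i\<close>, whose dimension is arbitrary.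
\<close>

type_synonym ('a, 'i) atlas = "('a set \<times> ('a \<Rightarrow> complex ^ 'i)) set"

definition points :: "('a, 'i :: finite) atlas \<Rightarrow> 'a set" where
  "points A = (\<Union>(U, \<phi>)\<in>A. U)"

text \<open>The Zariski topology, generated by the nonvanishing loci of polynomials on the charts.\<close>

definition zariski_topology :: "complex set \<Rightarrow> ('a, 'i :: finite) atlas \<Rightarrow> 'a topology" where
  "zariski_topology K A =
     topology_generated_by {{x \<in> U. p (\<phi> x) \<noteq> 0} | U \<phi> p. (U, \<phi>) \<in> A \<and> p \<in> polyfun K}"

definition euclidean_topology :: "('a, 'i :: finite) atlas \<Rightarrow> 'a topology" where
  "euclidean_topology A =
     topology_generated_by {{x \<in> U. \<phi> x \<in> W} | U \<phi> W. (U, \<phi>) \<in> A \<and> open W}"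

text \<open>
  \<open>regular_on K A W h\<close> is meant for Zariski open \<open>W\<close>: in every chart, \<open>h\<close> is locally on \<open>W\<close> a
  quotient of polynomials with coefficients in \<open>K\<close>. Shrinking a neighbourhood to a basic open
  set allows us to take the nonvanishing locus of the denominator as the neighbourhood.
\<close>

definition regular_on :: "complex set \<Rightarrow> ('a, 'i :: finite) atlas \<Rightarrow> 'a set \<Rightarrow> ('a \<Rightarrow> complex) \<Rightarrow> bool" where
  "regular_on K A W h \<longleftrightarrow>
     (\<forall>(U, \<phi>)\<in>A. \<forall>x \<in> U \<inter> W. \<exists>p \<in> polyfun K. \<exists>q \<in> polyfun K. q (\<phi> x) \<noteq> 0 \<and>
        (\<forall>y \<in> U \<inter> W. q (\<phi> y) \<noteq> 0 \<longrightarrow> h y = p (\<phi> y) / q (\<phi> y)))"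

text \<open>
  \<open>variety UNIV A\<close> says that \<open>A\<close> presents a complex variety, \<open>variety \<real> A\<close> that it presents a
  complex variety defined over \<open>\<real>\<close>. The conditions on two charts say that their overlap is
  Zariski open, that the transition map is regular, and that the variety is separated.
\<close>

definition variety :: "complex set \<Rightarrow> ('a, 'i :: finite) atlas \<Rightarrow> bool" where
  "variety K A \<longleftrightarrow> finite A \<and>
     (\<forall>(U, \<phi>)\<in>A. inj_on \<phi> U \<and> algebraic_set K (\<phi> ` U)) \<and>
     (\<forall>(U, \<phi>)\<in>A. \<forall>(V, \<psi>)\<in>A.
        (\<exists>Z. algebraic_set K Z \<and> \<phi> ` (U \<inter> V) = \<phi> ` U - Z) \<and>
        (\<forall>k. regular_on K {(U, \<phi>)} (U \<inter> V) (\<lambda>x. \<psi> x $ k)) \<and>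
        algebraic_set K ((\<lambda>x. join_vec (\<phi> x) (\<psi> x)) ` (U \<inter> V)))"

text \<open>
  An affine variety is a closed subset of an affine space, i.e. it is given with one global chart.
\<close>

definition affine_variety :: "complex set \<Rightarrow> ('a, 'i :: finite) atlas \<Rightarrow> bool" where
  "affine_variety K A \<longleftrightarrow> variety K A \<and> (\<exists>\<phi>. A = {(points A, \<phi>)})"

definition irreducible_space :: "'a topology \<Rightarrow> bool" where
  "irreducible_space T \<longleftrightarrow> topspace T \<noteq> {} \<and>
     (\<forall>C D. closedin T C \<and> closedin T D \<and> C \<union> D = topspace T \<longrightarrow> C = topspace T \<or> D = topspace T)"

definition real_points :: "('a, 'i :: finite) atlas \<Rightarrow> 'a set" where
  "real_points A = {x. \<exists>(U, \<phi>)\<in>A. x \<in> U \<and> (\<forall>k. \<phi> x $ k \<in> \<real>)}"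

abbreviation real_locus :: "('a, 'i :: finite) atlas \<Rightarrow> 'a topology" where
  "real_locus A \<equiv> subtopology (euclidean_topology A) (real_points A)"

definition product_atlas :: "('a, 'i :: finite) atlas \<Rightarrow> ('b, 'j :: finite) atlas \<Rightarrow> ('a \<times> 'b, 'i :: finite + 'j :: finite) atlas" where
  "product_atlas A B =
     {(U \<times> V, \<lambda>(x, y). join_vec (\<phi> x) (\<psi> y)) | U \<phi> V \<psi>. (U, \<phi>) \<in> A \<and> (V, \<psi>) \<in> B}"

definition morphism :: "complex set \<Rightarrow> ('a, 'i :: finite) atlas \<Rightarrow> ('b, 'j :: finite) atlas \<Rightarrow> ('a \<Rightarrow> 'b) \<Rightarrow> bool" where
  "morphism K A B f \<longleftrightarrow>
     continuous_map (zariski_topology K A) (zariski_topology K B) f \<and>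
     (\<forall>(V, \<psi>)\<in>B. \<forall>k. regular_on K A {x \<in> points A. f x \<in> V} (\<lambda>x. \<psi> (f x) $ k))"


section \<open>Algebraic groups and algebraic actions\<close>

definition algebraic_group :: "complex set \<Rightarrow> ('g, 'm) monoid_scheme \<Rightarrow> ('g, 'i :: finite) atlas \<Rightarrow> bool" where
  "algebraic_group K G A \<longleftrightarrow> group G \<and> variety K A \<and> carrier G = points A \<and>
     morphism K (product_atlas A A) A (\<lambda>(g, h). g \<otimes>\<^bsub>G\<^esub> h) \<and>
     morphism K A A (\<lambda>g. inv\<^bsub>G\<^esub> g)"

definition algebraic_action ::
  "complex set \<Rightarrow> ('g, 'm) monoid_scheme \<Rightarrow> ('g, 'i :: finite) atlas \<Rightarrow> ('x, 'j :: finite) atlas \<Rightarrow> ('g \<Rightarrow> 'x \<Rightarrow> 'x) \<Rightarrow> bool"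
where
  "algebraic_action K G A B a \<longleftrightarrow> group_action G (points B) a \<and>
     morphism K (product_atlas A B) B (\<lambda>(g, x). a g x)"

definition real_identity_component :: "('g, 'm) monoid_scheme \<Rightarrow> ('g, 'i :: finite) atlas \<Rightarrow> 'g set" where
  "real_identity_component G A = connected_component_of_set (real_locus A) \<one>\<^bsub>G\<^esub>"


section \<open>Basic facts\<close>

lemma one_polyfun: "(\<lambda>z. 1) \<in> polyfun K" if "1 \<in> K"
  using that by (rule polyfun.const)

lemma topspace_zariski_topology:
  assumes "1 \<in> K"
  shows "topspace (zariski_topology K A) = points A"
proof
  show "topspace (zariski_topology K A) \<subseteq> points A"
    by (auto simp: zariski_topology_def points_def)
  show "points A \<subseteq> topspace (zariski_topology K A)"
  proof
    fix x assume "x \<in> points A"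
    then obtain U \<phi> where U: "(U, \<phi>) \<in> A" "x \<in> U"
      by (auto simp: points_def)
    then have "U \<in> {{x \<in> U. p (\<phi> x) \<noteq> 0} | U \<phi> p. (U, \<phi>) \<in> A \<and> p \<in> polyfun K}"
      using one_polyfun[OF assms]
      by (intro CollectI exI[of _ U] exI[of _ \<phi>] exI[of _ "\<lambda>z. 1"]) auto
    with U show "x \<in> topspace (zariski_topology K A)"
      unfolding zariski_topology_def topology_generated_by_topspace by blast
  qed
qed

lemma topspace_euclidean_topology: "topspace (euclidean_topology A) = points A"
proof
  show "topspace (euclidean_topology A) \<subseteq> points A"
    by (auto simp: euclidean_topology_def points_def)
  show "points A \<subseteq> topspace (euclidean_topology A)"
  proof
    fix x assume "x \<in> points A"
    then obtain U \<phi> where U: "(U, \<phi>) \<in> A" "x \<in> U"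
      by (auto simp: points_def)
    then have "U \<in> {{x \<in> U. \<phi> x \<in> W} | U \<phi> W. (U, \<phi>) \<in> A \<and> open W}"
      by (intro CollectI exI[of _ U] exI[of _ \<phi>] exI[of _ UNIV]) auto
    with U show "x \<in> topspace (euclidean_topology A)"
      unfolding euclidean_topology_def topology_generated_by_topspace by blast
  qed
qed

lemma polyfun_mono: "K \<subseteq> K' \<Longrightarrow> polyfun K \<subseteq> polyfun K'"
proof
  fix p :: "complex ^ 'i \<Rightarrow> complex" assume K: "K \<subseteq> K'" and p: "p \<in> polyfun K"
  from p show "p \<in> polyfun K'"
    by induction (use K in \<open>auto intro: polyfun.intros\<close>)
qed

lemma algebraic_set_mono: "K \<subseteq> K' \<Longrightarrow> algebraic_set K Z \<Longrightarrow> algebraic_set K' Z"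
  unfolding algebraic_set_def by (blast dest: subset_trans[OF _ polyfun_mono])

lemma regular_on_mono:
  assumes "K \<subseteq> K'" "regular_on K A W h"
  shows "regular_on K' A W h"
  unfolding regular_on_def case_prod_beta
proof (intro ballI)
  fix c x assume "c \<in> A" "x \<in> fst c \<inter> W"
  then obtain p q where "p \<in> polyfun K" "q \<in> polyfun K" "q (snd c x) \<noteq> 0"
    "\<forall>y \<in> fst c \<inter> W. q (snd c y) \<noteq> 0 \<longrightarrow> h y = p (snd c y) / q (snd c y)"
    using assms(2) unfolding regular_on_def case_prod_beta by blast
  then show "\<exists>p \<in> polyfun K'. \<exists>q \<in> polyfun K'. q (snd c x) \<noteq> 0 \<and>
      (\<forall>y \<in> fst c \<inter> W. q (snd c y) \<noteq> 0 \<longrightarrow> h y = p (snd c y) / q (snd c y))"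
    using polyfun_mono[OF assms(1)] by blast
qed

lemma variety_mono:
  assumes K: "K \<subseteq> K'" and "variety K A"
  shows "variety K' A"
proof -
  note alg = algebraic_set_mono[OF K] and reg = regular_on_mono[OF K]
  have A: "finite A"
    "\<And>c. c \<in> A \<Longrightarrow> inj_on (snd c) (fst c) \<and> algebraic_set K (snd c ` fst c)"
    "\<And>c d. c \<in> A \<Longrightarrow> d \<in> A \<Longrightarrow>
       (\<exists>Z. algebraic_set K Z \<and> snd c ` (fst c \<inter> fst d) = snd c ` fst c - Z) \<and>
       (\<forall>k. regular_on K {(fst c, snd c)} (fst c \<inter> fst d) (\<lambda>x. snd d x $ k)) \<and>
       algebraic_set K ((\<lambda>x. join_vec (snd c x) (snd d x)) ` (fst c \<inter> fst d))"
    using assms(2) unfolding variety_def case_prod_beta by blast+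
  show ?thesis
    unfolding variety_def case_prod_beta
  proof (intro conjI ballI allI)
    fix c d k assume cd: "c \<in> A" "d \<in> A"
    show "\<exists>Z. algebraic_set K' Z \<and> snd c ` (fst c \<inter> fst d) = snd c ` fst c - Z"
      using A(3)[OF cd] alg by blast
    show "regular_on K' {(fst c, snd c)} (fst c \<inter> fst d) (\<lambda>x. snd d x $ k)"
      using A(3)[OF cd] reg by blast
    show "algebraic_set K' ((\<lambda>x. join_vec (snd c x) (snd d x)) ` (fst c \<inter> fst d))"
      using A(3)[OF cd] alg by blast
  qed (use A(1,2) alg in blast)+
qed

lemma polyfun_fst:
  fixes p :: "complex ^ 'i \<Rightarrow> complex"
  assumes "p \<in> polyfun K"
  shows "(\<lambda>z :: complex ^ ('i + 'j :: finite). p (\<chi> i. z $ Inl i)) \<in> polyfun K"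
  using assms by induction (auto intro: polyfun.intros)

lemma join_vec_eq_iff:
  fixes z :: "'c ^ ('i :: finite + 'j :: finite)"
  shows "z = join_vec u v \<longleftrightarrow> (\<forall>i. z $ Inl i = u $ i) \<and> (\<forall>j. z $ Inr j = v $ j)"
proof
  assume R: "(\<forall>i. z $ Inl i = u $ i) \<and> (\<forall>j. z $ Inr j = v $ j)"
  have "z $ k = join_vec u v $ k" for k
    using R by (cases k) (auto simp: join_vec_def)
  then show "z = join_vec u v"
    by (simp add: vec_eq_iff)
qed (simp add: join_vec_def)

lemma affine_variety_closed_subset:
  fixes \<phi> :: "'a \<Rightarrow> complex ^ 'i :: finite"
  assumes K: "1 \<in> K" "-1 \<in> K"
    and inj: "inj_on \<phi> S" and alg: "algebraic_set K (\<phi> ` S)"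
  shows "affine_variety K {(S, \<phi>)}"
proof -
  obtain P where P: "P \<subseteq> polyfun K" "\<phi> ` S = {z. \<forall>p\<in>P. p z = 0}"
    using alg by (auto simp: algebraic_set_def)
  have empty: "algebraic_set K ({} :: (complex ^ 'i) set)"
    unfolding algebraic_set_def using one_polyfun[OF K(1)]
    by (intro exI[of _ "{\<lambda>z. 1}"]) auto
  have reg: "regular_on K {(S, \<phi>)} S (\<lambda>x. \<phi> x $ k)" for k
  proof -
    have "\<exists>p \<in> polyfun K. \<exists>q \<in> polyfun K. q (\<phi> x) \<noteq> 0 \<and>
        (\<forall>y \<in> S \<inter> S. q (\<phi> y) \<noteq> 0 \<longrightarrow> \<phi> y $ k = p (\<phi> y) / q (\<phi> y))" for x
      by (rule bexI[OF bexI[OF _ one_polyfun[OF K(1)]] polyfun.coord[of k]]) simp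
    then show ?thesis
      by (simp add: regular_on_def)
  qed
  define Q :: "(complex ^ ('i + 'i) \<Rightarrow> complex) set" where
    "Q = (\<lambda>p z. p (\<chi> i. z $ Inl i)) ` P \<union> range (\<lambda>i z. z $ Inl i + -1 * z $ Inr i)"
  have "(\<lambda>z. z $ Inl i + -1 * z $ Inr i) \<in> polyfun K" for i :: 'i
    by (intro polyfun.add polyfun.mult polyfun.coord polyfun.const K(2))
  moreover have "(\<lambda>z :: complex ^ ('i + 'i). p (\<chi> i. z $ Inl i)) \<in> polyfun K" if "p \<in> P" for p
    using P(1) that by (intro polyfun_fst) auto
  ultimately have "Q \<subseteq> polyfun K"
    unfolding Q_def by blast
  moreover have "(\<lambda>x. join_vec (\<phi> x) (\<phi> x)) ` S = {z. \<forall>q\<in>Q. q z = 0}" (is "?L = ?R")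
  proof (rule Set.set_eqI)
    fix z :: "complex ^ ('i + 'i)"
    have "z \<in> ?R \<longleftrightarrow> (\<forall>p\<in>P. p (\<chi> i. z $ Inl i) = 0) \<and> (\<forall>i. z $ Inl i = z $ Inr i)"
      by (auto simp: Q_def ball_Un)
    also have "\<dots> \<longleftrightarrow> (\<chi> i. z $ Inl i) \<in> \<phi> ` S \<and> (\<forall>i. z $ Inl i = z $ Inr i)"
      by (simp add: P(2))
    also have "\<dots> \<longleftrightarrow> (\<exists>x\<in>S. (\<forall>i. z $ Inl i = \<phi> x $ i) \<and> (\<forall>i. z $ Inr i = \<phi> x $ i))"
      by (auto simp: image_iff vec_eq_iff)
    also have "\<dots> \<longleftrightarrow> z \<in> ?L"
      by (simp only: image_iff join_vec_eq_iff)
    finally show "z \<in> ?L \<longleftrightarrow> z \<in> ?R" ..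
  qed
  ultimately have "algebraic_set K ((\<lambda>x. join_vec (\<phi> x) (\<phi> x)) ` S)"
    unfolding algebraic_set_def by blast
  moreover have "\<exists>Z. algebraic_set K Z \<and> \<phi> ` S = \<phi> ` S - Z"
    using empty by (metis Diff_empty)
  ultimately show ?thesis
    using inj alg reg by (simp add: affine_variety_def variety_def points_def)
qed

end

theory Submission
  imports Defs
begin

text \<open>
  Among the orbits in \<open>X\<close>, choose \<open>L x0\<close> whose Zariski closure is minimal on real points; this is
  possible by the Hilbert basis theorem. If \<open>y \<in> X\<close> lies in the Euclidean closure of \<open>L x0\<close>, then
  \<open>L y\<close> and \<open>L x0\<close> have the same Zariski closure \<open>Z\<close> on real points. The orbit \<open>L y\<close> is semialgebraic:
  \<open>L\<close> is so as a component of a real algebraic set, and images are handled by the Tarski-Seidenberg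
  theorem. A semialgebraic set contains a nonempty Euclidean open subset of the real points of its
  Zariski closure, so \<open>L y\<close> contains a relatively open subset of \<open>Z\<close>. As the Euclidean closure of
  \<open>L x0\<close> is \<open>L\<close>-invariant, \<open>L x0\<close> enters this subset, hence \<open>y \<in> L x0\<close>. No dimension theory is needed.

  Both facts on semialgebraic sets rest on one statement in the style of Cohen and Hoermander: the
  signs of finitely many functions on the base determine the sign diagrams of a finite family of
  univariate polynomials up to an order isomorphism of the line.
\<close>


section \<open>Noetherianity of real polynomial functions\<close>

text \<open>\<open>L\<close> is only one connected component of the real points of the group, so no
  system of equations describes it. That it is semialgebraic is a statement about components, and
  for its sake connected cells are built and not merely variables eliminated. \<open>XX\<close> need
  not be affine, so semialgebraic sets live in the coordinates of single charts; an orbit is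
  reassembled from finitely many sets, each Zariski closed and cut down by a Euclidean open set and
  by the real points. Zariski closures consist of complex points but use real coefficients. The
  chain arguments run over real polynomial functions of real coordinates and control only the real
  points of a closed set, which is why closures are compared there. The degree of a univariate
  polynomial may jump with the base point. Two base points are therefore compared by the mere
  existence of an order isomorphism between the lines over them: no roots are numbered, and
  continuous dependence on the base point is recovered afterwards by counting roots.\<close>

definition function_ring :: "('b \<Rightarrow> real) set \<Rightarrow> bool" where
  "function_ring R \<longleftrightarrow> (\<forall>c. (\<lambda>x. c) \<in> R) \<and>
     (\<forall>f\<in>R. \<forall>g\<in>R. (\<lambda>x. f x + g x) \<in> R) \<and> (\<forall>f\<in>R. \<forall>g\<in>R. (\<lambda>x. f x * g x) \<in> R)"

lemma function_ring_const: "function_ring R \<Longrightarrow> (\<lambda>x. c) \<in> R"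
  and function_ring_add: "function_ring R \<Longrightarrow> f \<in> R \<Longrightarrow> g \<in> R \<Longrightarrow> (\<lambda>x. f x + g x) \<in> R"
  and function_ring_mult: "function_ring R \<Longrightarrow> f \<in> R \<Longrightarrow> g \<in> R \<Longrightarrow> (\<lambda>x. f x * g x) \<in> R"
  by (auto simp: function_ring_def)

lemma function_ring_uminus: "function_ring R \<Longrightarrow> f \<in> R \<Longrightarrow> (\<lambda>x. - f x) \<in> R"
  using function_ring_mult[of R "\<lambda>x. -1" f] function_ring_const[of R "-1"] by simp

lemma function_ring_diff:
  "function_ring R \<Longrightarrow> f \<in> R \<Longrightarrow> g \<in> R \<Longrightarrow> (\<lambda>x. f x - g x) \<in> R"
  using function_ring_add[of R f "\<lambda>x. - g x"] function_ring_uminus[of R g] by simp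

lemma function_ring_power: "function_ring R \<Longrightarrow> f \<in> R \<Longrightarrow> (\<lambda>x. f x ^ n) \<in> R"
  by (induction n) (auto intro: function_ring_const function_ring_mult)

lemma function_ring_sum:
  "function_ring R \<Longrightarrow> (\<And>i. i \<in> I \<Longrightarrow> f i \<in> R) \<Longrightarrow> (\<lambda>x. \<Sum>i\<in>I. f i x) \<in> R"
  by (induction I rule: infinite_finite_induct) (auto intro: function_ring_const function_ring_add)

text \<open>These are functions of all assignments, and \<open>V\<close> only limits the variables
  that may occur. Induction on \<open>V\<close> can thus adjoin variables one at a time within a
  single type.\<close>

inductive_set rpoly :: "'v set \<Rightarrow> (('v \<Rightarrow> real) \<Rightarrow> real) set" for V where
  const: "(\<lambda>x. c) \<in> rpoly V"
| coord: "k \<in> V \<Longrightarrow> (\<lambda>x. x k) \<in> rpoly V"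
| add: "f \<in> rpoly V \<Longrightarrow> g \<in> rpoly V \<Longrightarrow> (\<lambda>x. f x + g x) \<in> rpoly V"
| mult: "f \<in> rpoly V \<Longrightarrow> g \<in> rpoly V \<Longrightarrow> (\<lambda>x. f x * g x) \<in> rpoly V"

lemma function_ring_rpoly: "function_ring (rpoly V)"
  by (auto simp: function_ring_def intro: rpoly.intros)

lemma rpoly_mono: "V \<subseteq> W \<Longrightarrow> rpoly V \<subseteq> rpoly W"
proof
  fix f assume "V \<subseteq> W" and "f \<in> rpoly V"
  from this(2,1) show "f \<in> rpoly W"
    by induction (auto intro: rpoly.intros)
qed

lemma rpoly_fun_upd:
  assumes "f \<in> rpoly V" "v \<notin> V"
  shows "f (x(v := t)) = f x"
  using assms by induction auto

lemma rpoly_compose: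
  assumes "f \<in> rpoly V" and "\<And>k. k \<in> V \<Longrightarrow> (\<lambda>x. s x k) \<in> rpoly W"
  shows "(\<lambda>x. f (s x)) \<in> rpoly W"
  using assms by induction (auto intro: rpoly.intros)

text \<open>Coefficient sequences are total, so \<open>polys_in R z n\<close> means degree less than \<open>n\<close> in \<open>z\<close>.\<close>

definition polys_in :: "('b \<Rightarrow> real) set \<Rightarrow> ('b \<Rightarrow> real) \<Rightarrow> nat \<Rightarrow> ('b \<Rightarrow> real) set" where
  "polys_in R z n = {f. \<exists>c. (\<forall>i. c i \<in> R) \<and> f = (\<lambda>x. \<Sum>i<n. c i x * z x ^ i)}"

lemma polys_in_const:
  assumes "function_ring R" "a \<in> R" "n < m" shows "(\<lambda>x. a x * z x ^ n) \<in> polys_in R z m"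
proof -
  have "(\<lambda>x. a x * z x ^ n) = (\<lambda>x. \<Sum>i<m. (if i = n then a else (\<lambda>x. 0)) x * z x ^ i)"
  proof
    fix x
    have "(\<Sum>i<m. (if i = n then a else (\<lambda>x. 0)) x * z x ^ i)
        = (\<Sum>i<m. if i = n then a x * z x ^ n else 0)"
      by (rule sum.cong) auto
    also have "\<dots> = a x * z x ^ n"
      using assms by (simp add: sum.delta)
    finally show "a x * z x ^ n = (\<Sum>i<m. (if i = n then a else (\<lambda>x. 0)) x * z x ^ i)" ..
  qed
  then show ?thesis
    using assms unfolding polys_in_def
    by (intro CollectI exI[of _ "\<lambda>i. if i = n then a else (\<lambda>x. 0)"])
       (auto intro: function_ring_const)
qed

lemma polys_in_zero: "function_ring R \<Longrightarrow> (\<lambda>x. 0) \<in> polys_in R z n"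
  unfolding polys_in_def
  by (intro CollectI exI[of _ "\<lambda>i x. 0"]) (auto intro: function_ring_const)

lemma polys_in_add:
  assumes R: "function_ring R" and "f \<in> polys_in R z n" "g \<in> polys_in R z n"
  shows "(\<lambda>x. f x + g x) \<in> polys_in R z n"
proof -
  obtain c d where c: "\<forall>i. c i \<in> R" "f = (\<lambda>x. \<Sum>i<n. c i x * z x ^ i)"
    and d: "\<forall>i. d i \<in> R" "g = (\<lambda>x. \<Sum>i<n. d i x * z x ^ i)"
    using assms(2,3) unfolding polys_in_def by auto
  have "(\<lambda>x. f x + g x) = (\<lambda>x. \<Sum>i<n. (c i x + d i x) * z x ^ i)"
    by (auto simp: c d sum.distrib algebra_simps)
  then show ?thesis
    using c d R unfolding polys_in_def
    by (intro CollectI exI[of _ "\<lambda>i x. c i x + d i x"]) (auto intro: function_ring_add)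
qed

lemma polys_in_sum:
  assumes "function_ring R" "\<And>i. i \<in> I \<Longrightarrow> f i \<in> polys_in R z n"
  shows "(\<lambda>x. \<Sum>i\<in>I. f i x) \<in> polys_in R z n"
  using assms(2)
  by (induction I rule: infinite_finite_induct)
     (auto intro: polys_in_zero polys_in_add assms(1))

lemma polys_in_mono:
  assumes "function_ring R" "f \<in> polys_in R z n" "n \<le> m" shows "f \<in> polys_in R z m"
proof -
  obtain c where c: "\<forall>i. c i \<in> R" "f = (\<lambda>x. \<Sum>i<n. c i x * z x ^ i)"
    using assms(2) unfolding polys_in_def by auto
  show ?thesis
    unfolding c(2) using assms(3) c(1)
    by (intro polys_in_sum polys_in_const assms(1)) auto
qed

lemma polys_in_mult_power:
  assumes "function_ring R" "f \<in> polys_in R z n" "a \<in> R" "n + k \<le> m"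
  shows "(\<lambda>x. a x * z x ^ k * f x) \<in> polys_in R z m"
proof -
  obtain c where c: "\<forall>i. c i \<in> R" "f = (\<lambda>x. \<Sum>i<n. c i x * z x ^ i)"
    using assms(2) unfolding polys_in_def by auto
  have "(\<lambda>x. a x * z x ^ k * f x) = (\<lambda>x. \<Sum>i<n. (a x * c i x) * z x ^ (i + k))"
    by (auto simp: c(2) sum_distrib_left power_add algebra_simps)
  also have "\<dots> \<in> polys_in R z m"
    using c(1) assms(1,3,4)
    by (intro polys_in_sum polys_in_const) (auto intro: function_ring_mult)
  finally show ?thesis .
qed

lemma polys_in_mult:
  assumes R: "function_ring R" and "f \<in> polys_in R z n" "g \<in> polys_in R z m"
  shows "(\<lambda>x. f x * g x) \<in> polys_in R z (n + m)"
proof -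
  obtain c where c: "\<forall>i. c i \<in> R" "f = (\<lambda>x. \<Sum>i<n. c i x * z x ^ i)"
    using assms(2) unfolding polys_in_def by auto
  have "(\<lambda>x. f x * g x) = (\<lambda>x. \<Sum>i<n. c i x * z x ^ i * g x)"
    by (auto simp: c(2) sum_distrib_right)
  also have "\<dots> \<in> polys_in R z (n + m)"
    using c(1) by (intro polys_in_sum R polys_in_mult_power[OF R assms(3)]) auto
  finally show ?thesis .
qed

lemma function_ring_polys_in:
  assumes "function_ring R" shows "function_ring (\<Union>n. polys_in R z n)"
  unfolding function_ring_def
proof (intro conjI allI ballI)
  fix c show "(\<lambda>x. c) \<in> (\<Union>n. polys_in R z n)"
    using polys_in_const[of R "\<lambda>x. c" 0 1 z] assms by (auto intro: function_ring_const)
next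
  fix f g assume "f \<in> (\<Union>n. polys_in R z n)" "g \<in> (\<Union>n. polys_in R z n)"
  then obtain n m where nm: "f \<in> polys_in R z n" "g \<in> polys_in R z m" by auto
  show "(\<lambda>x. f x + g x) \<in> (\<Union>n. polys_in R z n)"
    using polys_in_mono[OF assms nm(1), of "n + m"] polys_in_mono[OF assms nm(2), of "n + m"]
    by (auto intro: polys_in_add[OF assms])
  show "(\<lambda>x. f x * g x) \<in> (\<Union>n. polys_in R z n)"
    using polys_in_mult[OF assms nm] by auto
qed

lemma rpoly_insert:
  assumes "f \<in> rpoly (insert v V)"
  shows "\<exists>n. f \<in> polys_in (rpoly V) (\<lambda>x. x v) n"
proof -
  note ring = function_ring_polys_in[OF function_ring_rpoly, of V "\<lambda>x. x v"]
  have "f \<in> (\<Union>n. polys_in (rpoly V) (\<lambda>x. x v) n)"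
    using assms
  proof induction
    case (coord k)
    show ?case
    proof (cases "k = v")
      case True
      have "(\<lambda>x. x v) \<in> polys_in (rpoly V) (\<lambda>x. x v) 2"
        using polys_in_const[OF function_ring_rpoly[of V] rpoly.const[of 1], of 1 2 "\<lambda>x. x v"] by simp
      with True show ?thesis by auto
    next
      case False
      with coord have "(\<lambda>x. x k) \<in> rpoly V" by (auto intro: rpoly.coord)
      then have "(\<lambda>x. x k) \<in> polys_in (rpoly V) (\<lambda>x. x v) 1"
        using polys_in_const[OF function_ring_rpoly[of V], of "\<lambda>x. x k" 0 1 "\<lambda>x. x v"] by simp
      then show ?thesis by auto
    qed
  qed (rule function_ring_const[OF ring] function_ring_add[OF ring] function_ring_mult[OF ring];
       assumption)+
  then show ?thesis by auto
qed

section \<open>Ideals and the Hilbert basis theorem\<close>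

inductive_set ideal_gen :: "('b \<Rightarrow> real) set \<Rightarrow> ('b \<Rightarrow> real) set \<Rightarrow> ('b \<Rightarrow> real) set" for R J where
  zero: "(\<lambda>x. 0) \<in> ideal_gen R J"
| gen: "f \<in> J \<Longrightarrow> f \<in> ideal_gen R J"
| add: "f \<in> ideal_gen R J \<Longrightarrow> g \<in> ideal_gen R J \<Longrightarrow> (\<lambda>x. f x + g x) \<in> ideal_gen R J"
| mult: "a \<in> R \<Longrightarrow> f \<in> ideal_gen R J \<Longrightarrow> (\<lambda>x. a x * f x) \<in> ideal_gen R J"

lemma ideal_gen_least:
  assumes "f \<in> ideal_gen R J" "J \<subseteq> ideal_gen R J'"
  shows "f \<in> ideal_gen R J'"
  using assms by induction (auto intro: ideal_gen.intros)

lemma ideal_gen_mono: "J \<subseteq> J' \<Longrightarrow> ideal_gen R J \<subseteq> ideal_gen R J'"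
  using ideal_gen_least[of _ R J J'] by (auto intro: ideal_gen.gen)

lemma ideal_gen_subset:
  assumes "f \<in> ideal_gen R J" "J \<subseteq> R" "function_ring R" shows "f \<in> R"
  using assms by induction (auto intro: function_ring_const function_ring_add function_ring_mult)

lemma ideal_gen_zero:
  assumes "f \<in> ideal_gen R J" "\<And>g. g \<in> J \<Longrightarrow> g x = 0" shows "f x = 0"
  using assms by induction auto

text \<open>The ascending chain condition in terms of sequences of generators, the form that a
  greedy choice of ever new elements contradicts directly.\<close>

definition noetherian :: "('b \<Rightarrow> real) set \<Rightarrow> bool" where
  "noetherian R \<longleftrightarrow> (\<forall>f :: nat \<Rightarrow> _. range f \<subseteq> R \<longrightarrow> (\<exists>k. f k \<in> ideal_gen R (f ` {..<k})))"

text \<open>A generator of minimal degree outside the ideal generated by its predecessors could be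
  reduced to smaller degree, since its leading coefficient lies in the ideal generated by the
  previous leading coefficients.\<close>

lemma noetherian_polys_in:
  assumes R: "function_ring R" and noeth: "noetherian R"
  shows "noetherian (\<Union>n. polys_in R z n)"
proof (rule ccontr)
  define S where "S = (\<Union>n. polys_in R z n)"
  have S: "function_ring S"
    unfolding S_def by (rule function_ring_polys_in[OF R])
  have RS: "R \<subseteq> S"
    using polys_in_const[OF R, of _ 0 1 z] by (auto simp: S_def)
  have zS: "(\<lambda>x. z x ^ i) \<in> S" for i
    using polys_in_const[OF R function_ring_const[OF R], of i "Suc i" 1 z] by (auto simp: S_def)
  assume "\<not> noetherian (\<Union>n. polys_in R z n)"
  then obtain f :: "nat \<Rightarrow> _" where f: "range f \<subseteq> S" "\<And>k. f k \<notin> ideal_gen S (f ` {..<k})"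
    unfolding noetherian_def S_def by blast
  define I where "I = ideal_gen S (range f)"
  have IS: "I \<subseteq> S"
    using ideal_gen_subset[OF _ f(1) S] by (auto simp: I_def)
  have up: "h \<in> ideal_gen S (f ` {..<m})" if "h \<in> ideal_gen S (f ` {..<k})" "k \<le> m" for h k m
  proof -
    have "f ` {..<k} \<subseteq> f ` {..<m}" using that(2) by auto
    then show ?thesis using that(1) ideal_gen_mono by blast
  qed
  have I_fin: "\<exists>k. h \<in> ideal_gen S (f ` {..<k})" if "h \<in> I" for h
    using that unfolding I_def
  proof induction
    case (gen h)
    then obtain k where "h = f k" by auto
    then show ?case by (intro exI[of _ "Suc k"] ideal_gen.gen) auto
  next
    case (add g h)
    then obtain k l where "g \<in> ideal_gen S (f ` {..<k})" "h \<in> ideal_gen S (f ` {..<l})" by auto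
    then have "g \<in> ideal_gen S (f ` {..<max k l})" "h \<in> ideal_gen S (f ` {..<max k l})"
      by (meson up max.cobounded1 max.cobounded2)+
    then show ?case by (blast intro: ideal_gen.add)
  qed (auto intro: ideal_gen.intros)
  \<comment> \<open>Finitely many elements of \<open>I\<close> involve only finitely many of the
    \<open>f j\<close>, so they cannot produce the next \<open>f k\<close>.\<close>
  have not_fg: "\<exists>g\<in>I. g \<notin> ideal_gen S J" if "finite J" "J \<subseteq> I" for J
  proof -
    have "\<exists>k. J \<subseteq> ideal_gen S (f ` {..<k})"
      using that
    proof (induction J)
      case (insert h J)
      then obtain k l where "J \<subseteq> ideal_gen S (f ` {..<k})" "h \<in> ideal_gen S (f ` {..<l})"
        using I_fin[of h] by auto
      then have "insert h J \<subseteq> ideal_gen S (f ` {..<max k l})"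
        by (meson up max.cobounded1 max.cobounded2 insert_subset subset_iff)
      then show ?case by blast
    qed auto
    then obtain k where "J \<subseteq> ideal_gen S (f ` {..<k})" by blast
    then have "f k \<notin> ideal_gen S J"
      using ideal_gen_least[of "f k" S J "f ` {..<k}"] f(2)[of k] by blast
    moreover have "f k \<in> I" by (auto simp: I_def intro: ideal_gen.gen)
    ultimately show ?thesis by blast
  qed
  define P where "P J g n \<longleftrightarrow> g \<in> I \<and> g \<notin> ideal_gen S J \<and> g \<in> polys_in R z n" for J g n
  define deg where "deg J = (LEAST n. \<exists>g. P J g n)" for J
  define G where "G J = (SOME g. P J g (deg J))" for J
  have ex: "\<exists>n g. P J g n" if "finite J" "J \<subseteq> I" for J
  proof -
    from not_fg[OF that] obtain g where g: "g \<in> I" "g \<notin> ideal_gen S J" by blast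
    then obtain n where "g \<in> polys_in R z n" using IS by (auto simp: S_def)
    with g show ?thesis unfolding P_def by blast
  qed
  have G: "P J (G J) (deg J)" if "finite J" "J \<subseteq> I" for J
    unfolding G_def deg_def using LeastI_ex[OF ex[OF that]] by (rule someI_ex)
  have deg_le: "deg J \<le> n" if "P J g n" for J g n
    unfolding deg_def using that by (intro Least_le) blast
  \<comment> \<open>\<open>H k\<close> collects the first \<open>k\<close> chosen generators;
    \<open>G\<close> always adds one of least degree bound among the elements of \<open>I\<close>
    outside the ideal generated so far.\<close>
  define H where "H = rec_nat {} (\<lambda>_ J. insert (G J) J)"
  have H_simps: "H 0 = {}" "H (Suc k) = insert (G (H k)) (H k)" for k
    by (simp_all add: H_def)
  have H: "finite (H k) \<and> H k \<subseteq> I" for k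
  proof (induction k)
    case (Suc k)
    then have "G (H k) \<in> I" using G[of "H k"] by (auto simp: P_def)
    with Suc show ?case by (simp add: H_simps)
  qed (simp add: H_simps)
  define g where "g k = G (H k)" for k
  define d where "d k = deg (H k)" for k
  have H_eq: "H k = g ` {..<k}" for k
    by (induction k) (auto simp: H_simps g_def lessThan_Suc)
  have g: "P (g ` {..<k}) (g k) (d k)" for k
    using G[of "H k"] H[of k] by (simp only: g_def[symmetric] d_def[symmetric] H_eq[symmetric])
  have d_min: "d k \<le> n" if "P (g ` {..<k}) h n" for k h n
    using deg_le[of "H k" h n] that by (simp only: d_def H_eq[symmetric])
  have d_mono: "d i \<le> d k" if "i \<le> k" for i k
  proof (rule d_min)
    have "g k \<notin> ideal_gen S (g ` {..<i})"
      using g[of k] ideal_gen_mono[of "g ` {..<i}" "g ` {..<k}" S] that unfolding P_def by force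
    then show "P (g ` {..<i}) (g k) (d k)" using g[of k] by (auto simp: P_def)
  qed
  have d_pos: "d k \<noteq> 0" for k
  proof
    assume "d k = 0"
    then have "g k = (\<lambda>x. 0)" using g[of k] by (auto simp: P_def polys_in_def)
    then show False using g[of k] by (auto simp: P_def intro: ideal_gen.zero)
  qed
  \<comment> \<open>\<open>d k\<close> bounds the degree strictly, so the top term has exponent
    \<open>d k - 1\<close>; by \<open>d_pos\<close> this subtraction is not cut off at 0.\<close>
  have "\<exists>al. fst al \<in> R \<and> snd al \<in> polys_in R z (d k - 1) \<and>
      g k = (\<lambda>x. fst al x * z x ^ (d k - 1) + snd al x)" for k
  proof -
    obtain c where c: "\<forall>i. c i \<in> R" "g k = (\<lambda>x. \<Sum>i<d k. c i x * z x ^ i)"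
      using g[of k] by (auto simp: P_def polys_in_def)
    obtain e where "d k = Suc e" using d_pos[of k] not0_implies_Suc by blast
    then have "g k = (\<lambda>x. c (d k - 1) x * z x ^ (d k - 1) + (\<Sum>i<d k - 1. c i x * z x ^ i))"
      unfolding c(2) by (simp add: add.commute)
    moreover have "(\<lambda>x. \<Sum>i<d k - 1. c i x * z x ^ i) \<in> polys_in R z (d k - 1)"
      using c(1) by (auto simp: polys_in_def)
    ultimately show ?thesis
      using c(1) by (intro exI[of _ "(c (d k - 1), \<lambda>x. \<Sum>i<d k - 1. c i x * z x ^ i)"]) simp
  qed
  then have "\<exists>al. \<forall>k. fst (al k) \<in> R \<and> snd (al k) \<in> polys_in R z (d k - 1) \<and>
      g k = (\<lambda>x. fst (al k) x * z x ^ (d k - 1) + snd (al k) x)"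
    by (intro choice allI)
  then obtain al where al: "\<forall>k. fst (al k) \<in> R \<and> snd (al k) \<in> polys_in R z (d k - 1) \<and>
      g k = (\<lambda>x. fst (al k) x * z x ^ (d k - 1) + snd (al k) x)" ..
  define a where "a k = fst (al k)" for k
  define l where "l k = snd (al k)" for k
  have a: "a k \<in> R" and l: "l k \<in> polys_in R z (d k - 1)"
    and gk: "g k = (\<lambda>x. a k x * z x ^ (d k - 1) + l k x)" for k
    using al by (auto simp: a_def l_def)
  obtain k where k: "a k \<in> ideal_gen R (a ` {..<k})"
    using noeth[unfolded noetherian_def, rule_format, of a] a by auto
  \<comment> \<open>A combination of earlier leading coefficients lifts to a combination
    \<open>h\<close> of earlier generators that has it as coefficient at
    \<open>d k - 1\<close>.\<close>
  have "\<exists>h\<in>ideal_gen S (g ` {..<k}). \<exists>m\<in>polys_in R z (d k - 1).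
      h = (\<lambda>x. b x * z x ^ (d k - 1) + m x)" if "b \<in> ideal_gen R (a ` {..<k})" for b
    using that
  proof induction
    case zero
    then show ?case
      using polys_in_zero[OF R]
      by (intro bexI[of _ "\<lambda>x. 0"]) (auto intro!: ideal_gen.zero bexI[of _ "\<lambda>x. 0"])
  next
    case (gen b)
    then obtain i where i: "i < k" "b = a i" by auto
    \<comment> \<open>Multiplying by this power of \<open>z\<close> raises \<open>g i\<close> to the
      degree bound of \<open>g k\<close>; the subtraction is exact by \<open>d_mono\<close>.\<close>
    let ?e = "d k - d i"
    have e: "d i - 1 + ?e = d k - 1" using d_mono[of i k] i d_pos[of i] by simp
    have e1: "(\<lambda>x. z x ^ ?e * g i x) \<in> ideal_gen S (g ` {..<k})"
      using i by (intro ideal_gen.mult zS ideal_gen.gen) auto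
    have e2: "(\<lambda>x. 1 * z x ^ ?e * l i x) \<in> polys_in R z (d k - 1)"
      using e by (intro polys_in_mult_power[OF R l] function_ring_const[OF R]) simp
    have e3: "(\<lambda>x. z x ^ ?e * g i x) = (\<lambda>x. b x * z x ^ (d k - 1) + 1 * z x ^ ?e * l i x)"
    proof
      fix x
      have "z x ^ (d k - 1) = z x ^ (d i - 1) * z x ^ ?e"
        by (simp only: e[symmetric] power_add)
      then show "z x ^ ?e * g i x = b x * z x ^ (d k - 1) + 1 * z x ^ ?e * l i x"
        by (simp only: gk i(2) algebra_simps)
    qed
    show ?case by (rule bexI[OF _ e1], rule bexI[OF _ e2], rule e3)
  next
    case (add b c)
    from add.IH(1) obtain h m where 1: "h \<in> ideal_gen S (g ` {..<k})"
        "m \<in> polys_in R z (d k - 1)" "h = (\<lambda>x. b x * z x ^ (d k - 1) + m x)" by blast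
    from add.IH(2) obtain h' m' where 2: "h' \<in> ideal_gen S (g ` {..<k})"
        "m' \<in> polys_in R z (d k - 1)" "h' = (\<lambda>x. c x * z x ^ (d k - 1) + m' x)" by blast
    have "(\<lambda>x. h x + h' x) = (\<lambda>x. (b x + c x) * z x ^ (d k - 1) + (m x + m' x))"
      by (simp add: 1 2 algebra_simps)
    then show ?case
      by (rule bexI[OF _ ideal_gen.add[OF 1(1) 2(1)], OF bexI[OF _ polys_in_add[OF R 1(2) 2(2)]]])
  next
    case (mult c b)
    then obtain h m where 1: "h \<in> ideal_gen S (g ` {..<k})" "m \<in> polys_in R z (d k - 1)"
        "h = (\<lambda>x. b x * z x ^ (d k - 1) + m x)" by blast
    have e3: "(\<lambda>x. c x * h x) = (\<lambda>x. (c x * b x) * z x ^ (d k - 1) + c x * z x ^ 0 * m x)"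
      by (simp add: 1 algebra_simps)
    have e2: "(\<lambda>x. c x * z x ^ 0 * m x) \<in> polys_in R z (d k - 1)"
      by (rule polys_in_mult_power[OF R 1(2) mult(1)]) simp
    have e1: "(\<lambda>x. c x * h x) \<in> ideal_gen S (g ` {..<k})"
      using mult(1) RS by (intro ideal_gen.mult 1) auto
    show ?case by (rule bexI[OF _ e1], rule bexI[OF _ e2], rule e3)
  qed
  from this[OF k] obtain h m where h: "h \<in> ideal_gen S (g ` {..<k})"
    and m: "m \<in> polys_in R z (d k - 1)" "h = (\<lambda>x. a k x * z x ^ (d k - 1) + m x)"
    by (elim bexE)
  \<comment> \<open>The top terms cancel, so \<open>r\<close> is still outside the ideal of the
    earlier generators but has a smaller degree bound, against \<open>d_min\<close>.\<close>
  define r where "r = (\<lambda>x. g k x + - 1 * h x)"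
  have c1: "(\<lambda>x. - 1) \<in> S" by (rule function_ring_const[OF S])
  have HI: "g ` {..<k} \<subseteq> I" and gI: "g k \<in> I"
    using H[of k] g[of k] by (auto simp: H_eq P_def)
  have "h \<in> I"
    using ideal_gen_least[OF h, of "range f"] HI by (simp add: I_def)
  then have "(\<lambda>x. - 1 * h x) \<in> I"
    unfolding I_def by (rule ideal_gen.mult[OF c1])
  with gI have "r \<in> I"
    unfolding r_def I_def by (rule ideal_gen.add)
  moreover have "r \<notin> ideal_gen S (g ` {..<k})"
  proof
    assume "r \<in> ideal_gen S (g ` {..<k})"
    then have "(\<lambda>x. r x + h x) \<in> ideal_gen S (g ` {..<k})" using h by (rule ideal_gen.add)
    then show False using g[of k] by (simp add: r_def P_def)
  qed
  moreover have "r \<in> polys_in R z (d k - 1)"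
  proof -
    have "r = (\<lambda>x. l k x + - 1 * z x ^ 0 * m x)" by (simp add: r_def gk m)
    also have "\<dots> \<in> polys_in R z (d k - 1)"
      by (intro polys_in_add[OF R l] polys_in_mult_power[OF R m(1)] function_ring_const[OF R]) simp
    finally show ?thesis .
  qed
  ultimately have "d k \<le> d k - 1" by (intro d_min[of k r]) (simp add: P_def)
  then show False using d_pos[of k] by simp
qed

lemma noetherian_rpoly:
  fixes V :: "'v set"
  assumes "finite V" shows "noetherian (rpoly V)"
  using assms
proof induction
  case empty
  have const: "\<exists>c. f = (\<lambda>x. c)" if "f \<in> rpoly {}" for f :: "('v \<Rightarrow> real) \<Rightarrow> real"
    using that by induction auto
  show ?case
    unfolding noetherian_def
  proof (intro allI impI)
    fix f :: "nat \<Rightarrow> ('v \<Rightarrow> real) \<Rightarrow> real" assume f: "range f \<subseteq> rpoly {}"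
    then obtain a b where ab: "f 0 = (\<lambda>x. a)" "f 1 = (\<lambda>x. b)"
      using const[of "f 0"] const[of "f 1"] by blast
    \<comment> \<open>Only constants remain: a zero \<open>f 0\<close> lies in the ideal of the
      empty set, and a nonzero one divides \<open>f 1\<close>.\<close>
    show "\<exists>k. f k \<in> ideal_gen (rpoly {}) (f ` {..<k})"
    proof (cases "a = 0")
      case True
      then show ?thesis using ab by (intro exI[of _ 0]) (auto intro: ideal_gen.zero)
    next
      case False
      have "(\<lambda>x. (b / a) * f 0 x) \<in> ideal_gen (rpoly {}) (f ` {..<1})"
        by (intro ideal_gen.mult rpoly.const ideal_gen.gen) auto
      moreover have "f 1 = (\<lambda>x. (b / a) * f 0 x)" using False unfolding ab by simp
      ultimately show ?thesis by (intro exI[of _ 1]) (simp only:)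
    qed
  qed
next
  case (insert v V)
  have "rpoly (insert v V) = (\<Union>n. polys_in (rpoly V) (\<lambda>x. x v) n)"
  proof (rule subset_antisym)
    show "rpoly (insert v V) \<subseteq> (\<Union>n. polys_in (rpoly V) (\<lambda>x. x v) n)"
      using rpoly_insert[of _ v V] by auto
    show "(\<Union>n. polys_in (rpoly V) (\<lambda>x. x v) n) \<subseteq> rpoly (insert v V)"
    proof (rule subsetI)
      fix f assume "f \<in> (\<Union>n. polys_in (rpoly V) (\<lambda>x. x v) n)"
      then obtain n c where c: "\<forall>i. c i \<in> rpoly V" "f = (\<lambda>x. \<Sum>i<n. c i x * x v ^ i)"
        by (auto simp: polys_in_def)
      have "c i \<in> rpoly (insert v V)" for i using c(1) rpoly_mono[of V "insert v V"] by auto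
      then show "f \<in> rpoly (insert v V)"
        unfolding c(2)
        by (intro function_ring_sum function_ring_mult function_ring_power function_ring_rpoly)
           (auto intro: rpoly.coord)
    qed
  qed
  then show ?case using noetherian_polys_in[OF function_ring_rpoly insert.IH] by (simp only:)
qed

text \<open>An element of the ideal of \<open>Q\<close> vanishes wherever \<open>Q\<close> does. If
  no finite \<open>Q\<close> cut out the zeros of \<open>P\<close>, each would leave an element of
  \<open>P\<close> outside its ideal, and choosing such elements in turn would contradict
  \<open>noetherian\<close>.\<close>

lemma noetherian_finite_zero_set:
  assumes "noetherian R" "P \<subseteq> R"
  shows "\<exists>Q\<subseteq>P. finite Q \<and> (\<forall>x. (\<forall>p\<in>Q. p x = 0) \<longrightarrow> (\<forall>p\<in>P. p x = 0))"
proof (rule ccontr)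
  assume *: "\<not> ?thesis"
  define G where "G Q = (SOME p. p \<in> P \<and> p \<notin> ideal_gen R Q)" for Q
  have G: "G Q \<in> P \<and> G Q \<notin> ideal_gen R Q" if "finite Q" "Q \<subseteq> P" for Q
  proof -
    have "\<not> (\<forall>x. (\<forall>p\<in>Q. p x = 0) \<longrightarrow> (\<forall>p\<in>P. p x = 0))"
      using * that by (simp only: not_ex) simp
    then obtain x p where "\<forall>p\<in>Q. p x = 0" "p \<in> P" "p x \<noteq> 0" by auto
    then have "p \<in> P \<and> p \<notin> ideal_gen R Q" using ideal_gen_zero[of p R Q x] by auto
    then show ?thesis unfolding G_def by (rule someI[where P = "\<lambda>p. p \<in> P \<and> p \<notin> ideal_gen R Q"])
  qed
  define H where "H = rec_nat {} (\<lambda>_ Q. insert (G Q) Q)"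
  have H_simps: "H 0 = {}" "H (Suc k) = insert (G (H k)) (H k)" for k
    by (simp_all add: H_def)
  have H: "finite (H k) \<and> H k \<subseteq> P" for k
    by (induction k) (use G in \<open>auto simp: H_simps\<close>)
  define g where "g k = G (H k)" for k
  have H_eq: "H k = g ` {..<k}" for k
    by (induction k) (auto simp: H_simps g_def lessThan_Suc)
  have "range g \<subseteq> R" using G H assms(2) by (auto simp: g_def)
  then obtain k where "g k \<in> ideal_gen R (g ` {..<k})"
    using assms(1)[unfolded noetherian_def, rule_format, of g] by auto
  then show False using G[of "H k"] H[of k] by (simp only: H_eq[symmetric] g_def[symmetric])
qed

section \<open>Matching the signs of univariate polynomials\<close>

definition order_iso :: "(real \<Rightarrow> real) \<Rightarrow> bool" where
  "order_iso h \<longleftrightarrow> strict_mono h \<and> surj h"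

lemma order_iso_less_iff: "order_iso h \<Longrightarrow> h s < h t \<longleftrightarrow> s < t"
  by (simp add: order_iso_def strict_mono_less)

lemma order_iso_surj: "order_iso h \<Longrightarrow> \<exists>s. t = h s"
  by (auto simp: order_iso_def surj_def)

lemma order_iso_comp: "order_iso h \<Longrightarrow> order_iso k \<Longrightarrow> order_iso (\<lambda>t. h (k t))"
  using comp_surj[of k h] by (auto simp: order_iso_def strict_mono_def comp_def)

text \<open>For \<open>r\<close> and \<open>s\<close> strictly between \<open>a\<close> and
  \<open>b\<close>, the piecewise linear bijection of the line that carries \<open>r\<close> to
  \<open>s\<close> and is the identity outside that interval. Exchanging \<open>r\<close> and
  \<open>s\<close> inverts it.\<close>

definition bend :: "real \<Rightarrow> real \<Rightarrow> real \<Rightarrow> real \<Rightarrow> real \<Rightarrow> real" where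
  "bend a b r s t = (if t \<le> a \<or> b \<le> t then t
     else if t \<le> r then a + (t - a) * ((s - a) / (r - a)) else b - (b - t) * ((b - s) / (b - r)))"

lemma bend_values:
  assumes "a < r" "r < b" "a < s" "s < b"
  shows "a < t \<Longrightarrow> t \<le> r \<Longrightarrow> bend a b r s t = a + (t - a) * ((s - a) / (r - a))"
    and "r < t \<Longrightarrow> t < b \<Longrightarrow> bend a b r s t = b - (b - t) * ((b - s) / (b - r))"
    and "a < t \<Longrightarrow> t \<le> r \<Longrightarrow> a < bend a b r s t \<and> bend a b r s t \<le> s"
    and "r < t \<Longrightarrow> t < b \<Longrightarrow> s < bend a b r s t \<and> bend a b r s t < b"
    and "bend a b r s r = s"
proof -
  show 1: "bend a b r s t = a + (t - a) * ((s - a) / (r - a))" if "a < t" "t \<le> r"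
    using assms that by (auto simp: bend_def)
  show 2: "bend a b r s t = b - (b - t) * ((b - s) / (b - r))" if "r < t" "t < b"
    using assms that by (auto simp: bend_def)
  show "a < bend a b r s t \<and> bend a b r s t \<le> s" if "a < t" "t \<le> r"
  proof -
    have "(t - a) * (s - a) \<le> (r - a) * (s - a)" "0 < (t - a) * (s - a)"
      using assms that by (auto intro: mult_right_mono)
    then show ?thesis using assms by (simp add: 1[OF that] field_simps)
  qed
  show "s < bend a b r s t \<and> bend a b r s t < b" if "r < t" "t < b"
  proof -
    have "(b - t) * (b - s) < (b - r) * (b - s)" "0 < (b - t) * (b - s)"
      using assms that by auto
    then show ?thesis using assms by (simp add: 2[OF that] field_simps)
  qed
  show "bend a b r s r = s"
    using assms by (auto simp: bend_def)
qed

lemma bend_bend: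
  assumes "a < r" "r < b" "a < s" "s < b"
  shows "bend a b s r (bend a b r s t) = t"
proof -
  consider "t \<le> a \<or> b \<le> t" | "a < t" "t \<le> r" | "r < t" "t < b" by linarith
  then show ?thesis
  proof cases
    case 1
    then show ?thesis by (simp add: bend_def)
  next
    case 2
    have "bend a b s r (bend a b r s t) = a + (bend a b r s t - a) * ((r - a) / (s - a))"
      using bend_values(1)[of a s b r "bend a b r s t"] bend_values(3)[of a r b s t] assms 2 by auto
    also have "\<dots> = t"
      using assms by (simp add: bend_values(1)[OF assms 2])
    finally show ?thesis .
  next
    case 3
    have "bend a b s r (bend a b r s t) = b - (b - bend a b r s t) * ((b - r) / (b - s))"
      using bend_values(2)[of a s b r "bend a b r s t"] bend_values(4)[of a r b s t] assms 3 by auto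
    also have "\<dots> = t"
      using assms by (simp add: bend_values(2)[OF assms 3])
    finally show ?thesis .
  qed
qed

lemma order_iso_bend:
  assumes "a < r" "r < b" "a < s" "s < b"
  shows "order_iso (bend a b r s)"
proof -
  have "bend a b r s t < bend a b r s u" if tu: "t < u" for t u
  proof -
    have 1: "bend a b r s t = t" if "t \<le> a \<or> b \<le> t" for t using that by (simp add: bend_def)
    have 2: "bend a b r s t < bend a b r s u" if "a < t" "u \<le> r"
    proof -
      have "(t - a) * ((s - a) / (r - a)) < (u - a) * ((s - a) / (r - a))"
        using assms tu by (intro mult_strict_right_mono) auto
      then show ?thesis
        using bend_values(1)[OF assms, of t] bend_values(1)[OF assms, of u] that tu by simp
    qed
    have 3: "bend a b r s t < bend a b r s u" if "r < t" "u < b"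
    proof -
      have "(b - u) * ((b - s) / (b - r)) < (b - t) * ((b - s) / (b - r))"
        using assms tu by (intro mult_strict_right_mono) auto
      then show ?thesis
        using bend_values(2)[OF assms, of t] bend_values(2)[OF assms, of u] that tu by simp
    qed
    show ?thesis
      using tu assms 1[of t] 1[of u] 2 3 bend_values(3,4)[OF assms, of t] bend_values(3,4)[OF assms, of u]
      by (smt (verit))
  qed
  moreover have "surj (bend a b r s)"
    using bend_bend[of a s b r] assms by (metis surj_def)
  ultimately show ?thesis by (auto simp: order_iso_def strict_mono_def)
qed

section \<open>Matching two polynomials that are monotone in the gaps between marked points\<close>

definition incr_on :: "real \<Rightarrow> real \<Rightarrow> real poly \<Rightarrow> bool" where
  "incr_on a b p \<longleftrightarrow> (\<forall>x y. a \<le> x \<longrightarrow> x < y \<longrightarrow> y \<le> b \<longrightarrow> poly p x < poly p y)"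

lemma incr_on_pderiv:
  assumes "\<And>x. a < x \<Longrightarrow> x < b \<Longrightarrow> poly (pderiv p) x > 0"
  shows "incr_on a b p"
  unfolding incr_on_def
proof (intro allI impI)
  fix x y assume xy: "a \<le> x" "x < y" "y \<le> b"
  obtain z where z: "x < z" "z < y" "poly p y - poly p x = (y - x) * poly (pderiv p) z"
    using poly_MVT[OF xy(2), of p] by blast
  have "poly (pderiv p) z > 0" using assms z xy by auto
  then have "(y - x) * poly (pderiv p) z > 0" using xy by simp
  with z show "poly p x < poly p y" by simp
qed

lemma incr_onD: "incr_on a b p \<Longrightarrow> a \<le> x \<Longrightarrow> x < y \<Longrightarrow> y \<le> b \<Longrightarrow> poly p x < poly p y"
  by (auto simp: incr_on_def)

lemma sgn_real_eq_iff: "sgn (a :: real) = sgn b \<longleftrightarrow> (a < 0 \<longleftrightarrow> b < 0) \<and> (a > 0 \<longleftrightarrow> b > 0)"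
  by (auto simp: sgn_real_def)

lemma poly_sgn_const:
  assumes "s \<le> t" "\<And>r. s \<le> r \<Longrightarrow> r \<le> t \<Longrightarrow> poly p r \<noteq> (0 :: real)"
  shows "sgn (poly p s) = sgn (poly p t)"
proof (rule ccontr)
  assume neq: "sgn (poly p s) \<noteq> sgn (poly p t)"
  then have "s < t" using assms(1) by (cases "s = t") auto
  moreover have "poly p s * poly p t < 0"
    using neq assms(2)[of s] assms(2)[of t] \<open>s < t\<close>
    by (auto simp: sgn_real_def mult_less_0_iff split: if_splits)
  ultimately obtain r where "s < r" "r < t" "poly p r = 0" using poly_IVT by blast
  then show False using assms(2)[of r] by auto
qed

lemma gap_exists:
  fixes t :: real
  assumes "finite D" "t \<notin> D" "\<not> (\<forall>d\<in>D. t < d)" "\<not> (\<forall>d\<in>D. d < t)"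
  obtains a b where "a \<in> D" "b \<in> D" "a < t" "t < b" "{a<..<b} \<inter> D = {}"
proof
  have ne: "{d \<in> D. d < t} \<noteq> {}" "{d \<in> D. t < d} \<noteq> {}"
    using assms by (auto simp: not_less le_less)
  have fin: "finite {d \<in> D. d < t}" "finite {d \<in> D. t < d}" using assms(1) by auto
  show "Max {d \<in> D. d < t} \<in> D" "Max {d \<in> D. d < t} < t"
    using Max_in[OF fin(1) ne(1)] by auto
  show "Min {d \<in> D. t < d} \<in> D" "t < Min {d \<in> D. t < d}"
    using Min_in[OF fin(2) ne(2)] by auto
  show "{Max {d \<in> D. d < t}<..<Min {d \<in> D. t < d}} \<inter> D = {}"
  proof (rule ccontr)
    assume "\<not> ?thesis"
    then obtain d where d: "d \<in> D" "Max {d \<in> D. d < t} < d" "d < Min {d \<in> D. t < d}" by auto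
    then have "d \<noteq> t" using assms(2) by auto
    then show False
      using d Max_ge[OF fin(1), of d] Min_le[OF fin(2), of d] by fastforce
  qed
qed

definition outer :: "real set \<Rightarrow> real \<Rightarrow> bool" where
  "outer D t \<longleftrightarrow> (\<forall>d\<in>D. t < d) \<or> (\<forall>d\<in>D. d < t)"

text \<open>Signs already agree on \<open>D\<close> and beyond its extremes, and in each gap
  \<open>p\<close> and, along \<open>h\<close>, \<open>q\<close> are strictly monotone in the same
  sense. Only the position of the at most one root in a gap can still be wrong. Decrease is encoded
  as increase of the negative.\<close>

definition matched :: "real set \<Rightarrow> real poly \<Rightarrow> real poly \<Rightarrow> (real \<Rightarrow> real) \<Rightarrow> bool" where
  "matched D p q h \<longleftrightarrow> order_iso h \<and> (\<forall>d\<in>D. sgn (poly p d) = sgn (poly q (h d))) \<and>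
     (\<forall>t. outer D t \<longrightarrow> sgn (poly p t) = sgn (poly q (h t))) \<and>
     (\<forall>a\<in>D. \<forall>b\<in>D. a < b \<longrightarrow> {a<..<b} \<inter> D = {} \<longrightarrow>
        incr_on a b p \<and> incr_on (h a) (h b) q \<or> incr_on a b (- p) \<and> incr_on (h a) (h b) (- q))"

lemma incr_gap_root:
  assumes h: "order_iso h" and p: "incr_on a b p" and q: "incr_on (h a) (h b) q"
    and ends: "sgn (poly p a) = sgn (poly q (h a))" "sgn (poly p b) = sgn (poly q (h b))"
    and r: "a < r" "r < b" "poly p r = 0"
  shows "\<exists>s. h a < s \<and> s < h b \<and> poly q s = 0"
proof -
  have "poly p a < 0" "poly p b > 0"
    using incr_onD[OF p, of a r] incr_onD[OF p, of r b] r by auto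
  then have "poly q (h a) < 0" "poly q (h b) > 0"
    using ends unfolding sgn_real_eq_iff by auto
  moreover have "h a < h b" using r by (simp add: order_iso_less_iff[OF h])
  ultimately show ?thesis using poly_IVT_pos[of "h a" "h b" q] by auto
qed

text \<open>A wrong sign of \<open>q\<close> at \<open>h t\<close> would by monotonicity fix its
  sign at one end, hence that of \<open>p\<close> there. Then \<open>p\<close> has a root between
  that end and \<open>t\<close>, and the vanishing of \<open>q\<close> at the image of this root
  contradicts monotonicity.\<close>

lemma incr_gap_sgn:
  assumes h: "order_iso h" and p: "incr_on a b p" and q: "incr_on (h a) (h b) q"
    and ends: "sgn (poly p a) = sgn (poly q (h a))" "sgn (poly p b) = sgn (poly q (h b))"
    and roots: "\<And>r. a < r \<Longrightarrow> r < b \<Longrightarrow> poly p r = 0 \<Longrightarrow> poly q (h r) = 0"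
    and t: "a < t" "t < b"
  shows "sgn (poly p t) = sgn (poly q (h t))"
proof -
  note hl = order_iso_less_iff[OF h]
  have q': "poly q (h x) < poly q (h y)" if "a \<le> x" "x < y" "y \<le> b" for x y
    using that incr_onD[OF q, of "h x" "h y"] h by (auto simp: order_iso_def strict_mono_less_eq strict_mono_less)
  have p': "poly p x < poly p y" if "a \<le> x" "x < y" "y \<le> b" for x y
    using that incr_onD[OF p] by auto
  consider "poly p t = 0" | "poly p t > 0" | "poly p t < 0" by linarith
  then show ?thesis
  proof cases
    case 1
    then show ?thesis using roots[OF t] by simp
  next
    case 2
    have "poly q (h t) > 0"
    proof (rule ccontr)
      assume neg: "\<not> poly q (h t) > 0"
      then have "poly q (h a) < 0" using q'[of a t] t by auto
      then have "poly p a < 0" using ends unfolding sgn_real_eq_iff by auto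
      then obtain r where "a < r" "r < t" "poly p r = 0"
        using poly_IVT_pos[of a t p] t 2 by blast
      then show False using roots[of r] q'[of r t] t neg by auto
    qed
    with 2 show ?thesis by simp
  next
    case 3
    have "poly q (h t) < 0"
    proof (rule ccontr)
      assume neg: "\<not> poly q (h t) < 0"
      then have "poly q (h b) > 0" using q'[of t b] t by auto
      then have "poly p b > 0" using ends unfolding sgn_real_eq_iff by auto
      then obtain r where "t < r" "r < b" "poly p r = 0"
        using poly_IVT_pos[of t b p] t 3 by blast
      then show False using roots[of r] q'[of t r] t neg by auto
    qed
    with 3 show ?thesis by simp
  qed
qed

lemma matched_root:
  assumes "matched D p q h" "a \<in> D" "b \<in> D" "{a<..<b} \<inter> D = {}" "a < r" "r < b" "poly p r = 0"
  shows "\<exists>s. h a < s \<and> s < h b \<and> poly q s = 0"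
proof -
  have h: "order_iso h" and
    ends: "sgn (poly p a) = sgn (poly q (h a))" "sgn (poly p b) = sgn (poly q (h b))"
    using assms by (auto simp: matched_def)
  consider "incr_on a b p" "incr_on (h a) (h b) q" | "incr_on a b (- p)" "incr_on (h a) (h b) (- q)"
    using assms unfolding matched_def by (meson less_trans)
  then show ?thesis
  proof cases
    case 1
    then show ?thesis using incr_gap_root[OF h _ _ ends assms(5-7)] by blast
  next
    case 2
    then show ?thesis
      using incr_gap_root[OF h 2 _ _ assms(5,6)] ends assms(7) by (auto simp: sgn_minus)
  qed
qed

text \<open>Sending roots of \<open>p\<close> to roots of \<open>q\<close> is enough, since within a
  gap monotonicity and the signs at the ends settle everything else.\<close>

lemma matched_sgn:
  assumes D: "finite D" and m: "matched D p q h"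
    and roots: "\<And>r. poly p r = 0 \<Longrightarrow> poly q (h r) = 0"
  shows "sgn (poly p t) = sgn (poly q (h t))"
proof (cases "t \<in> D \<or> outer D t")
  case True
  then show ?thesis using m by (auto simp: matched_def)
next
  case False
  then obtain a b where ab: "a \<in> D" "b \<in> D" "a < t" "t < b" "{a<..<b} \<inter> D = {}"
    using gap_exists[OF D, of t] by (auto simp: outer_def)
  have h: "order_iso h" and
    ends: "sgn (poly p a) = sgn (poly q (h a))" "sgn (poly p b) = sgn (poly q (h b))"
    using m ab by (auto simp: matched_def)
  consider "incr_on a b p" "incr_on (h a) (h b) q" | "incr_on a b (- p)" "incr_on (h a) (h b) (- q)"
    using m ab unfolding matched_def by (meson less_trans)
  then show ?thesis
  proof cases
    case 1
    then show ?thesis using incr_gap_sgn[OF h 1 ends roots ab(3,4)] by blast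
  next
    case 2
    have "sgn (poly (- p) t) = sgn (poly (- q) (h t))"
      by (rule incr_gap_sgn[OF h 2 _ _ _ ab(3,4)]) (use ends roots in \<open>auto simp: sgn_minus\<close>)
    then show ?thesis by (simp add: sgn_minus)
  qed
qed

lemma gap_unique_root:
  assumes "incr_on a b p \<or> incr_on a b (- p)" "a < r" "r < b" "a < s" "s < b"
    "poly p r = 0" "poly p s = 0"
  shows "r = s"
proof (rule ccontr)
  assume "r \<noteq> s"
  then consider "r < s" | "s < r" by linarith
  then show False
    using assms incr_onD[of a b p r s] incr_onD[of a b p s r]
      incr_onD[of a b "- p" r s] incr_onD[of a b "- p" s r] by cases auto
qed

text \<open>Induction on the number of roots of \<open>p\<close> that \<open>h\<close> does not send
  to roots of \<open>q\<close>. Each bend repairs one of them and stays inside a gap, where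
  \<open>p\<close> has no second root that it could spoil.\<close>

lemma match_all_roots:
  assumes D: "finite D" and p: "p \<noteq> 0" and "matched D p q h"
  shows "\<exists>h'. order_iso h' \<and> (\<forall>t. t \<in> D \<or> outer D t \<longrightarrow> h' t = h t) \<and>
           (\<forall>t. sgn (poly p t) = sgn (poly q (h' t)))"
  using assms(3)
proof (induction "card {t. poly p t = 0 \<and> poly q (h t) \<noteq> 0}" arbitrary: h rule: less_induct)
  case less
  define N where "N h = {t. poly p t = 0 \<and> poly q (h t) \<noteq> 0}" for h
  have finN: "finite (N h)" for h
    using poly_roots_finite[OF p] by (rule rev_finite_subset) (auto simp: N_def)
  have h: "order_iso h" using less.prems by (simp add: matched_def)
  show ?case
  proof (cases "N h = {}")
    case True
    then have "sgn (poly p t) = sgn (poly q (h t))" for t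
      by (intro matched_sgn[OF D less.prems]) (auto simp: N_def)
    then show ?thesis using h by auto
  next
    case False
    then obtain r where r: "poly p r = 0" "poly q (h r) \<noteq> 0" by (auto simp: N_def)
    then have "sgn (poly p r) \<noteq> sgn (poly q (h r))" by (auto simp: sgn_0_0)
    then have "r \<notin> D" "\<not> outer D r" using less.prems by (auto simp: matched_def)
    then obtain a b where ab: "a \<in> D" "b \<in> D" "a < r" "r < b" "{a<..<b} \<inter> D = {}"
      using gap_exists[OF D, of r] by (auto simp: outer_def)
    obtain s' where s': "h a < s'" "s' < h b" "poly q s' = 0"
      using matched_root[OF less.prems ab(1,2,5,3,4) r(1)] by blast
    obtain s where s: "s' = h s" using order_iso_surj[OF h] by blast
    with s' have s_ab: "a < s" "s < b" by (simp_all add: order_iso_less_iff[OF h])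
    \<comment> \<open>\<open>bend\<close> acts on the source line: it moves \<open>r\<close> to the
      preimage \<open>s\<close> of a root of \<open>q\<close>, so that \<open>h (k r)\<close> is
      that root.\<close>
    define k where "k = bend a b r s"
    have k: "order_iso k" and kr: "k r = s"
      using order_iso_bend[OF ab(3,4) s_ab] bend_values(5)[OF ab(3,4) s_ab] by (simp_all add: k_def)
    have k_out: "k t = t" if "t \<le> a \<or> b \<le> t" for t using that by (simp add: k_def bend_def)
    have kD: "k t = t" if "t \<in> D \<or> outer D t" for t
    proof (rule k_out, rule ccontr)
      assume "\<not> (t \<le> a \<or> b \<le> t)"
      then have "a < t" "t < b" by auto
      then show False using that ab(1,2,5) by (auto simp: outer_def)
    qed
    define g where "g t = h (k t)" for t
    have g: "g t = h t" if "t \<in> D \<or> outer D t" for t by (simp add: g_def kD[OF that])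
    have m: "matched D p q g"
      using less.prems order_iso_comp[OF h k] unfolding matched_def by (simp add: kD g_def[abs_def])
    have "N g \<subset> N h"
    proof
      show "N g \<subseteq> N h"
      proof
        fix t assume t: "t \<in> N g"
        show "t \<in> N h"
        proof (cases "t \<le> a \<or> b \<le> t")
          case True
          then show ?thesis using t k_out[OF True] by (simp add: N_def g_def)
        next
          case False
          have "a < b" using ab by simp
          then have "incr_on a b p \<or> incr_on a b (- p)"
            using less.prems ab unfolding matched_def by blast
          then have "t = r"
            using gap_unique_root[of a b p t r] False t r ab by (auto simp: N_def)
          then show ?thesis using r by (simp add: N_def)
        qed
      qed
      show "N g \<noteq> N h"
      proof -
        have "g r = s'" by (simp only: g_def kr s)
        then have "r \<notin> N g" using s'(3) by (simp add: N_def)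
        moreover have "r \<in> N h" using r by (simp add: N_def)
        ultimately show ?thesis by blast
      qed
    qed
    then have "card (N g) < card (N h)" using finN by (simp add: psubset_card_mono)
    then obtain h' where "order_iso h'" "\<forall>t. t \<in> D \<or> outer D t \<longrightarrow> h' t = g t"
      "\<forall>t. sgn (poly p t) = sgn (poly q (h' t))"
      using less.hyps[OF _ m] unfolding N_def by blast
    then show ?thesis using g by (intro exI[of _ h']) auto
  qed
qed

lemma poly_sgn_at_top:
  assumes "p \<noteq> (0 :: real poly)"
  shows "\<exists>T. \<forall>t\<ge>T. sgn (poly p t) = sgn (lead_coeff p)"
proof -
  have pos: "\<exists>T. \<forall>t\<ge>T. poly p t > 0" if "lead_coeff p > 0" for p :: "real poly"
    using poly_pinfty_gt_lc[OF that] that by (meson less_le_trans)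
  consider "lead_coeff p > 0" | "lead_coeff (- p) > 0"
    using assms by (metis lead_coeff_minus leading_coeff_0_iff neg_0_less_iff_less linorder_less_linear)
  then show ?thesis
  proof cases
    case 1
    then show ?thesis using pos[OF 1] by (metis sgn_pos)
  next
    case 2
    then have "lead_coeff p < 0" by (simp add: lead_coeff_minus)
    then show ?thesis using pos[OF 2] by (metis neg_0_less_iff_less poly_minus sgn_neg)
  qed
qed

lemma poly_sgn_at_bot:
  assumes "p \<noteq> (0 :: real poly)"
  shows "\<exists>T. \<forall>t\<le>T. sgn (poly p t) = (-1) ^ degree p * sgn (lead_coeff p)"
proof -
  define q where "q = pcompose p [:0, -1:]"
  have lc: "lead_coeff q = lead_coeff p * (-1) ^ degree p"
    unfolding q_def by (subst lead_coeff_comp) auto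
  have "q \<noteq> 0" using lc assms by auto
  then obtain T where T: "\<forall>t\<ge>T. sgn (poly q t) = sgn (lead_coeff q)" using poly_sgn_at_top by blast
  have "sgn (poly p t) = (-1) ^ degree p * sgn (lead_coeff p)" if "t \<le> - T" for t
    using T[rule_format, of "- t"] that unfolding lc
    by (simp add: q_def poly_pcompose sgn_mult)
  then show ?thesis by blast
qed

text \<open>Since the family contains the derivative of \<open>p\<close>, there is at most one root of \<open>p\<close> in each gap
  between the roots of the family, and \<open>h\<close> can be bent inside the gap to match it.\<close>

lemma extend_order_iso:
  fixes u w :: "'k \<Rightarrow> real poly"
  assumes I: "finite I" and h: "order_iso h"
    and uw: "\<And>k t. k \<in> I \<Longrightarrow> sgn (poly (u k) t) = sgn (poly (w k) (h t))"
    and i0: "i0 \<in> I" "u i0 = pderiv p" "w i0 = pderiv q"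
    and deg: "degree p = degree q" "degree p > 0"
    and lc: "sgn (lead_coeff p) = sgn (lead_coeff q)"
    and roots: "\<And>k t. k \<in> I \<Longrightarrow> u k \<noteq> 0 \<Longrightarrow> poly (u k) t = 0 \<Longrightarrow>
      sgn (poly p t) = sgn (poly q (h t))"
  shows "\<exists>h'. order_iso h' \<and> (\<forall>k\<in>I. \<forall>t. sgn (poly (u k) t) = sgn (poly (w k) (h' t))) \<and>
           (\<forall>t. sgn (poly p t) = sgn (poly q (h' t)))"
proof -
  have p: "p \<noteq> 0" "q \<noteq> 0" "pderiv p \<noteq> 0" using deg by (auto simp: pderiv_eq_0_iff)
  define E where "E = (\<Union>k\<in>{k\<in>I. u k \<noteq> 0}. {t. poly (u k) t = 0})"
  have E: "finite E" using I poly_roots_finite by (auto simp: E_def)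
  obtain T1 T2 where T1: "\<forall>t\<ge>T1. sgn (poly p t) = sgn (lead_coeff p)"
    and T2: "\<forall>t\<ge>T2. sgn (poly q t) = sgn (lead_coeff q)"
    using poly_sgn_at_top p by meson
  obtain B1 B2 where B1: "\<forall>t\<le>B1. sgn (poly p t) = (-1) ^ degree p * sgn (lead_coeff p)"
    and B2: "\<forall>t\<le>B2. sgn (poly q t) = (-1) ^ degree q * sgn (lead_coeff q)"
    using poly_sgn_at_bot p by meson
  obtain T2' B2' where T2': "T2 = h T2'" and B2': "B2 = h B2'" using order_iso_surj[OF h] by metis
  \<comment> \<open>\<open>T2\<close> and \<open>B2\<close> belong to the target line, so their
    preimages under \<open>h\<close> enter. From \<open>M\<close> upwards and from \<open>m\<close>
    downwards both polynomials have the signs of their leading terms, and all roots of the family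
    lie between.\<close>
  define M where "M = Max (E \<union> {T1, T2', B1, B2'})"
  define m where "m = Min (E \<union> {T1, T2', B1, B2'})"
  have "\<forall>e \<in> E \<union> {T1, T2', B1, B2'}. m \<le> e \<and> e \<le> M"
    unfolding M_def m_def using E by (intro ballI conjI Max_ge Min_le) simp_all
  then have M: "\<And>e. e \<in> E \<Longrightarrow> e \<le> M" "T1 \<le> M" "T2' \<le> M"
    and m: "\<And>e. e \<in> E \<Longrightarrow> m \<le> e" "m \<le> B1" "m \<le> B2'" by auto
  have hle: "h s \<le> h t \<longleftrightarrow> s \<le> t" for s t
    using h by (simp add: order_iso_def strict_mono_less_eq)
  have top: "sgn (poly p t) = sgn (poly q (h t))" if "M \<le> t" for t
    using T1[rule_format, of t] T2[rule_format, of "h t"] that M lc by (simp add: T2' hle)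
  have bot: "sgn (poly p t) = sgn (poly q (h t))" if "t \<le> m" for t
    using B1[rule_format, of t] B2[rule_format, of "h t"] that m lc deg by (simp add: B2' hle)
  define D where "D = E \<union> {m, M}"
  have D: "finite D" using E by (simp add: D_def)
  have no_root: "poly (u k) t \<noteq> 0" if "k \<in> I" "u k \<noteq> 0" "t \<notin> D" for k t
    using that by (auto simp: D_def E_def)
  have const: "sgn (poly (u k) s) = sgn (poly (u k) t)"
    if "k \<in> I" "a < s" "s < b" "a < t" "t < b" "{a<..<b} \<inter> D = {}" for k s t a b
  proof (cases "u k = 0")
    case False
    then have nz: "poly (u k) r \<noteq> 0" if "a < r" "r < b" for r
    proof -
      have "r \<notin> D" using that \<open>{a<..<b} \<inter> D = {}\<close> greaterThanLessThan_iff by blast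
      then show ?thesis by (rule no_root[OF \<open>k \<in> I\<close> False])
    qed
    show ?thesis
    proof (cases "s \<le> t")
      case True
      then show ?thesis using poly_sgn_const[of s t "u k"] nz that by auto
    next
      case False
      then show ?thesis using poly_sgn_const[of t s "u k"] nz that by auto
    qed
  qed simp
  have match: "matched D p q h"
    unfolding matched_def
  proof (intro conjI allI ballI impI)
    fix d assume "d \<in> D"
    then show "sgn (poly p d) = sgn (poly q (h d))"
      using top[of d] bot[of d] roots by (auto simp: D_def E_def)
  next
    fix t assume "outer D t"
    then have "t \<le> m \<or> M \<le> t" by (auto simp: outer_def D_def)
    then show "sgn (poly p t) = sgn (poly q (h t))" using top bot by auto
  next
    fix a b assume ab: "a \<in> D" "b \<in> D" "a < b" "{a<..<b} \<inter> D = {}"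
    define c where "c = (a + b) / 2"
    have c: "a < c" "c < b" using ab by (auto simp: c_def)
    have p': "sgn (poly (pderiv p) t) = sgn (poly (pderiv p) c)" if "a < t" "t < b" for t
      using const[OF i0(1) that c ab(4)] by (simp add: i0)
    \<comment> \<open>Every point between \<open>h a\<close> and \<open>h b\<close> is the image of
      a point of the gap, so the constant sign passes from \<open>pderiv p\<close> to
      \<open>pderiv q\<close>.\<close>
    have q': "sgn (poly (pderiv q) t) = sgn (poly (pderiv p) c)" if "h a < t" "t < h b" for t
    proof -
      obtain s where s: "t = h s" using order_iso_surj[OF h] by blast
      then have "a < s" "s < b" using that by (auto simp: order_iso_less_iff[OF h])
      then show ?thesis using p'[of s] uw[OF i0(1), of s] by (simp add: s i0)
    qed
    have "c \<notin> D" using ab(4) c by auto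
    then have "poly (pderiv p) c \<noteq> 0" using no_root[OF i0(1), of c] p by (simp add: i0)
    then consider "poly (pderiv p) c > 0" | "poly (pderiv p) c < 0" by linarith
    then show "incr_on a b p \<and> incr_on (h a) (h b) q \<or> incr_on a b (- p) \<and> incr_on (h a) (h b) (- q)"
    proof cases
      case 1
      then show ?thesis
        using p' q' unfolding sgn_real_eq_iff
        by (intro disjI1 conjI incr_on_pderiv) blast+
    next
      case 2
      then show ?thesis
        using p' q' unfolding sgn_real_eq_iff
        by (intro disjI2 conjI incr_on_pderiv) (simp_all add: pderiv_minus)
    qed
  qed (rule h)
  from match_all_roots[OF D p(1) match] obtain h' where h': "order_iso h'"
    "\<And>t. t \<in> D \<or> outer D t \<Longrightarrow> h' t = h t" "\<forall>t. sgn (poly p t) = sgn (poly q (h' t))" by blast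
  \<comment> \<open>Inside a gap \<open>h'\<close> may differ from \<open>h\<close>, but
    \<open>h' t\<close> is the image under \<open>h\<close> of another point of the same gap, and
    \<open>u k\<close> has only one sign there.\<close>
  have "sgn (poly (u k) t) = sgn (poly (w k) (h' t))" if k: "k \<in> I" for k t
  proof (cases "t \<in> D \<or> outer D t")
    case True
    then show ?thesis using h'(2)[OF True] uw[OF k] by simp
  next
    case False
    then obtain a b where ab: "a \<in> D" "b \<in> D" "a < t" "t < b" "{a<..<b} \<inter> D = {}"
      using gap_exists[OF D, of t] by (auto simp: outer_def)
    obtain s where s: "h' t = h s" using order_iso_surj[OF h] by blast
    have "h' a < h' t" "h' t < h' b" using ab by (simp_all add: order_iso_less_iff[OF h'(1)])
    then have "a < s" "s < b" using ab h'(2)[of a] h'(2)[of b] by (simp_all add: s order_iso_less_iff[OF h])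
    then show ?thesis using const[OF k ab(3,4) _ _ ab(5), of s] uw[OF k, of s] by (simp add: s)
  qed
  then show ?thesis using h' by blast
qed

section \<open>Sign determination and projection of semialgebraic sets\<close>

text \<open>The argument \<open>x\<close> is a base point. The degree bound is strict, so that bound
  0 leaves only the zero family, from which the induction on degrees starts.\<close>

definition poly_family :: "('b \<Rightarrow> real) set \<Rightarrow> nat \<Rightarrow> ('b \<Rightarrow> real poly) set" where
  "poly_family R d = {P. (\<forall>i. (\<lambda>x. coeff (P x) i) \<in> R) \<and> (\<forall>x i. d \<le> i \<longrightarrow> coeff (P x) i = 0)}"

lemma poly_family_mono: "d \<le> e \<Longrightarrow> poly_family R d \<subseteq> poly_family R e"
  by (auto simp: poly_family_def)

lemma poly_family_coeff: "P \<in> poly_family R d \<Longrightarrow> (\<lambda>x. coeff (P x) i) \<in> R"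
  by (simp add: poly_family_def)

lemma poly_family_altdef:
  assumes "P \<in> poly_family R d"
  shows "poly (P x) t = (\<Sum>i<d. coeff (P x) i * t ^ i)"
proof -
  have "poly (P x) t = (\<Sum>i\<le>degree (P x). coeff (P x) i * t ^ i)" by (rule poly_altdef)
  also have "\<dots> = (\<Sum>i\<in>{..degree (P x)} \<inter> {..<d}. coeff (P x) i * t ^ i)"
    using assms by (intro sum.mono_neutral_right) (auto simp: poly_family_def)
  also have "\<dots> = (\<Sum>i<d. coeff (P x) i * t ^ i)"
    by (intro sum.mono_neutral_left) (auto simp: coeff_eq_0)
  finally show ?thesis .
qed

lemma poly_family_pderiv:
  assumes "function_ring R" "P \<in> poly_family R (Suc d)"
  shows "(\<lambda>x. pderiv (P x)) \<in> poly_family R d"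
proof -
  have "(\<lambda>x. of_nat (Suc i) * coeff (P x) (Suc i)) \<in> R" for i
    using assms by (intro function_ring_mult function_ring_const poly_family_coeff)
  then show ?thesis using assms(2) by (auto simp: poly_family_def coeff_pderiv)
qed

lemma poly_family_cutoff:
  assumes "function_ring R" "P \<in> poly_family R d"
  shows "(\<lambda>x. poly_cutoff e (P x)) \<in> poly_family R e"
proof -
  have "(\<lambda>x. if i < e then coeff (P x) i else 0) \<in> R" for i
    using assms by (cases "i < e") (auto intro: function_ring_const poly_family_coeff)
  then show ?thesis by (auto simp: poly_family_def coeff_poly_cutoff)
qed

lemma poly_cutoff_id: "(\<And>i. d \<le> i \<Longrightarrow> coeff p i = 0) \<Longrightarrow> poly_cutoff d p = p"
  by (auto simp: poly_eq_iff coeff_poly_cutoff)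

text \<open>Each reduction multiplies by the square of the formal leading coefficient of
  \<open>G\<close>. The total factor is an even power, positive wherever this coefficient is
  nonzero, so that signs survive the division.\<close>

lemma poly_family_pseudo_rem:
  assumes R: "function_ring R" and G: "G \<in> poly_family R (Suc e)" and F: "F \<in> poly_family R d"
  shows "\<exists>r\<in>poly_family R e. \<exists>m q. \<forall>x. smult (coeff (G x) e ^ (2 * m)) (F x) = q x * G x + r x"
  using F
proof (induction d arbitrary: F)
  case 0
  then have "F \<in> poly_family R e" using poly_family_mono[of 0 e R] by auto
  then show ?case by (intro bexI[of _ F] exI[of _ 0] exI[of _ "\<lambda>x. 0"]) auto
next
  case (Suc n)
  show ?case
  proof (cases "Suc n \<le> e")
    case True
    then have "F \<in> poly_family R e" using Suc.prems poly_family_mono[of "Suc n" e R] by auto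
    then show ?thesis by (intro bexI[of _ F] exI[of _ 0] exI[of _ "\<lambda>x. 0"]) auto
  next
    case False
    define b where "b x = coeff (G x) e" for x
    \<comment> \<open>Chosen so that \<open>smult (b x ^ 2) (F x)\<close> and
      \<open>c x * G x\<close> have the same coefficient at \<open>n\<close>.\<close>
    define c where "c x = monom (b x * coeff (F x) n) (n - e)" for x
    define F1 where "F1 x = smult (b x ^ 2) (F x) - c x * G x" for x
    have bR: "b \<in> R" using poly_family_coeff[OF G, of e] by (simp add: b_def[abs_def])
    have coeff_F1: "coeff (F1 x) i = b x ^ 2 * coeff (F x) i -
        (if i < n - e then 0 else b x * coeff (F x) n * coeff (G x) (i - (n - e)))" for x i
      by (simp add: F1_def c_def coeff_monom_mult)
    have "F1 \<in> poly_family R n"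
      unfolding poly_family_def
    proof (intro CollectI conjI allI impI)
      fix i
      have "(\<lambda>x. b x ^ 2 * coeff (F x) i) \<in> R"
        using Suc.prems R bR
        by (intro function_ring_mult function_ring_power poly_family_coeff) auto
      moreover have "(\<lambda>x. if i < n - e then 0 else b x * coeff (F x) n * coeff (G x) (i - (n - e))) \<in> R"
        using Suc.prems R bR G
        by (cases "i < n - e")
           (auto intro!: function_ring_const function_ring_mult poly_family_coeff)
      ultimately show "(\<lambda>x. coeff (F1 x) i) \<in> R"
        unfolding coeff_F1 by (intro function_ring_diff R)
    next
      fix x i assume i: "n \<le> i"
      show "coeff (F1 x) i = 0"
      proof (cases "i = n")
        case True
        have "n - (n - e) = e" "\<not> n < n - e" using False by auto
        with True show ?thesis by (simp add: coeff_F1 b_def power2_eq_square)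
      next
        case neq: False
        have "coeff (F x) i = 0" "coeff (G x) (i - (n - e)) = 0"
          using Suc.prems G i neq False by (auto simp: poly_family_def)
        then show ?thesis by (simp add: coeff_F1)
      qed
    qed
    from Suc.IH[OF this] obtain r m q where r: "r \<in> poly_family R e"
      "\<forall>x. smult (b x ^ (2 * m)) (F1 x) = q x * G x + r x"
      unfolding b_def by blast
    have "smult (b x ^ (2 * Suc m)) (F x) = (q x + smult (b x ^ (2 * m)) (c x)) * G x + r x" for x
    proof -
      have "smult (b x ^ (2 * Suc m)) (F x) = smult (b x ^ (2 * m)) (F1 x + c x * G x)"
        by (simp add: F1_def power2_eq_square mult_ac)
      also have "\<dots> = smult (b x ^ (2 * m)) (F1 x) + smult (b x ^ (2 * m)) (c x) * G x"
        by (simp add: smult_add_right)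
      also have "\<dots> = (q x + smult (b x ^ (2 * m)) (c x)) * G x + r x"
        using r(2) by (simp add: algebra_simps)
      finally show ?thesis .
    qed
    then show ?thesis
      using r(1) unfolding b_def
      by (intro bexI[of _ r] exI[of _ "Suc m"] exI[of _ "\<lambda>x. q x + smult (b x ^ (2 * m)) (c x)"])
         (auto simp: b_def)
  qed
qed

lemma poly_family_rem_sgn:
  assumes R: "function_ring R" and G: "G \<in> poly_family R (Suc e)" and F: "F \<in> poly_family R d"
  shows "\<exists>r\<in>poly_family R e. \<forall>x t. coeff (G x) e \<noteq> 0 \<longrightarrow> poly (G x) t = 0 \<longrightarrow>
           sgn (poly (F x) t) = sgn (poly (r x) t)"
proof -
  obtain r m q where r: "r \<in> poly_family R e"
    "\<forall>x. smult (coeff (G x) e ^ (2 * m)) (F x) = q x * G x + r x"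
    using poly_family_pseudo_rem[OF assms] by blast
  have "sgn (poly (F x) t) = sgn (poly (r x) t)"
    if nz: "coeff (G x) e \<noteq> 0" and root: "poly (G x) t = 0" for x t
  proof -
    have "poly (smult (coeff (G x) e ^ (2 * m)) (F x)) t = poly (q x * G x + r x) t"
      using r(2) by simp
    then have "coeff (G x) e ^ (2 * m) * poly (F x) t = poly (r x) t" using root by simp
    moreover have "coeff (G x) e ^ (2 * m) > 0" using nz by (simp add: power_mult)
    ultimately show ?thesis by (metis sgn_mult sgn_pos mult_1)
  qed
  with r(1) show ?thesis by blast
qed

definition same_signs :: "('b \<Rightarrow> real) set \<Rightarrow> 'b \<Rightarrow> 'b \<Rightarrow> bool" where
  "same_signs A x y \<longleftrightarrow> (\<forall>a\<in>A. sgn (a x) = sgn (a y))"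

lemma same_signs_Un [simp]: "same_signs (A \<union> B) x y \<longleftrightarrow> same_signs A x y \<and> same_signs B x y"
  by (auto simp: same_signs_def)

lemma same_signs_sym: "same_signs A x y \<Longrightarrow> same_signs A y x"
  by (auto simp: same_signs_def)

text \<open>The order isomorphism expresses that the sign diagrams over \<open>x\<close> and \<open>y\<close> agree, without
  enumerating the roots.\<close>

definition same_diagram :: "('b \<Rightarrow> real poly) set \<Rightarrow> 'b \<Rightarrow> 'b \<Rightarrow> bool" where
  "same_diagram F x y \<longleftrightarrow>
     (\<exists>h. order_iso h \<and> (\<forall>P\<in>F. \<forall>t. sgn (poly (P x) t) = sgn (poly (P y) (h t))))"

definition signs_determined :: "('b \<Rightarrow> real) set \<Rightarrow> ('b \<Rightarrow> real poly) set \<Rightarrow> bool" where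
  "signs_determined R F \<longleftrightarrow>
     (\<exists>A\<subseteq>R. finite A \<and> (\<forall>x y. same_signs A x y \<longrightarrow> same_diagram F x y))"

text \<open>At a root of \<open>Q\<close> the sign of \<open>P\<close> is that of its pseudo-remainder by \<open>Q\<close>, which has smaller
  degree. As leading coefficients may vanish, all truncations of \<open>Q\<close> are divided by.\<close>

lemma signs_determined_insert:
  assumes R: "function_ring R" and F: "finite F" "F \<subseteq> poly_family R (Suc d)"
    and P: "P \<in> poly_family R (Suc d)"
    and cut: "signs_determined R (insert (\<lambda>x. poly_cutoff d (P x)) F)"
    and rems: "\<And>E. finite E \<Longrightarrow> E \<subseteq> poly_family R d \<Longrightarrow> signs_determined R (E \<union> F)"
  shows "signs_determined R (insert P F)"
proof -
  define P' where "P' = (\<lambda>x. pderiv (P x))"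
  define I where "I = insert P' F"
  have P': "P' \<in> poly_family R d" unfolding P'_def by (rule poly_family_pderiv[OF R P])
  have I: "finite I" "I \<subseteq> poly_family R (Suc d)"
    using F P' poly_family_mono[of d "Suc d" R] by (auto simp: I_def)
  \<comment> \<open>Truncated after exponent \<open>e\<close>, \<open>Q\<close> has the formal
    leading coefficient that pseudo-division asks for; at base points where \<open>Q x\<close> has
    degree \<open>e\<close> the truncation is \<open>Q x\<close> itself.\<close>
  have "\<exists>r\<in>poly_family R e. \<forall>x t. coeff (Q x) e \<noteq> 0 \<longrightarrow> poly (poly_cutoff (Suc e) (Q x)) t = 0 \<longrightarrow>
           sgn (poly (P x) t) = sgn (poly (r x) t)" if "Q \<in> I" for Q e
    using poly_family_rem_sgn[OF R poly_family_cutoff[OF R, of Q "Suc d" "Suc e"] P] I that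
    by (auto simp: coeff_poly_cutoff)
  then obtain r where r: "\<And>Q e. Q \<in> I \<Longrightarrow> r Q e \<in> poly_family R e"
    "\<And>Q e x t. Q \<in> I \<Longrightarrow> coeff (Q x) e \<noteq> 0 \<Longrightarrow> poly (poly_cutoff (Suc e) (Q x)) t = 0 \<Longrightarrow>
           sgn (poly (P x) t) = sgn (poly (r Q e x) t)"
    by metis
  define E where "E = insert P' ((\<lambda>(Q, e). r Q e) ` (I \<times> {..d}))"
  have "finite E" "E \<subseteq> poly_family R d"
    using I(1) r(1) P' poly_family_mono[of _ d R] by (fastforce simp: E_def)+
  from rems[OF this] obtain A1 where A1: "A1 \<subseteq> R" "finite A1"
    "\<And>x y. same_signs A1 x y \<Longrightarrow> same_diagram (E \<union> F) x y"
    unfolding signs_determined_def by blast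
  from cut obtain A2 where A2: "A2 \<subseteq> R" "finite A2"
    "\<And>x y. same_signs A2 x y \<Longrightarrow> same_diagram (insert (\<lambda>x. poly_cutoff d (P x)) F) x y"
    unfolding signs_determined_def by blast
  \<comment> \<open>Equal signs of all coefficients give equal degrees, and equal signs of leading
    coefficients, over the two base points.\<close>
  define A3 where "A3 = (\<lambda>(Q, i) x. coeff (Q x) i) ` (insert P I \<times> {..Suc d})"
  have A3: "A3 \<subseteq> R" "finite A3"
    using I P by (auto simp: A3_def intro: poly_family_coeff)
  have "same_diagram (insert P F) x y"
    if same: "same_signs A1 x y" "same_signs A2 x y" "same_signs A3 x y" for x y
  proof -
    have sgn_coeff: "sgn (coeff (Q x) i) = sgn (coeff (Q y) i)" if "Q \<in> insert P I" for Q i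
    proof (cases "i \<le> Suc d")
      case True
      then have "(\<lambda>x. coeff (Q x) i) \<in> A3"
        using that unfolding A3_def by (intro image_eqI[of _ _ "(Q, i)"]) auto
      then show ?thesis using same(3) by (auto simp: same_signs_def)
    next
      case False
      then show ?thesis using that P I(2) by (auto simp: poly_family_def)
    qed
    then have coeff_0: "coeff (Q x) i = 0 \<longleftrightarrow> coeff (Q y) i = 0" if "Q \<in> insert P I" for Q i
      using that by (metis sgn_0_0)
    have degree: "degree (Q x) = degree (Q y)" if "Q \<in> insert P I" for Q
      unfolding degree_def using coeff_0[OF that] by simp
    obtain h where h: "order_iso h"
      "\<And>Q t. Q \<in> E \<union> F \<Longrightarrow> sgn (poly (Q x) t) = sgn (poly (Q y) (h t))"
      using A1(3)[OF same(1)] unfolding same_diagram_def by blast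
    \<comment> \<open>Either \<open>P\<close> loses its top coefficient and equals its truncation,
      or it keeps the positive degree \<open>d\<close> and the order isomorphism has to be bent, or
      it is constant along the line.\<close>
    consider "coeff (P x) d = 0" | "degree (P x) = d" "d > 0" | "degree (P x) = 0"
    proof (cases "coeff (P x) d = 0")
      case False
      then have "degree (P x) = d"
        using P by (intro order_antisym degree_le le_degree) (auto simp: poly_family_def)
      then show ?thesis using that by auto
    qed
    then show ?thesis
    proof cases
      case 1
      have "poly_cutoff d (P z) = P z" if "coeff (P z) d = 0" for z
      proof (rule poly_cutoff_id)
        fix i assume "d \<le> i"
        then show "coeff (P z) i = 0" using P that by (cases "i = d") (auto simp: poly_family_def)
      qed
      then show ?thesis
        using A2(3)[OF same(2)] 1 coeff_0[of P d] by (auto simp: same_diagram_def)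
    next
      case 2
      have "\<exists>h'. order_iso h' \<and> (\<forall>Q\<in>I. \<forall>t. sgn (poly (Q x) t) = sgn (poly (Q y) (h' t))) \<and>
          (\<forall>t. sgn (poly (P x) t) = sgn (poly (P y) (h' t)))"
      proof (rule extend_order_iso[of I h "\<lambda>Q. Q x" "\<lambda>Q. Q y" P'])
        show "sgn (poly (Q x) t) = sgn (poly (Q y) (h t))" if "Q \<in> I" for Q t
          using h(2) that by (auto simp: I_def E_def)
        show "degree (P x) = degree (P y)" using degree[of P] by simp
        then show "sgn (lead_coeff (P x)) = sgn (lead_coeff (P y))"
          using sgn_coeff[of P] by simp
        fix Q t assume Q: "Q \<in> I" "Q x \<noteq> 0" "poly (Q x) t = 0"
        \<comment> \<open>This degree is the same over \<open>x\<close> and \<open>y\<close>, so one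
          remainder \<open>r Q e\<close> gives the sign of \<open>P\<close> at corresponding roots
          over both.\<close>
        define e where "e = degree (Q x)"
        have e: "coeff (Q x) e \<noteq> 0" "e = degree (Q y)"
          unfolding e_def by (use Q(2) in simp) (use Q(1) degree[of Q] in simp)
        then have e': "coeff (Q y) e \<noteq> 0" using Q(1) coeff_0[of Q e] by simp
        have "e \<le> d"
          using e(1) Q(1) I(2) by (auto simp: poly_family_def not_less_eq_eq[symmetric])
        then have rE: "r Q e \<in> E" using Q(1) by (auto simp: E_def intro!: image_eqI[of _ _ "(Q, e)"])
        have cutx: "poly_cutoff (Suc e) (Q x) = Q x" and cuty: "poly_cutoff (Suc e) (Q y) = Q y"
          using e(2) by (auto intro!: poly_cutoff_id simp: e_def coeff_eq_0)
        have "sgn (poly (Q y) (h t)) = sgn (poly (Q x) t)"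
          using h(2)[of Q t] Q(1) by (auto simp: I_def E_def)
        then have "poly (Q y) (h t) = 0" using Q(3) by (simp add: sgn_0_0)
        then have "sgn (poly (P y) (h t)) = sgn (poly (r Q e y) (h t))"
          using r(2)[OF Q(1) e'] by (simp add: cuty)
        also have "\<dots> = sgn (poly (r Q e x) t)" using h(2)[of "r Q e" t] rE by simp
        also have "\<dots> = sgn (poly (P x) t)"
          using r(2)[OF Q(1) e(1)] Q(3) by (simp add: cutx)
        finally show "sgn (poly (P x) t) = sgn (poly (P y) (h t))" ..
      qed (use I h 2 in \<open>auto simp: I_def P'_def\<close>)
      then show ?thesis unfolding same_diagram_def I_def by blast
    next
      case 3
      then obtain a b where "P x = [:a:]" "P y = [:b:]"
        using degree[of P] by (metis degree_eq_zeroE insertI1)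
      then have "sgn (poly (P x) t) = sgn (poly (P y) (h t))" for t
        using sgn_coeff[of P 0] by simp
      then show ?thesis using h unfolding same_diagram_def by blast
    qed
  qed
  then show ?thesis
    unfolding signs_determined_def using A1 A2 A3
    by (intro exI[of _ "A1 \<union> A2 \<union> A3"]) auto
qed

text \<open>The outer induction is on the degree bound. The inner one is on the set of members
  allowed to reach the top degree; it keeps the set \<open>E\<close> of lower members arbitrary,
  because every insertion adds remainders to it.\<close>

theorem sign_determination:
  assumes R: "function_ring R" and "finite F" "F \<subseteq> poly_family R d"
  shows "signs_determined R F"
  using assms(2,3)
proof (induction d arbitrary: F)
  case 0
  have "order_iso id" by (auto simp: order_iso_def strict_mono_def)
  moreover have "P x = 0" if "P \<in> F" for P x
    using 0 that by (auto simp: poly_family_def poly_eq_iff)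
  ultimately show ?case
    unfolding signs_determined_def same_diagram_def by (intro exI[of _ "{}"]) force
next
  case (Suc d)
  have "signs_determined R (E \<union> F)"
    if "finite E" "E \<subseteq> poly_family R d" for E
    using Suc.prems that
  proof (induction F arbitrary: E rule: finite_induct)
    case empty
    then show ?case using Suc.IH[of E] by simp
  next
    case (insert P F)
    have "signs_determined R (insert P (E \<union> F))"
    proof (rule signs_determined_insert[OF R])
      show "finite (E \<union> F)" "E \<union> F \<subseteq> poly_family R (Suc d)" "P \<in> poly_family R (Suc d)"
        using insert.prems insert.hyps poly_family_mono[of d "Suc d" R] by auto
      have "(\<lambda>x. poly_cutoff d (P x)) \<in> poly_family R d"
        using insert.prems poly_family_cutoff[OF R, of P "Suc d" d] by auto
      then show "signs_determined R (insert (\<lambda>x. poly_cutoff d (P x)) (E \<union> F))"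
        using insert.IH[of "insert (\<lambda>x. poly_cutoff d (P x)) E"] insert.prems by simp
      show "signs_determined R (E' \<union> (E \<union> F))" if "finite E'" "E' \<subseteq> poly_family R d" for E'
        using insert.IH[of "E' \<union> E"] insert.prems that by (simp add: Un_assoc)
    qed
    then show ?case by simp
  qed
  from this[of "{}"] show ?case by simp
qed

text \<open>A union of sign classes of finitely many functions is the same as a finite Boolean
  combination of sign conditions.\<close>

definition semialg :: "('b \<Rightarrow> real) set \<Rightarrow> 'b set \<Rightarrow> bool" where
  "semialg R S \<longleftrightarrow> (\<exists>A\<subseteq>R. finite A \<and> (\<forall>x y. same_signs A x y \<longrightarrow> x \<in> S \<longrightarrow> y \<in> S))"

lemma semialg_Compl: "semialg R S \<Longrightarrow> semialg R (- S)"
  unfolding semialg_def by (meson ComplD ComplI same_signs_sym)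

lemma semialg_empty: "semialg R {}"
  unfolding semialg_def by (intro exI[of _ "{}"]) auto

lemma semialg_Un:
  assumes "semialg R S" "semialg R T" shows "semialg R (S \<union> T)"
proof -
  obtain A B where "A \<subseteq> R" "finite A" "\<forall>x y. same_signs A x y \<longrightarrow> x \<in> S \<longrightarrow> y \<in> S"
    "B \<subseteq> R" "finite B" "\<forall>x y. same_signs B x y \<longrightarrow> x \<in> T \<longrightarrow> y \<in> T"
    using assms unfolding semialg_def by blast
  then show ?thesis unfolding semialg_def by (intro exI[of _ "A \<union> B"]) auto
qed

lemma semialg_Int: "semialg R S \<Longrightarrow> semialg R T \<Longrightarrow> semialg R (S \<inter> T)"
  using semialg_Compl[OF semialg_Un[OF semialg_Compl semialg_Compl], of R S T] by simp

lemma semialg_Union: "finite \<S> \<Longrightarrow> (\<And>S. S \<in> \<S> \<Longrightarrow> semialg R S) \<Longrightarrow> semialg R (\<Union>\<S>)"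
  by (induction rule: finite_induct) (auto intro: semialg_empty semialg_Un)

lemma semialg_INT:
  assumes "finite I" "\<And>i. i \<in> I \<Longrightarrow> semialg R (S i)"
  shows "semialg R (\<Inter>i\<in>I. S i)"
proof -
  have "semialg R (\<Union>i\<in>I. - S i)" using assms by (intro semialg_Union) (auto intro: semialg_Compl)
  then have "semialg R (- (\<Union>i\<in>I. - S i))" by (rule semialg_Compl)
  then show ?thesis by simp
qed

lemma semialg_zero_set: "f \<in> R \<Longrightarrow> semialg R {x. f x = 0}"
  unfolding semialg_def same_signs_def by (intro exI[of _ "{f}"]) (auto simp: sgn_0_0 sgn_eq_0_iff)

lemma semialg_vimage:
  assumes "semialg R S" "\<And>f. f \<in> R \<Longrightarrow> (\<lambda>x. f (s x)) \<in> R'"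
  shows "semialg R' {x. s x \<in> S}"
proof -
  obtain A where "A \<subseteq> R" "finite A" "\<forall>x y. same_signs A x y \<longrightarrow> x \<in> S \<longrightarrow> y \<in> S"
    using assms(1) unfolding semialg_def by blast
  then show ?thesis
    using assms(2) unfolding semialg_def same_signs_def
    by (intro exI[of _ "(\<lambda>f x. f (s x)) ` A"]) auto
qed

definition sign_class :: "('b \<Rightarrow> real) set \<Rightarrow> (('b \<Rightarrow> real) \<Rightarrow> real) \<Rightarrow> 'b set" where
  "sign_class A \<sigma> = {x. \<forall>a\<in>A. sgn (a x) = \<sigma> a}"

text \<open>Extensional sign vectors keep the number of classes finite. Some of the classes may be
  empty.\<close>

definition sign_classes :: "('b \<Rightarrow> real) set \<Rightarrow> 'b set set" where
  "sign_classes A = sign_class A ` (A \<rightarrow>\<^sub>E {-1, 0, 1})"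

lemma finite_sign_classes: "finite A \<Longrightarrow> finite (sign_classes A)"
  by (simp add: sign_classes_def finite_PiE)

lemma semialg_sign_class: "A \<subseteq> R \<Longrightarrow> finite A \<Longrightarrow> semialg R (sign_class A \<sigma>)"
  unfolding semialg_def sign_class_def same_signs_def by (intro exI[of _ A]) auto

lemma sign_classes_cover: "\<exists>C\<in>sign_classes A. x \<in> C"
proof
  show "x \<in> sign_class A (restrict (\<lambda>a. sgn (a x)) A)" by (auto simp: sign_class_def)
  show "sign_class A (restrict (\<lambda>a. sgn (a x)) A) \<in> sign_classes A"
    unfolding sign_classes_def by (intro imageI) (simp add: PiE_def Pi_def extensional_def sgn_if)
qed

lemma semialg_sign_classes:
  assumes "semialg R S"
  obtains A where "A \<subseteq> R" "finite A" "S = \<Union>{C \<in> sign_classes A. C \<subseteq> S}"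
proof -
  obtain A where A: "A \<subseteq> R" "finite A" "\<forall>x y. same_signs A x y \<longrightarrow> x \<in> S \<longrightarrow> y \<in> S"
    using assms unfolding semialg_def by blast
  have "S \<subseteq> \<Union>{C \<in> sign_classes A. C \<subseteq> S}"
  proof
    fix x assume x: "x \<in> S"
    obtain C where C: "C \<in> sign_classes A" "x \<in> C" using sign_classes_cover[of A x] by blast
    then obtain \<sigma> where "C = sign_class A \<sigma>" by (auto simp: sign_classes_def)
    then have "same_signs A x y" if "y \<in> C" for y
      using C(2) that by (simp add: sign_class_def same_signs_def)
    with A(3) x have "C \<subseteq> S" by blast
    with C show "x \<in> \<Union>{C \<in> sign_classes A. C \<subseteq> S}" by blast
  qed
  then have "S = \<Union>{C \<in> sign_classes A. C \<subseteq> S}" by (intro subset_antisym) auto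
  then show ?thesis by (rule that[OF A(1,2)])
qed

lemma polys_in_poly_family:
  assumes R: "function_ring R" and "f \<in> polys_in R z n"
  obtains P where "P \<in> poly_family R n" "\<And>x. f x = poly (P x) (z x)"
proof -
  obtain c where c: "\<forall>i. c i \<in> R" "f = (\<lambda>x. \<Sum>i<n. c i x * z x ^ i)"
    using assms(2) unfolding polys_in_def by auto
  define P where "P x = (\<Sum>i<n. monom (c i x) i)" for x
  have coeff_P: "coeff (P x) i = (if i < n then c i x else 0)" for x i
    by (simp add: P_def coeff_sum sum.delta)
  have "(\<lambda>x. coeff (P x) i) \<in> R" for i
    using c(1) by (cases "i < n") (auto simp: coeff_P intro: function_ring_const[OF R])
  then have "P \<in> poly_family R n" by (auto simp: poly_family_def coeff_P)
  moreover have "f x = poly (P x) (z x)" for x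
    by (simp add: c P_def poly_sum poly_monom)
  ultimately show ?thesis by (rule that)
qed

section \<open>Elimination of real variables\<close>

lemma rpoly_family:
  assumes "f \<in> rpoly (insert v V)" "v \<notin> V"
  shows "\<exists>n. \<exists>P\<in>poly_family (rpoly V) n. \<forall>x t. f (x(v := t)) = poly (P x) t"
proof -
  obtain n where "f \<in> polys_in (rpoly V) (\<lambda>x. x v) n" using rpoly_insert[OF assms(1)] by blast
  from polys_in_poly_family[OF function_ring_rpoly this]
  obtain P where P: "P \<in> poly_family (rpoly V) n" "\<And>x. f x = poly (P x) (x v)" by blast
  have "P (x(v := t)) = P x" for x t
    using rpoly_fun_upd[OF poly_family_coeff[OF P(1)] assms(2)] by (simp add: poly_eq_iff)
  with P show ?thesis by (intro exI[of _ n] bexI[of _ P]) simp_all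
qed

lemma rpoly_family_finite:
  assumes "finite A" "A \<subseteq> rpoly (insert v V)" "v \<notin> V"
  shows "\<exists>d P. \<forall>f\<in>A. P f \<in> poly_family (rpoly V) d \<and> (\<forall>x t. f (x(v := t)) = poly (P f x) t)"
  using assms(1,2)
proof (induction A rule: finite_induct)
  case (insert g A)
  have "A \<subseteq> rpoly (insert v V)" using insert.prems by simp
  from insert.IH[OF this] obtain d P where
    P: "\<forall>f\<in>A. P f \<in> poly_family (rpoly V) d \<and> (\<forall>x t. f (x(v := t)) = poly (P f x) t)"
    by (elim exE)
  have "g \<in> rpoly (insert v V)" using insert.prems by simp
  from rpoly_family[OF this assms(3)] obtain n Q where Q: "Q \<in> poly_family (rpoly V) n"
    "\<forall>x t. g (x(v := t)) = poly (Q x) t" by blast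
  have sub: "poly_family (rpoly V) d \<subseteq> poly_family (rpoly V) (max d n)"
    "poly_family (rpoly V) n \<subseteq> poly_family (rpoly V) (max d n)" by (simp_all add: poly_family_mono)
  have "(P(g := Q)) f \<in> poly_family (rpoly V) (max d n) \<and>
      (\<forall>x t. f (x(v := t)) = poly ((P(g := Q)) f x) t)" if "f \<in> insert g A" for f
  proof (cases "f = g")
    case True
    then show ?thesis using Q subsetD[OF sub(2)] by simp
  next
    case False
    then show ?thesis using P that subsetD[OF sub(1)] by simp
  qed
  then show ?case by blast
qed simp

text \<open>The one-variable step of Tarski-Seidenberg. If \<open>x\<close> and \<open>y\<close>
  have the same diagram, the order isomorphism carries a witness \<open>t\<close> over
  \<open>x\<close> to a witness over \<open>y\<close>.\<close>

lemma semialg_project: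
  assumes "semialg (rpoly (insert v V)) S" "v \<notin> V"
  shows "semialg (rpoly V) {x. \<exists>t. x(v := t) \<in> S}"
proof -
  obtain A where A: "A \<subseteq> rpoly (insert v V)" "finite A"
    "\<And>x y. same_signs A x y \<Longrightarrow> x \<in> S \<Longrightarrow> y \<in> S"
    using assms(1) unfolding semialg_def by blast
  from rpoly_family_finite[OF A(2,1) assms(2)] obtain d P where
    P: "\<forall>f\<in>A. P f \<in> poly_family (rpoly V) d \<and> (\<forall>x t. f (x(v := t)) = poly (P f x) t)"
    by (elim exE)
  then have "signs_determined (rpoly V) (P ` A)"
    using A(2) by (intro sign_determination[OF function_ring_rpoly]) auto
  then obtain B where B: "B \<subseteq> rpoly V" "finite B"
    "\<And>x y. same_signs B x y \<Longrightarrow> same_diagram (P ` A) x y"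
    unfolding signs_determined_def by blast
  have "\<exists>t. y(v := t) \<in> S" if same: "same_signs B x y" "x(v := t) \<in> S" for x y t
  proof -
    obtain h where "\<And>f t. f \<in> A \<Longrightarrow> sgn (poly (P f x) t) = sgn (poly (P f y) (h t))"
      using B(3)[OF same(1)] unfolding same_diagram_def by auto
    then have "same_signs A (x(v := t)) (y(v := h t))"
      using P by (simp add: same_signs_def)
    then show ?thesis using A(3) same(2) by blast
  qed
  then show ?thesis using B unfolding semialg_def by (intro exI[of _ B]) auto
qed

lemma semialg_project_finite:
  assumes "finite W" "semialg (rpoly (W \<union> V)) S" "W \<inter> V = {}"
  shows "semialg (rpoly V) {x. \<exists>y\<in>S. \<forall>k. k \<notin> W \<longrightarrow> y k = x k}"
  using assms
proof (induction W arbitrary: S rule: finite_induct)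
  case empty
  then show ?case by (simp add: fun_eq_iff[symmetric] Bex_def)
next
  case (insert w W)
  have "semialg (rpoly (W \<union> V)) {x. \<exists>t. x(w := t) \<in> S}"
    using insert by (intro semialg_project) auto
  then have "semialg (rpoly V) {x. \<exists>y\<in>{x. \<exists>t. x(w := t) \<in> S}. \<forall>k. k \<notin> W \<longrightarrow> y k = x k}"
    using insert by (intro insert.IH) auto
  moreover have "{x. \<exists>y\<in>{x. \<exists>t. x(w := t) \<in> S}. \<forall>k. k \<notin> W \<longrightarrow> y k = x k}
      = {x. \<exists>y\<in>S. \<forall>k. k \<notin> insert w W \<longrightarrow> y k = x k}" (is "?L = ?R")
  proof (intro subset_antisym subsetI)
    fix x assume "x \<in> ?L"
    then obtain y t where y: "y(w := t) \<in> S" "\<forall>k. k \<notin> W \<longrightarrow> y k = x k" by blast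
    show "x \<in> ?R" by (rule CollectI, rule bexI[OF _ y(1)]) (use y(2) in auto)
  next
    fix x assume "x \<in> ?R"
    then obtain y where y: "y \<in> S" "\<forall>k. k \<notin> insert w W \<longrightarrow> y k = x k" by blast
    \<comment> \<open>The intermediate point takes its coordinate \<open>w\<close> from
      \<open>x\<close>, so that it differs from \<open>x\<close> only on \<open>W\<close>; the old
      value \<open>y w\<close> is the witness for the one-variable projection.\<close>
    have "(y(w := x w))(w := y w) \<in> S" using y(1) by simp
    then have 1: "y(w := x w) \<in> {x. \<exists>t. x(w := t) \<in> S}" by blast
    show "x \<in> ?L" by (rule CollectI, rule bexI[OF _ 1]) (use y(2) in auto)
  qed
  ultimately show ?case by simp
qed

section \<open>Connected components of semialgebraic sets\<close>

lemma rpoly_continuous: "f \<in> rpoly V \<Longrightarrow> continuous_on S f"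
  by (induction rule: rpoly.induct)
     (auto intro: continuous_intros continuous_on_subset[OF continuous_on_product_coordinates])

lemma continuous_on_fun_upd:
  "continuous_on UNIV (\<lambda>p :: ('v \<Rightarrow> real) \<times> real. (fst p)(v := snd p))"
proof (rule continuous_on_coordinatewise_then_product)
  fix i
  have "continuous_on UNIV (\<lambda>p :: ('v \<Rightarrow> real) \<times> real. fst p i)"
    by (rule continuous_on_compose2[OF continuous_on_product_coordinates[of i] continuous_on_fst])
       (auto intro: continuous_intros)
  then show "continuous_on UNIV (\<lambda>p :: ('v \<Rightarrow> real) \<times> real. ((fst p)(v := snd p)) i)"
    by (cases "i = v") (auto intro: continuous_intros)
qed

text \<open>The function space is a union of lines through the zero function. It is the single cell
  in the case without variables.\<close>

lemma connected_UNIV_fun: "connected (UNIV :: ('v \<Rightarrow> real) set)"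
proof -
  have conn: "connected (range (\<lambda>t. (\<lambda>i. t * x i)))" for x :: "'v \<Rightarrow> real"
    by (intro connected_continuous_image continuous_on_coordinatewise_then_product
        continuous_intros) auto
  have "connected (\<Union>x. range (\<lambda>t. (\<lambda>i. t * x i :: real)) :: ('v \<Rightarrow> real) set)"
  proof (rule connected_Union)
    have "(\<lambda>i. 0) \<in> range (\<lambda>t. (\<lambda>i. t * x i :: real))" for x :: "'v \<Rightarrow> real"
      by (rule image_eqI[of _ _ 0]) auto
    then show "\<Inter> (range (\<lambda>x. range (\<lambda>t i. t * x i :: real))) \<noteq> ({} :: ('v \<Rightarrow> real) set)"
      by blast
  qed (use conn in auto)
  moreover have "x \<in> range (\<lambda>t. (\<lambda>i. t * x i))" for x :: "'v \<Rightarrow> real"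
    by (rule image_eqI[of _ _ 1]) auto
  then have "(\<Union>x. range (\<lambda>t. (\<lambda>i. t * x i :: real)) :: ('v \<Rightarrow> real) set) = UNIV" by blast
  ultimately show ?thesis by simp
qed

lemma simple_root_sign_change:
  fixes p :: "real poly"
  assumes root: "poly p t = 0" and simple: "poly (pderiv p) t \<noteq> 0" and "\<delta> > 0"
  shows "\<exists>a b. t - \<delta> < a \<and> a < t \<and> t < b \<and> b < t + \<delta> \<and> poly p a * poly p b < 0"
proof -
  have "\<exists>a b. t - \<delta> < a \<and> a < t \<and> t < b \<and> b < t + \<delta> \<and> poly p a < 0 \<and> 0 < poly p b"
    if root: "poly p t = 0" and pos: "poly (pderiv p) t > 0" for p :: "real poly"
  proof -
    obtain d1 where d1: "d1 > 0" "\<forall>h>0. h < d1 \<longrightarrow> poly p t < poly p (t + h)"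
      using DERIV_pos_inc_right[OF poly_DERIV pos] by blast
    obtain d2 where d2: "d2 > 0" "\<forall>h>0. h < d2 \<longrightarrow> poly p (t - h) < poly p t"
      using DERIV_pos_inc_left[OF poly_DERIV pos] by blast
    define h where "h = min \<delta> (min d1 d2) / 2"
    have "h > 0" "h < \<delta>" "h < d1" "h < d2" using d1 d2 \<open>\<delta> > 0\<close> by (auto simp: h_def)
    then show ?thesis
      using d1 d2 root by (intro exI[of _ "t - h"] exI[of _ "t + h"]) auto
  qed
  from this[of p] this[of "- p"] show ?thesis
    using root simple by (cases "poly (pderiv p) t > 0")
      (auto simp: pderiv_minus mult_less_0_iff not_less le_less)
qed

text \<open>The two images coincide because they have equal cardinality, and an increasing map
  preserves ranks. In the proof, \<open>K\<close> gives the rank in the common image.\<close>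

lemma strict_mono_on_finite_unique:
  fixes f g :: "real \<Rightarrow> real"
  assumes A: "finite A" and f: "strict_mono_on A f" and g: "strict_mono_on A g"
    and fg: "f ` A \<subseteq> g ` A" and a: "a \<in> A"
  shows "f a = g a"
proof -
  have "card (f ` A) = card (g ` A)"
    using f g by (simp add: card_image strict_mono_on_imp_inj_on)
  then have img: "f ` A = g ` A" using fg A by (intro card_subset_eq) auto
  define K where "K c = card {b \<in> g ` A. b \<le> c}" for c
  have lower: "{b \<in> k ` A. b \<le> k a} = k ` {b \<in> A. b \<le> a}" if "strict_mono_on A k" for k :: "real \<Rightarrow> real"
    using that a by (auto simp: strict_mono_on_leD strict_mono_on_less_eq)
  have card: "card (k ` {b \<in> A. b \<le> a}) = card {b \<in> A. b \<le> a}" if "strict_mono_on A k" for k :: "real \<Rightarrow> real"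
    using strict_mono_on_imp_inj_on[OF that] by (intro card_image) (auto simp: inj_on_def)
  have eq: "K (f a) = K (g a)"
    using lower[OF f] lower[OF g] card[OF f] card[OF g] by (simp add: K_def img)
  have less: "K c < K d" if "c < d" "d \<in> g ` A" for c d
  proof -
    have "d \<in> {b \<in> g ` A. b \<le> d}" "d \<notin> {b \<in> g ` A. b \<le> c}"
      "{b \<in> g ` A. b \<le> c} \<subseteq> {b \<in> g ` A. b \<le> d}" using that by auto
    then have "{b \<in> g ` A. b \<le> c} \<subset> {b \<in> g ` A. b \<le> d}" by blast
    then show ?thesis unfolding K_def using A by (intro psubset_card_mono) auto
  qed
  have "f a \<in> g ` A" "g a \<in> g ` A" using a img by auto
  with less[of "f a" "g a"] less[of "g a" "f a"] eq show ?thesis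
    by (metis less_irrefl linorder_less_linear)
qed

lemma poly_family_continuous:
  assumes "P \<in> poly_family (rpoly V) d"
  shows "continuous_on UNIV (\<lambda>x. poly (P x) t)"
  unfolding poly_family_altdef[OF assms] using rpoly_continuous[OF poly_family_coeff[OF assms]]
  by (intro continuous_intros) auto

section \<open>Families closed under derivatives\<close>

definition deriv_closed :: "('b \<Rightarrow> real poly) set \<Rightarrow> bool" where
  "deriv_closed F \<longleftrightarrow> (\<forall>P\<in>F. (\<lambda>x. pderiv (P x)) \<in> F)"

lemma deriv_closed_extend:
  assumes R: "function_ring R" and F: "finite F" "F \<subseteq> poly_family R d"
  shows "\<exists>E. F \<subseteq> E \<and> finite E \<and> E \<subseteq> poly_family R d \<and> deriv_closed E"
proof -
  define D where "D P i = (\<lambda>x. (pderiv ^^ i) (P x))" for P :: "'a \<Rightarrow> real poly" and i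
  have D: "D P i \<in> poly_family R (d - i)" if "P \<in> F" for P i
  proof (induction i)
    case 0
    then show ?case using F that by (auto simp: D_def)
  next
    case (Suc i)
    have "D P i \<in> poly_family R (Suc (d - Suc i))"
      by (rule subsetD[OF poly_family_mono Suc]) simp
    from poly_family_pderiv[OF R this] show ?case by (simp add: D_def)
  qed
  define E where "E = (\<lambda>(P, i). D P i) ` (F \<times> {..d})"
  have "F \<subseteq> E"
    unfolding E_def by (auto simp: D_def intro!: image_eqI[of _ _ "(_, 0)"])
  moreover have "finite E" using F by (simp add: E_def)
  moreover have "E \<subseteq> poly_family R d"
    using D poly_family_mono[of "d - _" d R] by (fastforce simp: E_def)
  moreover have "deriv_closed E"
    unfolding deriv_closed_def
  proof
    fix Q assume "Q \<in> E"
    then obtain P i where Pi: "P \<in> F" "i \<le> d" "Q = D P i" by (auto simp: E_def)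
    have der: "(\<lambda>x. pderiv (Q x)) = D P (Suc i)" by (simp add: Pi D_def)
    show "(\<lambda>x. pderiv (Q x)) \<in> E"
    \<comment> \<open>After \<open>d\<close> derivatives the degree bound is 0, so the family is
      zero and equals its derivative; the exponents may therefore stop at \<open>d\<close>.\<close>
    proof (cases "i = d")
      case True
      then have "Q x = 0" for x
        using D[OF Pi(1), of i] Pi(3) by (simp add: poly_family_def poly_eq_iff)
      then have "(\<lambda>x. pderiv (Q x)) = Q" by auto
      then show ?thesis using \<open>Q \<in> E\<close> by simp
    next
      case False
      then show ?thesis
        unfolding der E_def using Pi by (intro image_eqI[of _ _ "(P, Suc i)"]) auto
    qed
  qed
  ultimately show ?thesis by blast
qed

definition fibre :: "('b \<Rightarrow> real poly) set \<Rightarrow> (('b \<Rightarrow> real poly) \<Rightarrow> real) \<Rightarrow> 'b \<Rightarrow> real set" where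
  "fibre F \<sigma> x = {t. \<forall>P\<in>F. sgn (poly (P x) t) = \<sigma> P}"

text \<open>Thom's lemma.\<close>

lemma is_interval_fibre:
  assumes F: "deriv_closed F"
  shows "is_interval (fibre F \<sigma> x)"
  unfolding is_interval_1
proof (intro ballI allI impI)
  fix a b c assume a: "a \<in> fibre F \<sigma> x" and b: "b \<in> fibre F \<sigma> x" and c: "a \<le> c \<and> c \<le> b"
  have "sgn (poly (P x) c) = \<sigma> P" if "P \<in> F" "a \<le> c" "c \<le> b" for P c
    using that
  proof (induction "degree (P x)" arbitrary: P c rule: less_induct)
    case less
    have ends: "sgn (poly (P x) a) = \<sigma> P" "sgn (poly (P x) b) = \<sigma> P"
      using a b less.prems by (auto simp: fibre_def)
    show ?case
    proof (cases "c = a \<or> c = b \<or> degree (P x) = 0")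
      case True
      then show ?thesis using ends by (auto elim: degree_eq_zeroE)
    next
      case False
      define P' where "P' = (\<lambda>x. pderiv (P x))"
      have P': "P' \<in> F" using F less.prems by (auto simp: deriv_closed_def P'_def)
      have "degree (P' x) < degree (P x)" using False by (simp add: P'_def degree_pderiv)
      then have sgn: "sgn (poly (pderiv (P x)) e) = \<sigma> P'" if "a \<le> e" "e \<le> b" for e
        using less.hyps[OF _ P' that] by (simp add: P'_def)
      have lt: "a < c" "c < b" using False less.prems by auto
      \<comment> \<open>A vanishing sign would give this nonzero polynomial infinitely many roots.
        So \<open>P x\<close> is strictly monotone between \<open>a\<close> and \<open>b\<close>,
        and equal signs at the ends force the same sign in between.\<close>
      have "pderiv (P x) \<noteq> 0" using False by (simp add: pderiv_eq_0_iff)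
      then have "finite {e. poly (pderiv (P x)) e = 0}" by (rule poly_roots_finite)
      moreover have "infinite {a..b}" using lt by simp
      ultimately have "\<not> {a..b} \<subseteq> {e. poly (pderiv (P x)) e = 0}"
        using finite_subset by blast
      then have "\<sigma> P' \<noteq> 0" using sgn by (auto simp: sgn_eq_0_iff)
      moreover have "\<sigma> P' = sgn (poly (pderiv (P x)) a)" using sgn[of a] lt by simp
      ultimately consider "\<sigma> P' = 1" | "\<sigma> P' = -1" by (auto simp: sgn_real_def split: if_splits)
      then show ?thesis
      proof cases
        case 1
        have "poly (pderiv (P x)) e > 0" if "a < e" "e < b" for e
          using sgn[of e] 1 that by (simp add: sgn_1_pos)
        then have "incr_on a b (P x)" by (rule incr_on_pderiv)
        from incr_onD[OF this, of a c] incr_onD[OF this, of c b] show ?thesis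
          using lt ends by (auto simp: sgn_real_def split: if_splits)
      next
        case 2
        have "poly (pderiv (- P x)) e > 0" if "a < e" "e < b" for e
          using sgn[of e] 2 that by (simp add: sgn_1_neg pderiv_minus)
        then have "incr_on a b (- P x)" by (rule incr_on_pderiv)
        from incr_onD[OF this, of a c] incr_onD[OF this, of c b] show ?thesis
          using lt ends by (auto simp: sgn_real_def split: if_splits)
      qed
    qed
  qed
  then show "c \<in> fibre F \<sigma> x" using c by (auto simp: fibre_def)
qed

lemma fibre_order_iso:
  assumes "\<And>P t. P \<in> F \<Longrightarrow> sgn (poly (P x) t) = sgn (poly (P y) (h t))"
  shows "t \<in> fibre F \<sigma> x \<longleftrightarrow> h t \<in> fibre F \<sigma> y"
  using assms by (simp add: fibre_def)

text \<open>Members that vanish identically over \<open>x\<close> are left out, which keeps the set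
  of roots finite.\<close>

definition family_roots :: "('b \<Rightarrow> real poly) set \<Rightarrow> 'b \<Rightarrow> real set" where
  "family_roots F x = {t. \<exists>P\<in>F. P x \<noteq> 0 \<and> poly (P x) t = 0}"

lemma finite_family_roots: "finite F \<Longrightarrow> finite (family_roots F x)"
proof -
  assume "finite F"
  then have "finite (\<Union>P\<in>{P\<in>F. P x \<noteq> 0}. {t. poly (P x) t = 0})"
    by (auto intro: poly_roots_finite)
  moreover have "family_roots F x = (\<Union>P\<in>{P\<in>F. P x \<noteq> 0}. {t. poly (P x) t = 0})"
    by (auto simp: family_roots_def)
  ultimately show ?thesis by simp
qed

lemma family_zero_iff:
  assumes h: "order_iso h" "\<And>t. sgn (poly p t) = sgn (poly q (h t))"
  shows "p = 0 \<longleftrightarrow> q = 0"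
proof -
  have "p = 0 \<longleftrightarrow> (\<forall>t. sgn (poly p t) = 0)" by (simp add: sgn_eq_0_iff poly_all_0_iff_0)
  also have "\<dots> \<longleftrightarrow> (\<forall>t. sgn (poly q t) = 0)" using h(2) order_iso_surj[OF h(1)] by metis
  also have "\<dots> \<longleftrightarrow> q = 0" by (simp add: sgn_eq_0_iff poly_all_0_iff_0)
  finally show ?thesis .
qed

lemma family_roots_order_iso:
  assumes h: "order_iso h" "\<And>P t. P \<in> F \<Longrightarrow> sgn (poly (P x) t) = sgn (poly (P y) (h t))"
  shows "family_roots F y = h ` family_roots F x"
proof -
  have nz: "P x = 0 \<longleftrightarrow> P y = 0" if "P \<in> F" for P
    using family_zero_iff[OF h(1) h(2)[OF that]] .
  have iff: "h t \<in> family_roots F y \<longleftrightarrow> t \<in> family_roots F x" for t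
  proof -
    have "poly (P x) t = 0 \<longleftrightarrow> poly (P y) (h t) = 0" if "P \<in> F" for P
      using h(2)[OF that, of t] by (metis sgn_0_0)
    then show ?thesis using nz by (auto simp: family_roots_def)
  qed
  then show ?thesis using order_iso_surj[OF h(1)] by (auto simp: image_iff) metis
qed

text \<open>Passing from a member with a multiple root at \<open>t\<close> to its derivative lowers
  the degree, so this ends with a member for which the root is simple.\<close>

lemma family_simple_root:
  assumes F: "deriv_closed F" and t: "t \<in> family_roots F x"
  shows "\<exists>P\<in>F. poly (P x) t = 0 \<and> poly (pderiv (P x)) t \<noteq> 0"
proof -
  obtain P where "P \<in> F" "P x \<noteq> 0" "poly (P x) t = 0" using t by (auto simp: family_roots_def)
  then show ?thesis
  proof (induction "degree (P x)" arbitrary: P rule: less_induct)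
    case less
    have "degree (P x) \<noteq> 0"
    proof
      assume "degree (P x) = 0"
      then obtain c where "P x = [:c:]" by (rule degree_eq_zeroE)
      then show False using less.prems by simp
    qed
    then have "degree (pderiv (P x)) < degree (P x)" "pderiv (P x) \<noteq> 0"
      by (simp_all add: degree_pderiv pderiv_eq_0_iff)
    then show ?case
      using less.hyps[of "\<lambda>x. pderiv (P x)"] less.prems F by (cases "poly (pderiv (P x)) t = 0")
        (auto simp: deriv_closed_def)
  qed
qed

text \<open>Near \<open>x0\<close> every root over \<open>x0\<close> persists, being a simple root of some member of the family.
  As the numbers of roots agree, the persisting roots are the ones given by the diagram.\<close>

lemma fibre_lower_hemicontinuous:
  assumes F: "finite F" "F \<subseteq> poly_family (rpoly V) d" "deriv_closed F"
    and C: "\<And>x y. x \<in> C \<Longrightarrow> y \<in> C \<Longrightarrow> same_diagram F x y"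
    and x0: "x0 \<in> C" and t0: "t0 \<in> fibre F \<sigma> x0" and "\<epsilon> > 0"
  shows "\<exists>N. open N \<and> x0 \<in> N \<and> (\<forall>x\<in>N \<inter> C. \<exists>t\<in>fibre F \<sigma> x. \<bar>t - t0\<bar> < \<epsilon>)"
proof -
  have cont: "continuous_on UNIV (\<lambda>x. poly (P x) t)" if "P \<in> F" for P t
    using poly_family_continuous F(2) that by blast
  have open_pos: "open {x. poly (P x) t * c > 0}" if "P \<in> F" for P t c
    using cont[OF that, of t] by (intro open_Collect_less continuous_intros) auto
  show ?thesis
  proof (cases "t0 \<in> family_roots F x0")
    \<comment> \<open>Here \<open>t0\<close> itself works: nonzero signs persist near
      \<open>x0\<close>, and a member vanishing at \<open>t0\<close> vanishes identically over
      \<open>x0\<close>, hence over all of \<open>C\<close>.\<close>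
    case False
    define N where "N = (\<Inter>P\<in>{P\<in>F. \<sigma> P \<noteq> 0}. {x. poly (P x) t0 * \<sigma> P > 0})"
    have "open N" unfolding N_def using F(1) open_pos by (intro open_INT) auto
    moreover have "x0 \<in> N"
    proof -
      have "poly (P x0) t0 * \<sigma> P > 0" if "P \<in> F" "\<sigma> P \<noteq> 0" for P
      proof -
        have s: "\<sigma> P = sgn (poly (P x0) t0)" using t0 that by (simp add: fibre_def)
        with that have "poly (P x0) t0 < 0 \<or> poly (P x0) t0 > 0" by (auto simp: sgn_eq_0_iff)
        then show ?thesis unfolding s by auto
      qed
      then show ?thesis by (simp add: N_def)
    qed
    moreover have "t0 \<in> fibre F \<sigma> x" if x: "x \<in> N" "x \<in> C" for x
      unfolding fibre_def
    proof (intro CollectI ballI)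
      fix P assume P: "P \<in> F"
      have s: "sgn (poly (P x0) t0) = \<sigma> P" using t0 P by (simp add: fibre_def)
      show "sgn (poly (P x) t0) = \<sigma> P"
      proof (cases "\<sigma> P = 0")
        case True
        then have "P x0 = 0" using s False P by (auto simp: family_roots_def sgn_eq_0_iff)
        moreover obtain h where "order_iso h" "\<And>t. sgn (poly (P x0) t) = sgn (poly (P x) (h t))"
          using C[OF x0 x(2)] P unfolding same_diagram_def by blast
        ultimately have "P x = 0" using family_zero_iff by blast
        then show ?thesis using True by simp
      next
        case nz: False
        then have "poly (P x) t0 * \<sigma> P > 0" using x P by (auto simp: N_def)
        moreover have "\<sigma> P = 1 \<or> \<sigma> P = -1" using s nz by (auto simp: sgn_real_def split: if_splits)
        ultimately show ?thesis by (auto simp: sgn_real_def)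
      qed
    qed
    ultimately show ?thesis using \<open>\<epsilon> > 0\<close> by (intro exI[of _ N]) force
  next
    case True
    define Z where "Z = family_roots F x0"
    have Z: "finite Z" using finite_family_roots[OF F(1)] by (simp add: Z_def)
    \<comment> \<open>At most half the distance between any two roots, and at most
      \<open>\<epsilon>\<close>: intervals of radius \<open>\<delta>\<close> around the roots do not
      overlap, and the root that replaces \<open>t0\<close> is closer than
      \<open>\<epsilon>\<close>.\<close>
    define \<delta> where "\<delta> = Min (insert \<epsilon> ((\<lambda>(s, t). \<bar>s - t\<bar> / 2) ` {(s, t) \<in> Z \<times> Z. s \<noteq> t}))"
    have fin: "finite ((\<lambda>(s, t). \<bar>s - t\<bar> / 2) ` {(s, t) \<in> Z \<times> Z. s \<noteq> t})"
      by (rule finite_imageI, rule finite_subset[of _ "Z \<times> Z"]) (use Z in auto)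
    have "\<delta> > 0" unfolding \<delta>_def using fin \<open>\<epsilon> > 0\<close> by (subst Min_gr_iff) auto
    have "\<delta> \<le> \<epsilon>" unfolding \<delta>_def using fin by (intro Min_le) auto
    have sep: "s + \<delta> \<le> t - \<delta>" if "s \<in> Z" "t \<in> Z" "s < t" for s t
    proof -
      have "\<delta> \<le> \<bar>s - t\<bar> / 2"
        unfolding \<delta>_def using fin that by (intro Min_le) (auto intro!: image_eqI[of _ _ "(s, t)"])
      then show ?thesis using that by simp
    qed
    \<comment> \<open>The triple consists of a member of \<open>F\<close> and two points on either
      side of \<open>t\<close> at which this member has opposite signs.\<close>
    have "\<exists>G. fst G \<in> F \<and> t - \<delta> < fst (snd G) \<and> fst (snd G) < t \<and> t < snd (snd G) \<and>
        snd (snd G) < t + \<delta> \<and>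
        poly (fst G x0) (fst (snd G)) * poly (fst G x0) (snd (snd G)) < 0" if tZ: "t \<in> Z" for t
    proof -
      obtain P where P: "P \<in> F" "poly (P x0) t = 0" "poly (pderiv (P x0)) t \<noteq> 0"
        using family_simple_root[OF F(3)] tZ unfolding Z_def by blast
      from simple_root_sign_change[OF P(2,3) \<open>\<delta> > 0\<close>] obtain a b where
        "t - \<delta> < a \<and> a < t \<and> t < b \<and> b < t + \<delta> \<and> poly (P x0) a * poly (P x0) b < 0" by blast
      then show ?thesis using P by (intro exI[of _ "(P, a, b)"]) simp
    qed
    then have "\<exists>G. \<forall>t\<in>Z. fst (G t) \<in> F \<and> t - \<delta> < fst (snd (G t)) \<and> fst (snd (G t)) < t \<and>
        t < snd (snd (G t)) \<and> snd (snd (G t)) < t + \<delta> \<and>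
        poly (fst (G t) x0) (fst (snd (G t))) * poly (fst (G t) x0) (snd (snd (G t))) < 0"
      by (intro bchoice ballI)
    then obtain G where G: "\<forall>t\<in>Z. fst (G t) \<in> F \<and> t - \<delta> < fst (snd (G t)) \<and> fst (snd (G t)) < t \<and>
        t < snd (snd (G t)) \<and> snd (snd (G t)) < t + \<delta> \<and>
        poly (fst (G t) x0) (fst (snd (G t))) * poly (fst (G t) x0) (snd (snd (G t))) < 0" ..
    define g where "g t = fst (G t)" for t
    define a where "a t = fst (snd (G t))" for t
    define b where "b t = snd (snd (G t))" for t
    have g: "g t \<in> F" "t - \<delta> < a t" "a t < t" "t < b t" "b t < t + \<delta>"
      "poly (g t x0) (a t) * poly (g t x0) (b t) < 0" if "t \<in> Z" for t
      using G that by (auto simp: g_def a_def b_def)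
    \<comment> \<open>On \<open>N\<close> the signs at both ends of each bracket are still those
      over \<open>x0\<close>, so a root remains in the bracket.\<close>
    define N where "N = (\<Inter>t\<in>Z. {x. poly (g t x) (a t) * poly (g t x0) (a t) > 0} \<inter>
        {x. poly (g t x) (b t) * poly (g t x0) (b t) > 0})"
    have "open N" unfolding N_def using Z open_pos g(1) by (intro open_INT ballI open_Int) auto
    moreover have "x0 \<in> N"
      using g(6) by (auto simp: N_def zero_less_mult_iff mult_less_0_iff)
    moreover have "\<exists>t\<in>fibre F \<sigma> x. \<bar>t - t0\<bar> < \<epsilon>" if x: "x \<in> N" "x \<in> C" for x
    proof -
      have "\<exists>r. a t < r \<and> r < b t \<and> r \<in> family_roots F x" if t: "t \<in> Z" for t
      proof -
        have pos: "poly (g t x) (a t) * poly (g t x0) (a t) > 0"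
          "poly (g t x) (b t) * poly (g t x0) (b t) > 0"
          using x(1) t by (auto simp: N_def)
        then have "poly (g t x) (a t) * poly (g t x) (b t) < 0"
          using g(6)[OF t] by (auto simp: zero_less_mult_iff mult_less_0_iff)
        moreover have "a t < b t" using g[OF t] by simp
        ultimately obtain r where r: "a t < r" "r < b t" "poly (g t x) r = 0"
          using poly_IVT[of "a t" "b t" "g t x"] by blast
        have "g t x \<noteq> 0" using pos by auto
        then show ?thesis using r g(1)[OF t] by (auto simp: family_roots_def)
      qed
      then have "\<exists>\<rho>. \<forall>t\<in>Z. a t < \<rho> t \<and> \<rho> t < b t \<and> \<rho> t \<in> family_roots F x"
        by (intro bchoice ballI)
      then obtain \<rho> where \<rho>: "\<And>t. t \<in> Z \<Longrightarrow> a t < \<rho> t \<and> \<rho> t < b t \<and> \<rho> t \<in> family_roots F x"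
        by auto
      obtain h where h: "order_iso h" "\<And>P t. P \<in> F \<Longrightarrow> sgn (poly (P x0) t) = sgn (poly (P x) (h t))"
        using C[OF x0 x(2)] unfolding same_diagram_def by blast
      \<comment> \<open>Both maps are increasing on the roots over \<open>x0\<close>, and
        \<open>h\<close> reaches every root over \<open>x\<close>. So the bracketed roots are the
        images under \<open>h\<close>, and these satisfy the prescribed signs.\<close>
      have "\<rho> t0 = h t0"
      proof (rule strict_mono_on_finite_unique[OF Z, where f = \<rho> and g = h])
        show "strict_mono_on Z \<rho>"
        proof (rule strict_mono_onI)
          fix s t assume st: "s \<in> Z" "t \<in> Z" "s < t"
          then show "\<rho> s < \<rho> t" using sep[OF st] \<rho>[OF st(1)] \<rho>[OF st(2)] g[OF st(1)] g[OF st(2)] by linarith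
        qed
        show "strict_mono_on Z h" using h(1) by (auto simp: order_iso_def strict_mono_def strict_mono_on_def)
        show "\<rho> ` Z \<subseteq> h ` Z" using \<rho> family_roots_order_iso[of h F x0 x, OF h] by (auto simp: Z_def)
        show "t0 \<in> Z" using True by (simp add: Z_def)
      qed
      then have "\<rho> t0 \<in> fibre F \<sigma> x" using fibre_order_iso[of F x0 x h t0 \<sigma>, OF h(2)] t0 by simp
      moreover have "\<bar>\<rho> t0 - t0\<bar> < \<epsilon>"
        using \<rho>[of t0] g[of t0] True \<open>\<delta> \<le> \<epsilon>\<close> by (simp add: Z_def abs_if)
      ultimately show ?thesis by blast
    qed
    ultimately show ?thesis by (intro exI[of _ N]) blast
  qed
qed

section \<open>Cylindrical decomposition into connected cells\<close>

lemma open_in_from_local: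
  assumes "\<And>x. x \<in> M \<Longrightarrow> \<exists>W. open W \<and> x \<in> W \<and> W \<inter> C \<subseteq> M" "M \<subseteq> C"
  obtains U where "open U" "U \<inter> C = M"
proof
  show "open (\<Union>{W. open W \<and> W \<inter> C \<subseteq> M})" by auto
  show "\<Union>{W. open W \<and> W \<inter> C \<subseteq> M} \<inter> C = M"
  proof (intro subset_antisym subsetI)
    fix x assume x: "x \<in> M"
    obtain W where "open W" "x \<in> W" "W \<inter> C \<subseteq> M" using assms(1)[OF x] by blast
    then show "x \<in> \<Union>{W. open W \<and> W \<inter> C \<subseteq> M} \<inter> C" using x assms(2) by blast
  qed auto
qed

text \<open>A nonempty cell projects onto \<open>C\<close> with connected fibres. Lower
  hemicontinuity makes the projection of a relatively open part of the cell open in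
  \<open>C\<close>, so a separation of the cell would separate \<open>C\<close> or a single
  fibre.\<close>

lemma connected_cell:
  fixes v :: 'v
  assumes F: "finite F" "F \<subseteq> poly_family (rpoly V) d" "deriv_closed F" and v: "v \<notin> V"
    and C: "\<And>x y. x \<in> C \<Longrightarrow> y \<in> C \<Longrightarrow> same_diagram F x y"
    and conn: "connected C" and C_upd: "\<And>x t. x \<in> C \<Longrightarrow> x(v := t) \<in> C"
  shows "connected {x \<in> C. x v \<in> fibre F \<sigma> x}"
proof (cases "{x \<in> C. x v \<in> fibre F \<sigma> x} = {}")
  case False
  then obtain x1 where x1: "x1 \<in> C" "x1 v \<in> fibre F \<sigma> x1" by blast
  have upd: "P (x(v := t)) = P x" if "P \<in> F" for P x t
    using rpoly_fun_upd[OF poly_family_coeff, of P V d v] F(2) that v by (auto simp: poly_eq_iff)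
  then have fibre_upd: "fibre F \<sigma> (x(v := t)) = fibre F \<sigma> x" for x t
    unfolding fibre_def by metis
  have in_cell: "x(v := t) \<in> {x \<in> C. x v \<in> fibre F \<sigma> x} \<longleftrightarrow> t \<in> fibre F \<sigma> x" if "x \<in> C" for x t
    using that C_upd by (simp add: fibre_upd)
  have ne: "fibre F \<sigma> x \<noteq> {}" if xC: "x \<in> C" for x
  proof -
    obtain h where "\<And>P t. P \<in> F \<Longrightarrow> sgn (poly (P x1) t) = sgn (poly (P x) (h t))"
      using C[OF x1(1) xC] unfolding same_diagram_def by blast
    then show ?thesis using fibre_order_iso[of F x1 x h] x1(2) by blast
  qed
  have conn_fibre: "connected ((\<lambda>t. x(v := t)) ` fibre F \<sigma> x)" for x
  proof (rule connected_continuous_image)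
    show "continuous_on (fibre F \<sigma> x) (\<lambda>t. x(v := t))"
    proof (rule continuous_on_coordinatewise_then_product)
      show "continuous_on (fibre F \<sigma> x) (\<lambda>t. (x(v := t)) i)" for i
        by (cases "i = v") (auto intro: continuous_intros)
    qed
    show "connected (fibre F \<sigma> x)" using is_interval_fibre[OF F(3)] is_interval_connected by blast
  qed
  show ?thesis
  proof (rule connectedI)
    fix O1 O2 :: "('v \<Rightarrow> real) set"
    assume O: "open O1" "open O2" and meet: "O1 \<inter> {x \<in> C. x v \<in> fibre F \<sigma> x} \<noteq> {}"
        "O2 \<inter> {x \<in> C. x v \<in> fibre F \<sigma> x} \<noteq> {}"
      and disj: "O1 \<inter> O2 \<inter> {x \<in> C. x v \<in> fibre F \<sigma> x} = {}"
      and cover: "{x \<in> C. x v \<in> fibre F \<sigma> x} \<subseteq> O1 \<union> O2"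
    \<comment> \<open>The base points over which the cell meets \<open>O'\<close>. The coordinate
      \<open>v\<close> of the base point itself is overwritten and has no influence.\<close>
    define M where "M O' = {x \<in> C. \<exists>t\<in>fibre F \<sigma> x. x(v := t) \<in> O'}" for O'
    have loc: "\<exists>W. open W \<and> x0 \<in> W \<and> W \<inter> C \<subseteq> M O'" if O': "open O'" and x0: "x0 \<in> M O'" for O' x0
    proof -
      obtain t0 where t0: "x0 \<in> C" "t0 \<in> fibre F \<sigma> x0" "x0(v := t0) \<in> O'" using x0 by (auto simp: M_def)
      have "open ((\<lambda>p. (fst p)(v := snd p)) -` O')"
        using open_vimage[OF O' continuous_on_fun_upd] .
      then obtain A B where AB: "open A" "open B" "x0 \<in> A" "t0 \<in> B"
        "A \<times> B \<subseteq> (\<lambda>p. (fst p)(v := snd p)) -` O'"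
        using t0(3) by (auto elim: open_prod_elim[of _ "(x0, t0)"])
      obtain \<epsilon> where \<epsilon>: "\<epsilon> > 0" "\<And>t. \<bar>t - t0\<bar> < \<epsilon> \<Longrightarrow> t \<in> B"
        using AB(2,4) unfolding open_dist dist_real_def by blast
      obtain N where N: "open N" "x0 \<in> N" "\<forall>x\<in>N \<inter> C. \<exists>t\<in>fibre F \<sigma> x. \<bar>t - t0\<bar> < \<epsilon>"
        using fibre_lower_hemicontinuous[OF F C t0(1,2) \<epsilon>(1)] by blast
      have "N \<inter> A \<inter> C \<subseteq> M O'"
      proof
        fix x assume x: "x \<in> N \<inter> A \<inter> C"
        then obtain t where t: "t \<in> fibre F \<sigma> x" "t \<in> B" using N(3) \<epsilon>(2) by blast
        then have "x(v := t) \<in> O'" using AB(5) x by (force simp: subset_iff)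
        then show "x \<in> M O'" using t x by (auto simp: M_def)
      qed
      then show ?thesis using N(1,2) AB(1,3) by (intro exI[of _ "N \<inter> A"]) auto
    qed
    obtain U1 where U1: "open U1" "U1 \<inter> C = M O1"
      by (rule open_in_from_local[of "M O1" C]) (use loc[OF O(1)] in \<open>auto simp: M_def\<close>)
    obtain U2 where U2: "open U2" "U2 \<inter> C = M O2"
      by (rule open_in_from_local[of "M O2" C]) (use loc[OF O(2)] in \<open>auto simp: M_def\<close>)
    have "C \<subseteq> U1 \<union> U2"
    proof
      fix x assume x: "x \<in> C"
      then obtain t where t: "t \<in> fibre F \<sigma> x" using ne by blast
      then have "x(v := t) \<in> O1 \<union> O2" using in_cell[OF x, of t] cover by blast
      then have "x \<in> M O1 \<union> M O2" using x t by (auto simp: M_def)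
      then show "x \<in> U1 \<union> U2" using U1 U2 by blast
    qed
    moreover have "U1 \<inter> U2 \<inter> C = {}"
    proof (rule ccontr)
      assume "\<not> ?thesis"
      then obtain x where "x \<in> M O1" "x \<in> M O2" using U1 U2 by blast
      then obtain s t where st: "x \<in> C" "s \<in> fibre F \<sigma> x" "x(v := s) \<in> O1"
        "t \<in> fibre F \<sigma> x" "x(v := t) \<in> O2" by (auto simp: M_def)
      have sub: "(\<lambda>t. x(v := t)) ` fibre F \<sigma> x \<subseteq> {x \<in> C. x v \<in> fibre F \<sigma> x}"
        using in_cell[OF st(1)] by blast
      show False
        using connectedD[OF conn_fibre[of x] O] sub cover disj st by blast
    qed
    moreover have "U1 \<inter> C \<noteq> {}" "U2 \<inter> C \<noteq> {}"
    proof -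
      have "M O' \<noteq> {}" if meet: "O' \<inter> {x \<in> C. x v \<in> fibre F \<sigma> x} \<noteq> {}" for O'
      proof -
        obtain x where x: "x \<in> O'" "x \<in> C" "x v \<in> fibre F \<sigma> x" using meet by blast
        then have "x \<in> M O'" by (auto simp: M_def intro!: bexI[of _ "x v"])
        then show ?thesis by blast
      qed
      then show "U1 \<inter> C \<noteq> {}" "U2 \<inter> C \<noteq> {}" using U1 U2 meet by auto
    qed
    ultimately show False using connectedD[OF conn U1(1) U2(1)] by blast
  qed
qed (use connected_empty in metis)

lemma rpoly_family_eval:
  assumes "P \<in> poly_family (rpoly V) d"
  shows "(\<lambda>x. poly (P x) (x v)) \<in> rpoly (insert v V)"
  unfolding poly_family_altdef[OF assms]
  using poly_family_coeff[OF assms] rpoly_mono[of V "insert v V"]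
  by (intro function_ring_sum function_ring_mult function_ring_power function_ring_rpoly)
     (auto intro: rpoly.coord)

text \<open>A cylindrical decomposition: over a connected piece of a sign class the diagram of a
  family closed under derivatives does not change, and each sign condition on the family cuts out a
  connected cell above the piece.\<close>

theorem semialg_connected_cover:
  assumes "finite V" "semialg (rpoly V) S"
  shows "\<exists>\<C>. finite \<C> \<and> (\<forall>C\<in>\<C>. connected C \<and> semialg (rpoly V) C) \<and> S = \<Union>\<C>"
  using assms
proof (induction V arbitrary: S rule: finite_induct)
  case empty
  have const: "f x = f y" if "f \<in> rpoly {}" for f :: "('a \<Rightarrow> real) \<Rightarrow> real" and x y
    using that by induction auto
  obtain A :: "(('a \<Rightarrow> real) \<Rightarrow> real) set" where "A \<subseteq> rpoly {}"
    "\<forall>x y. same_signs A x y \<longrightarrow> x \<in> S \<longrightarrow> y \<in> S"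
    using empty unfolding semialg_def by blast
  moreover have "same_signs A x y" for x y
    using const \<open>A \<subseteq> rpoly {}\<close> unfolding same_signs_def by (metis subsetD)
  ultimately have "S = {} \<or> S = UNIV" by blast
  then show ?case
  proof
    assume "S = {}"
    then show ?thesis by (intro exI[of _ "{}"]) auto
  next
    assume "S = UNIV"
    then show ?thesis using connected_UNIV_fun empty by (intro exI[of _ "{UNIV}"]) auto
  qed
next
  case (insert v V)
  obtain A where A: "A \<subseteq> rpoly (insert v V)" "finite A"
    "\<And>x y. same_signs A x y \<Longrightarrow> x \<in> S \<Longrightarrow> y \<in> S"
    using insert.prems unfolding semialg_def by blast
  from rpoly_family_finite[OF A(2,1) insert.hyps(2)] obtain d P where
    P: "\<forall>f\<in>A. P f \<in> poly_family (rpoly V) d \<and> (\<forall>x t. f (x(v := t)) = poly (P f x) t)"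
    by (elim exE)
  then have "P ` A \<subseteq> poly_family (rpoly V) d" by blast
  from deriv_closed_extend[OF function_ring_rpoly finite_imageI[OF A(2)] this]
  obtain F where F: "P ` A \<subseteq> F" "finite F" "F \<subseteq> poly_family (rpoly V) d"
    "deriv_closed F"
    by (elim exE conjE)
  have "signs_determined (rpoly V) F"
    using sign_determination[OF function_ring_rpoly F(2,3)] .
  then obtain B where B: "B \<subseteq> rpoly V" "finite B"
    "\<And>x y. same_signs B x y \<Longrightarrow> same_diagram F x y"
    unfolding signs_determined_def by blast
  have "\<exists>\<C>. finite \<C> \<and> (\<forall>C\<in>\<C>. connected C \<and> semialg (rpoly V) C) \<and> K = \<Union>\<C>"
    if "K \<in> sign_classes B" for K
    using that B by (intro insert.IH) (auto simp: sign_classes_def intro: semialg_sign_class)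
  then have "\<exists>\<K>. \<forall>K\<in>sign_classes B. finite (\<K> K) \<and>
      (\<forall>C\<in>\<K> K. connected C \<and> semialg (rpoly V) C) \<and> K = \<Union>(\<K> K)"
    by (intro bchoice ballI)
  then obtain \<K> where "\<forall>K\<in>sign_classes B. finite (\<K> K) \<and>
      (\<forall>C\<in>\<K> K. connected C \<and> semialg (rpoly V) C) \<and> K = \<Union>(\<K> K)" ..
  then have \<K>: "finite (\<K> K)" "\<And>C. C \<in> \<K> K \<Longrightarrow> connected C \<and> semialg (rpoly V) C"
    "K = \<Union>(\<K> K)" if "K \<in> sign_classes B" for K
    using that by blast+
  \<comment> \<open>A point supplies both the base point and, as its coordinate \<open>v\<close>, a
    point of the line over it. Sign conditions in the fibres thus become sign classes of functions
    on the whole space.\<close>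
  define ev where "ev Q = (\<lambda>x. poly (Q x) (x v))" for Q :: "('a \<Rightarrow> real) \<Rightarrow> real poly"
  have A_ev: "A \<subseteq> ev ` F"
  proof
    fix f assume f: "f \<in> A"
    have "f x = poly (P f x) (x v)" for x
      using P f fun_upd_triv[of x v] by metis
    then have "f = ev (P f)" by (auto simp: ev_def)
    then show "f \<in> ev ` F" using F(1) f by blast
  qed
  have ev: "ev ` F \<subseteq> rpoly (insert v V)"
    using F(3) rpoly_family_eval[of _ V d v] by (auto simp: ev_def)
  \<comment> \<open>A base piece is described without \<open>v\<close> and is thus a cylinder; its
    intersection with a sign class of the evaluated family is one cell.\<close>
  define \<C> where "\<C> = (\<lambda>(C, D). C \<inter> D) ` ((\<Union>K\<in>sign_classes B. \<K> K) \<times> {D \<in> sign_classes (ev ` F). D \<subseteq> S})"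
  have "finite \<C>"
    unfolding \<C>_def using finite_sign_classes[OF B(2)] \<K>(1) finite_sign_classes[of "ev ` F"] F(2)
    by (intro finite_imageI finite_cartesian_product finite_UN_I) auto
  moreover have "connected E \<and> semialg (rpoly (insert v V)) E" if E: "E \<in> \<C>" for E
  proof -
    obtain K C D where KCD: "K \<in> sign_classes B" "C \<in> \<K> K" "D \<in> sign_classes (ev ` F)" "E = C \<inter> D"
      using E by (auto simp: \<C>_def)
    have C: "connected C" "semialg (rpoly V) C" "C \<subseteq> K" using \<K>[OF KCD(1)] KCD(2) by auto
    obtain \<tau> where \<tau>: "K = sign_class B \<tau>" using KCD(1) by (auto simp: sign_classes_def)
    obtain \<sigma> where \<sigma>: "D = sign_class (ev ` F) \<sigma>" using KCD(3) by (auto simp: sign_classes_def)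
    obtain A' where A': "A' \<subseteq> rpoly V" "\<And>x y. same_signs A' x y \<Longrightarrow> x \<in> C \<Longrightarrow> y \<in> C"
      using C(2) unfolding semialg_def by blast
    have "x(v := t) \<in> C" if "x \<in> C" for x t
    proof (rule A'(2)[OF _ that])
      show "same_signs A' x (x(v := t))"
        unfolding same_signs_def
      proof
        fix a assume "a \<in> A'"
        then have "a (x(v := t)) = a x" using A'(1) insert.hyps(2) by (intro rpoly_fun_upd[of a V]) auto
        then show "sgn (a x) = sgn (a (x(v := t)))" by simp
      qed
    qed
    moreover have "same_diagram F x y" if "x \<in> C" "y \<in> C" for x y
    proof (rule B(3))
      have "x \<in> K" "y \<in> K" using that C(3) by auto
      then show "same_signs B x y" by (simp add: \<tau> sign_class_def same_signs_def)
    qed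
    ultimately have "connected {x \<in> C. x v \<in> fibre F (\<lambda>P. \<sigma> (ev P)) x}"
      using connected_cell[OF F(2,3,4) insert.hyps(2)] C(1) by blast
    moreover have "{x \<in> C. x v \<in> fibre F (\<lambda>P. \<sigma> (ev P)) x} = E"
      by (auto simp: KCD(4) \<sigma> sign_class_def fibre_def ev_def)
    moreover have "semialg (rpoly (insert v V)) C"
      using semialg_vimage[OF C(2), of "\<lambda>x. x" "rpoly (insert v V)"] rpoly_mono[of V "insert v V"]
      by auto
    then have "semialg (rpoly (insert v V)) E"
      unfolding KCD(4) \<sigma> using ev F(2) by (intro semialg_Int semialg_sign_class) auto
    ultimately show ?thesis by simp
  qed
  moreover have "S = \<Union>\<C>"
  proof (intro subset_antisym subsetI)
    fix x assume x: "x \<in> S"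
    obtain K where K: "K \<in> sign_classes B" "x \<in> K" using sign_classes_cover[of B x] by blast
    then obtain C where C: "C \<in> \<K> K" "x \<in> C" using \<K>(3)[OF K(1)] by blast
    obtain D where D: "D \<in> sign_classes (ev ` F)" "x \<in> D" using sign_classes_cover[of "ev ` F" x] by blast
    then obtain \<sigma> where \<sigma>: "D = sign_class (ev ` F) \<sigma>" by (auto simp: sign_classes_def)
    have "y \<in> S" if "y \<in> D" for y
    proof (rule A(3)[OF _ x])
      show "same_signs A x y"
        using A_ev D(2) that unfolding \<sigma> sign_class_def same_signs_def by fastforce
    qed
    then have "C \<inter> D \<in> \<C>"
      using K C D by (auto simp: \<C>_def intro!: image_eqI[of _ _ "(C, D)"])
    then show "x \<in> \<Union>\<C>" using C D by blast
  next
    fix x assume "x \<in> \<Union>\<C>"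
    then show "x \<in> S" by (auto simp: \<C>_def)
  qed
  ultimately show ?case by blast
qed

section \<open>Local coordinate expressions of morphisms\<close>

definition real_coords :: "complex ^ 'i \<Rightarrow> 'i \<Rightarrow> real" where
  "real_coords z = (\<lambda>k. Re (z $ k))"

definition real_vec :: "complex ^ 'i \<Rightarrow> bool" where
  "real_vec z \<longleftrightarrow> (\<forall>k. z $ k \<in> \<real>)"

lemma real_vec_nth: "real_vec z \<Longrightarrow> z $ k = of_real (real_coords z k)"
  by (simp add: real_vec_def real_coords_def of_real_Re)

lemma real_coords_eq_iff: "real_vec z \<Longrightarrow> real_vec w \<Longrightarrow> real_coords z = real_coords w \<longleftrightarrow> z = w"
  by (auto simp: vec_eq_iff real_vec_nth)

text \<open>Real coefficients give real values at real vectors, so that equations on the charts can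
  be read as real polynomial functions and treated by the semialgebraic part.\<close>

lemma polyfun_real:
  assumes "p \<in> polyfun \<real>"
  shows "\<exists>f\<in>rpoly UNIV. \<forall>z. real_vec z \<longrightarrow> p z = of_real (f (real_coords z))"
  using assms
proof induction
  case (const c)
  then obtain r where "c = of_real r" by (auto elim: Reals_cases)
  then show ?case by (intro bexI[of _ "\<lambda>x. r"]) (auto intro: rpoly.const)
next
  case (coord k)
  show ?case by (intro bexI[of _ "\<lambda>x. x k"]) (auto intro: rpoly.coord simp: real_vec_nth)
next
  case (add p q)
  then obtain f g where "f \<in> rpoly UNIV" "g \<in> rpoly UNIV"
    "\<forall>z. real_vec z \<longrightarrow> p z = of_real (f (real_coords z))"
    "\<forall>z. real_vec z \<longrightarrow> q z = of_real (g (real_coords z))" by blast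
  then show ?case by (intro bexI[of _ "\<lambda>x. f x + g x"]) (auto intro: rpoly.add)
next
  case (mult p q)
  then obtain f g where "f \<in> rpoly UNIV" "g \<in> rpoly UNIV"
    "\<forall>z. real_vec z \<longrightarrow> p z = of_real (f (real_coords z))"
    "\<forall>z. real_vec z \<longrightarrow> q z = of_real (g (real_coords z))" by blast
  then show ?case by (intro bexI[of _ "\<lambda>x. f x * g x"]) (auto intro: rpoly.mult)
qed

lemma rpoly_polyfun:
  assumes "f \<in> rpoly V"
  shows "\<exists>p\<in>polyfun \<real>. \<forall>z. real_vec z \<longrightarrow> p z = of_real (f (real_coords z))"
  using assms
proof induction
  case (const c)
  show ?case by (intro bexI[of _ "\<lambda>z. of_real c"]) (auto intro: polyfun.const)
next
  case (coord k)
  show ?case by (intro bexI[of _ "\<lambda>z. z $ k"]) (auto intro: polyfun.coord simp: real_vec_nth)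
next
  case (add f g)
  then obtain p q where "p \<in> polyfun \<real>" "q \<in> polyfun \<real>"
    "\<forall>z. real_vec z \<longrightarrow> p z = of_real (f (real_coords z))"
    "\<forall>z. real_vec z \<longrightarrow> q z = of_real (g (real_coords z))" by blast
  then show ?case by (intro bexI[of _ "\<lambda>z. p z + q z"]) (auto intro: polyfun.add)
next
  case (mult f g)
  then obtain p q where "p \<in> polyfun \<real>" "q \<in> polyfun \<real>"
    "\<forall>z. real_vec z \<longrightarrow> p z = of_real (f (real_coords z))"
    "\<forall>z. real_vec z \<longrightarrow> q z = of_real (g (real_coords z))" by blast
  then show ?case by (intro bexI[of _ "\<lambda>z. p z * q z"]) (auto intro: polyfun.mult)
qed

lemma polyfun_continuous: "p \<in> polyfun K \<Longrightarrow> continuous_on S p"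
  by (induction rule: polyfun.induct) (auto intro!: continuous_intros)

lemma polyfun_prod:
  assumes "1 \<in> K" "\<And>i. i \<in> I \<Longrightarrow> p i \<in> polyfun K"
  shows "(\<lambda>z. \<Prod>i\<in>I. p i z) \<in> polyfun K"
  using assms(2)
  by (induction I rule: infinite_finite_induct) (auto intro: polyfun.mult polyfun.const assms(1))

lemma polyfun_Reals: "p \<in> polyfun \<real> \<Longrightarrow> real_vec z \<Longrightarrow> p z \<in> \<real>"
  by (induction rule: polyfun.induct) (auto simp: real_vec_def)

lemma polyfun_join_left:
  assumes "p \<in> polyfun \<real>" "real_vec w"
  shows "(\<lambda>z. p (join_vec z w)) \<in> polyfun \<real>"
  using assms(1)
proof induction
  case (coord k)
  show ?case
    by (cases k) (use assms(2) in \<open>auto simp: join_vec_def real_vec_def intro: polyfun.intros\<close>)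
qed (auto intro: polyfun.intros)

lemma polyfun_join_right:
  assumes "p \<in> polyfun \<real>" "real_vec w"
  shows "(\<lambda>z. p (join_vec w z)) \<in> polyfun \<real>"
  using assms(1)
proof induction
  case (coord k)
  show ?case
    by (cases k) (use assms(2) in \<open>auto simp: join_vec_def real_vec_def intro: polyfun.intros\<close>)
qed (auto intro: polyfun.intros)

text \<open>Clearing denominators: sums and products of fractions are fractions whose denominators
  are products of the given ones.\<close>

lemma polyfun_rational_compose:
  assumes "p \<in> polyfun \<real>" and "\<And>k. n k \<in> polyfun \<real>" "\<And>k. d k \<in> polyfun \<real>"
  shows "\<exists>P\<in>polyfun \<real>. \<exists>Q\<in>polyfun \<real>. \<forall>z w. (\<forall>k. d k z \<noteq> 0 \<and> w $ k = n k z / d k z) \<longrightarrow>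
           Q z \<noteq> 0 \<and> p w = P z / Q z"
  using assms(1)
proof induction
  case (const c)
  then show ?case
    by (intro bexI[of _ "\<lambda>z. c", OF bexI[of _ "\<lambda>z. 1"]]) (auto intro: polyfun.const)
next
  case (coord k)
  show ?case by (intro bexI[of _ "n k", OF bexI[of _ "d k"]]) (auto intro: assms)
next
  case (add p q)
  from add.IH obtain P Q where 1: "P \<in> polyfun \<real>" "Q \<in> polyfun \<real>"
    "\<forall>z w. (\<forall>k. d k z \<noteq> 0 \<and> w $ k = n k z / d k z) \<longrightarrow> Q z \<noteq> 0 \<and> p w = P z / Q z" by blast
  from add.IH obtain P' Q' where 2: "P' \<in> polyfun \<real>" "Q' \<in> polyfun \<real>"
    "\<forall>z w. (\<forall>k. d k z \<noteq> 0 \<and> w $ k = n k z / d k z) \<longrightarrow> Q' z \<noteq> 0 \<and> q w = P' z / Q' z" by blast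
  have "Q z * Q' z \<noteq> 0 \<and> p w + q w = (P z * Q' z + P' z * Q z) / (Q z * Q' z)"
    if zw: "\<forall>k. d k z \<noteq> 0 \<and> w $ k = n k z / d k z" for z w
  proof -
    have "Q z \<noteq> 0 \<and> p w = P z / Q z" "Q' z \<noteq> 0 \<and> q w = P' z / Q' z"
      using 1(3) 2(3) zw by blast+
    then show ?thesis by (simp add: add_frac_eq)
  qed
  then show ?case
    using 1(1,2) 2(1,2)
    by (intro bexI[of _ "\<lambda>z. P z * Q' z + P' z * Q z", OF bexI[of _ "\<lambda>z. Q z * Q' z"]])
       (auto intro: polyfun.add polyfun.mult)
next
  case (mult p q)
  from mult.IH obtain P Q where 1: "P \<in> polyfun \<real>" "Q \<in> polyfun \<real>"
    "\<forall>z w. (\<forall>k. d k z \<noteq> 0 \<and> w $ k = n k z / d k z) \<longrightarrow> Q z \<noteq> 0 \<and> p w = P z / Q z" by blast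
  from mult.IH obtain P' Q' where 2: "P' \<in> polyfun \<real>" "Q' \<in> polyfun \<real>"
    "\<forall>z w. (\<forall>k. d k z \<noteq> 0 \<and> w $ k = n k z / d k z) \<longrightarrow> Q' z \<noteq> 0 \<and> q w = P' z / Q' z" by blast
  have "Q z * Q' z \<noteq> 0 \<and> p w * q w = (P z * P' z) / (Q z * Q' z)"
    if zw: "\<forall>k. d k z \<noteq> 0 \<and> w $ k = n k z / d k z" for z w
  proof -
    have "Q z \<noteq> 0 \<and> p w = P z / Q z" "Q' z \<noteq> 0 \<and> q w = P' z / Q' z"
      using 1(3) 2(3) zw by blast+
    then show ?thesis by simp
  qed
  then show ?case
    using 1(1,2) 2(1,2)
    by (intro bexI[of _ "\<lambda>z. P z * P' z", OF bexI[of _ "\<lambda>z. Q z * Q' z"]])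
       (auto intro: polyfun.mult)
qed

text \<open>All conditions are gathered in the one polynomial \<open>r\<close>. The domain of the
  expression is then a principal open set, and covering \<open>L\<close> by such domains becomes a
  question about zero sets.\<close>

definition local_form ::
  "'a set \<Rightarrow> ('a \<Rightarrow> complex ^ 'i) \<Rightarrow> 'b set \<Rightarrow> ('b \<Rightarrow> complex ^ 'j) \<Rightarrow> ('a \<Rightarrow> 'b) \<Rightarrow>
   (complex ^ 'i \<Rightarrow> complex) \<Rightarrow> ('j \<Rightarrow> complex ^ 'i \<Rightarrow> complex) \<Rightarrow> ('j \<Rightarrow> complex ^ 'i \<Rightarrow> complex) \<Rightarrow> bool"
where
  "local_form U \<phi> V \<psi> f r n d \<longleftrightarrow> r \<in> polyfun \<real> \<and> (\<forall>k. n k \<in> polyfun \<real> \<and> d k \<in> polyfun \<real>) \<and>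
     (\<forall>y\<in>U. r (\<phi> y) \<noteq> 0 \<longrightarrow> f y \<in> V \<and> (\<forall>k. d k (\<phi> y) \<noteq> 0 \<and> \<psi> (f y) $ k = n k (\<phi> y) / d k (\<phi> y)))"

text \<open>Regularity gives one denominator per coordinate. Multiplying \<open>r\<close> by all of
  them, finitely many, yields a common domain.\<close>

lemma local_form_exists:
  fixes f :: "'a \<Rightarrow> 'b" and \<psi> :: "'b \<Rightarrow> complex ^ 'j :: finite"
  assumes r: "r \<in> polyfun \<real>" "r (\<phi> x) \<noteq> 0" "\<And>y. y \<in> U \<Longrightarrow> r (\<phi> y) \<noteq> 0 \<Longrightarrow> y \<in> W \<and> f y \<in> V"
    and reg: "\<And>k. \<exists>p\<in>polyfun \<real>. \<exists>q\<in>polyfun \<real>. q (\<phi> x) \<noteq> 0 \<and>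
      (\<forall>y\<in>U \<inter> W. q (\<phi> y) \<noteq> 0 \<longrightarrow> \<psi> (f y) $ k = p (\<phi> y) / q (\<phi> y))"
  shows "\<exists>r n d. local_form U \<phi> V \<psi> f r n d \<and> r (\<phi> x) \<noteq> 0"
proof -
  have "\<exists>p. \<forall>k. fst (p k) \<in> polyfun \<real> \<and> snd (p k) \<in> polyfun \<real> \<and> snd (p k) (\<phi> x) \<noteq> 0 \<and>
      (\<forall>y\<in>U \<inter> W. snd (p k) (\<phi> y) \<noteq> 0 \<longrightarrow> \<psi> (f y) $ k = fst (p k) (\<phi> y) / snd (p k) (\<phi> y))"
  proof (intro choice allI)
    fix k
    from reg[of k] obtain p q where "p \<in> polyfun \<real>" "q \<in> polyfun \<real>" "q (\<phi> x) \<noteq> 0"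
      "\<forall>y\<in>U \<inter> W. q (\<phi> y) \<noteq> 0 \<longrightarrow> \<psi> (f y) $ k = p (\<phi> y) / q (\<phi> y)" by blast
    then show "\<exists>p. fst p \<in> polyfun \<real> \<and> snd p \<in> polyfun \<real> \<and> snd p (\<phi> x) \<noteq> 0 \<and>
      (\<forall>y\<in>U \<inter> W. snd p (\<phi> y) \<noteq> 0 \<longrightarrow> \<psi> (f y) $ k = fst p (\<phi> y) / snd p (\<phi> y))"
      by (intro exI[of _ "(p, q)"]) simp
  qed
  then obtain p where p: "\<forall>k. fst (p k) \<in> polyfun \<real> \<and> snd (p k) \<in> polyfun \<real> \<and> snd (p k) (\<phi> x) \<noteq> 0 \<and>
      (\<forall>y\<in>U \<inter> W. snd (p k) (\<phi> y) \<noteq> 0 \<longrightarrow> \<psi> (f y) $ k = fst (p k) (\<phi> y) / snd (p k) (\<phi> y))" ..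
  define s where "s z = r z * (\<Prod>k\<in>UNIV. snd (p k) z)" for z
  have "local_form U \<phi> V \<psi> f s (\<lambda>k. fst (p k)) (\<lambda>k. snd (p k))"
    unfolding local_form_def
  proof (intro conjI ballI impI allI)
    show "s \<in> polyfun \<real>"
      using p unfolding s_def[abs_def] by (intro polyfun.mult polyfun_prod r) auto
    fix y assume y: "y \<in> U" "s (\<phi> y) \<noteq> 0"
    then have ry: "r (\<phi> y) \<noteq> 0" and py: "\<And>k. snd (p k) (\<phi> y) \<noteq> 0" by (auto simp: s_def)
    then show "f y \<in> V" "snd (p k) (\<phi> y) \<noteq> 0" for k using r(3)[OF y(1)] by auto
    show "\<psi> (f y) $ k = fst (p k) (\<phi> y) / snd (p k) (\<phi> y)" for k
      using p py[of k] r(3)[OF y(1) ry] y(1) by blast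
  qed (use p in auto)
  moreover have "s (\<phi> x) \<noteq> 0" using r p by (simp add: s_def)
  ultimately show ?thesis by blast
qed

lemma local_form_nonvanishing:
  assumes lf: "local_form U \<phi> V \<psi> f r n d" and p: "p \<in> polyfun \<real>"
    and x: "x \<in> U" "r (\<phi> x) \<noteq> 0" "p (\<psi> (f x)) \<noteq> 0"
  shows "\<exists>q\<in>polyfun \<real>. q (\<phi> x) \<noteq> 0 \<and> (\<forall>y\<in>U. q (\<phi> y) \<noteq> 0 \<longrightarrow> f y \<in> V \<and> p (\<psi> (f y)) \<noteq> 0)"
proof -
  have nd: "n k \<in> polyfun \<real>" "d k \<in> polyfun \<real>" for k using lf by (auto simp: local_form_def)
  obtain P Q where PQ: "P \<in> polyfun \<real>" "Q \<in> polyfun \<real>"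
    "\<forall>z w. (\<forall>k. d k z \<noteq> 0 \<and> w $ k = n k z / d k z) \<longrightarrow> Q z \<noteq> 0 \<and> p w = P z / Q z"
    using polyfun_rational_compose[of p n d, OF p nd] by blast
  have form: "f y \<in> V \<and> Q (\<phi> y) \<noteq> 0 \<and> p (\<psi> (f y)) = P (\<phi> y) / Q (\<phi> y)"
    if "y \<in> U" "r (\<phi> y) \<noteq> 0" for y
    using lf PQ(3) that unfolding local_form_def by blast
  have "(\<lambda>z. r z * P z) \<in> polyfun \<real>" using lf PQ(1) by (auto simp: local_form_def intro: polyfun.mult)
  moreover have "r (\<phi> x) * P (\<phi> x) \<noteq> 0" using form[OF x(1,2)] x by auto
  moreover have "\<forall>y\<in>U. r (\<phi> y) * P (\<phi> y) \<noteq> 0 \<longrightarrow> f y \<in> V \<and> p (\<psi> (f y)) \<noteq> 0"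
    using form by auto
  ultimately show ?thesis by (intro bexI[of _ "\<lambda>z. r z * P z"] conjI)
qed

lemma local_form_open:
  fixes \<psi> :: "'b \<Rightarrow> complex ^ 'j :: finite"
  assumes lf: "local_form U \<phi> V \<psi> f r n d" and W: "open W"
    and x: "x \<in> U" "r (\<phi> x) \<noteq> 0" "\<psi> (f x) \<in> W"
  shows "\<exists>W'. open W' \<and> \<phi> x \<in> W' \<and> (\<forall>y\<in>U. \<phi> y \<in> W' \<longrightarrow> f y \<in> V \<and> \<psi> (f y) \<in> W)"
proof -
  have nd: "n k \<in> polyfun \<real>" "d k \<in> polyfun \<real>" and r: "r \<in> polyfun \<real>" for k
    using lf by (auto simp: local_form_def)
  define D where "D = {z. r z \<noteq> 0} \<inter> (\<Inter>k\<in>UNIV. {z. d k z \<noteq> 0})"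
  define g where "g z = (\<chi> k. n k z / d k z)" for z
  have "open D"
    unfolding D_def using nd r
    by (intro open_Int open_INT ballI open_Collect_neq polyfun_continuous continuous_on_const) auto
  moreover have "continuous_on D g"
    unfolding g_def using nd
    by (intro continuous_on_vec_lambda continuous_on_divide polyfun_continuous) (auto simp: D_def)
  ultimately have "open (g -` W \<inter> D)"
    using W by (metis continuous_on_open_vimage)
  moreover have eq: "f y \<in> V \<and> \<phi> y \<in> D \<and> \<psi> (f y) = g (\<phi> y)" if "y \<in> U" "r (\<phi> y) \<noteq> 0" for y
    using lf that by (auto simp: local_form_def D_def g_def vec_eq_iff)
  moreover have "\<phi> x \<in> g -` W \<inter> D" using eq[OF x(1,2)] x(3) by auto
  moreover have "f y \<in> V \<and> \<psi> (f y) \<in> W" if "y \<in> U" "\<phi> y \<in> g -` W \<inter> D" for y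
    using eq[OF that(1)] that(2) by (auto simp: D_def)
  ultimately show ?thesis by blast
qed

lemma local_form_real:
  assumes "local_form U \<phi> V \<psi> f r n d" "y \<in> U" "r (\<phi> y) \<noteq> 0" "real_vec (\<phi> y)"
  shows "real_vec (\<psi> (f y))"
  using assms polyfun_Reals unfolding local_form_def real_vec_def[of "\<psi> (f y)"]
  by (metis Reals_divide)

lemma transition_local_form:
  fixes B :: "('a, 'i :: finite) atlas"
  assumes var: "variety \<real> B" and charts: "(U, \<phi>) \<in> B" "(V, \<psi>) \<in> B" and x: "x \<in> U" "x \<in> V"
  shows "\<exists>r n d. local_form U \<phi> V \<psi> (\<lambda>x. x) r n d \<and> r (\<phi> x) \<noteq> 0"
proof -
  have inj: "inj_on \<phi> U" and Z: "\<exists>Z. algebraic_set \<real> Z \<and> \<phi> ` (U \<inter> V) = \<phi> ` U - Z"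
    and reg: "\<And>k. regular_on \<real> {(U, \<phi>)} (U \<inter> V) (\<lambda>x. \<psi> x $ k)"
    using bspec[OF var[unfolded variety_def, THEN conjunct2, THEN conjunct1] charts(1), unfolded prod.case]
      bspec[OF bspec[OF var[unfolded variety_def, THEN conjunct2, THEN conjunct2] charts(1),
          unfolded prod.case] charts(2), unfolded prod.case]
    by blast+
  obtain Z where Z: "algebraic_set \<real> Z" "\<phi> ` (U \<inter> V) = \<phi> ` U - Z" using Z by blast
  obtain P where P: "P \<subseteq> polyfun \<real>" "Z = {z. \<forall>p\<in>P. p z = 0}"
    using Z(1) by (auto simp: algebraic_set_def)
  have "\<phi> x \<notin> Z" using Z(2) x by blast
  then obtain r where r: "r \<in> P" "r (\<phi> x) \<noteq> 0" using P(2) by blast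
  show ?thesis
  proof (rule local_form_exists[where W = V])
    show "r \<in> polyfun \<real>" using r P by blast
    show "r (\<phi> x) \<noteq> 0" by fact
    fix y assume y: "y \<in> U" "r (\<phi> y) \<noteq> 0"
    then have "\<phi> y \<in> \<phi> ` (U \<inter> V)" using Z(2) P(2) r(1) by blast
    then show "y \<in> V \<and> y \<in> V" using inj_onD[OF inj] y(1) by fastforce
  next
    fix k
    show "\<exists>p\<in>polyfun \<real>. \<exists>q\<in>polyfun \<real>. q (\<phi> x) \<noteq> 0 \<and>
        (\<forall>y\<in>U \<inter> V. q (\<phi> y) \<noteq> 0 \<longrightarrow> \<psi> y $ k = p (\<phi> y) / q (\<phi> y))"
      using reg[of k] x unfolding regular_on_def by simp
  qed
qed

text \<open>The topology is generated by the principal open sets of all charts at once. Those of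
  another chart are pulled back through the transition map, and products take care of
  intersections.\<close>

lemma zariski_basis:
  fixes B :: "('a, 'i :: finite) atlas"
  assumes var: "variety \<real> B" and chart: "(U, \<phi>) \<in> B"
    and W: "openin (zariski_topology \<real> B) W" and x: "x \<in> U" "x \<in> W"
  shows "\<exists>r\<in>polyfun \<real>. r (\<phi> x) \<noteq> 0 \<and> (\<forall>y\<in>U. r (\<phi> y) \<noteq> 0 \<longrightarrow> y \<in> W)"
proof -
  have "generate_topology_on {{x \<in> U. p (\<phi> x) \<noteq> 0} | U \<phi> p. (U, \<phi>) \<in> B \<and> p \<in> polyfun \<real>} W"
    using W by (simp add: zariski_topology_def openin_topology_generated_by_iff)
  then show ?thesis
    using x(2)
  proof induction
    case (Int S T)
    then obtain r s where "r \<in> polyfun \<real>" "r (\<phi> x) \<noteq> 0" "\<forall>y\<in>U. r (\<phi> y) \<noteq> 0 \<longrightarrow> y \<in> S"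
      "s \<in> polyfun \<real>" "s (\<phi> x) \<noteq> 0" "\<forall>y\<in>U. s (\<phi> y) \<noteq> 0 \<longrightarrow> y \<in> T" by blast
    then show ?case by (intro bexI[of _ "\<lambda>z. r z * s z"]) (auto intro: polyfun.mult)
  next
    case (UN K)
    then obtain k where k: "k \<in> K" "x \<in> k" by blast
    from UN.IH[OF this] k(1) show ?case by blast
  next
    case (Basis S)
    then obtain V \<psi> p where S: "S = {x \<in> V. p (\<psi> x) \<noteq> 0}" "(V, \<psi>) \<in> B" "p \<in> polyfun \<real>" by blast
    then have xV: "x \<in> V" "p (\<psi> x) \<noteq> 0" using Basis.prems by auto
    obtain r n d where lf: "local_form U \<phi> V \<psi> (\<lambda>x. x) r n d" "r (\<phi> x) \<noteq> 0"
      using transition_local_form[OF var chart S(2) x(1) xV(1)] by blast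
    from local_form_nonvanishing[OF lf(1) S(3) x(1) lf(2) xV(2)] show ?case by (simp add: S(1))
  qed simp
qed

section \<open>Topologies and morphisms in charts\<close>

lemma openin_euclidean_chart:
  fixes B :: "('a, 'i :: finite) atlas"
  assumes "(U, \<phi>) \<in> B" "open W"
  shows "openin (euclidean_topology B) {x \<in> U. \<phi> x \<in> W}"
  unfolding euclidean_topology_def openin_topology_generated_by_iff
  using assms by (intro generate_topology_on.Basis) blast

lemma openin_zariski_chart:
  fixes B :: "('a, 'i :: finite) atlas"
  assumes "(U, \<phi>) \<in> B" "p \<in> polyfun K"
  shows "openin (zariski_topology K B) {x \<in> U. p (\<phi> x) \<noteq> 0}"
  unfolding zariski_topology_def openin_topology_generated_by_iff
  using assms by (intro generate_topology_on.Basis) blast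

lemma openin_zariski_chart_domain:
  fixes B :: "('a, 'i :: finite) atlas"
  assumes "(U, \<phi>) \<in> B" "1 \<in> K"
  shows "openin (zariski_topology K B) U"
  using openin_zariski_chart[OF assms(1) one_polyfun[OF assms(2)]] by simp

lemma zariski_open_imp_euclidean_open:
  fixes B :: "('a, 'i :: finite) atlas"
  assumes "openin (zariski_topology K B) W"
  shows "openin (euclidean_topology B) W"
proof -
  have "generate_topology_on {{x \<in> U. p (\<phi> x) \<noteq> 0} | U \<phi> p. (U, \<phi>) \<in> B \<and> p \<in> polyfun K} W"
    using assms by (simp add: zariski_topology_def openin_topology_generated_by_iff)
  then show ?thesis
  proof induction
    case (Basis S)
    then obtain U \<phi> p where S: "S = {x \<in> U. p (\<phi> x) \<noteq> 0}" "(U, \<phi>) \<in> B" "p \<in> polyfun K" by blast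
    have "open {z. p z \<noteq> 0}"
      by (intro open_Collect_neq polyfun_continuous[OF S(3)] continuous_on_const)
    from openin_euclidean_chart[OF S(2) this] show ?case by (simp add: S(1))
  qed auto
qed

lemma morphism_local_form:
  fixes B :: "('a, 'i :: finite) atlas" and C :: "('b, 'j :: finite) atlas"
  assumes var: "variety \<real> B" and f: "morphism \<real> B C f"
    and charts: "(U, \<phi>) \<in> B" "(V, \<psi>) \<in> C" and x: "x \<in> U" "f x \<in> V"
  shows "\<exists>r n d. local_form U \<phi> V \<psi> f r n d \<and> r (\<phi> x) \<noteq> 0"
proof -
  define W where "W = {x \<in> points B. f x \<in> V}"
  have U: "U \<subseteq> points B" using charts(1) by (auto simp: points_def)
  have "openin (zariski_topology \<real> B) W"
    using f openin_zariski_chart_domain[OF charts(2), of \<real>]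
    unfolding morphism_def continuous_map_def W_def by (auto simp: topspace_zariski_topology)
  moreover have xW: "x \<in> W" using x U by (auto simp: W_def)
  ultimately obtain r where r: "r \<in> polyfun \<real>" "r (\<phi> x) \<noteq> 0" "\<forall>y\<in>U. r (\<phi> y) \<noteq> 0 \<longrightarrow> y \<in> W"
    using zariski_basis[OF var charts(1) _ x(1)] by blast
  have reg: "regular_on \<real> B W (\<lambda>x. \<psi> (f x) $ k)" for k
    using f charts(2) unfolding morphism_def W_def by fast
  show ?thesis
  proof (rule local_form_exists[where r = r and W = W])
    show "r \<in> polyfun \<real>" "r (\<phi> x) \<noteq> 0" by fact+
    show "y \<in> W \<and> f y \<in> V" if "y \<in> U" "r (\<phi> y) \<noteq> 0" for y
      using r(3) that by (auto simp: W_def)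
    show "\<exists>p\<in>polyfun \<real>. \<exists>q\<in>polyfun \<real>. q (\<phi> x) \<noteq> 0 \<and>
        (\<forall>y\<in>U \<inter> W. q (\<phi> y) \<noteq> 0 \<longrightarrow> \<psi> (f y) $ k = p (\<phi> y) / q (\<phi> y))" for k
      using bspec[OF bspec[OF reg[of k, unfolded regular_on_def] charts(1), unfolded prod.case], of x]
        x(1) xW by simp
  qed
qed

lemma morphism_maps_points:
  fixes B :: "('a, 'i :: finite) atlas" and C :: "('b, 'j :: finite) atlas"
  assumes "morphism \<real> B C f" "x \<in> points B" shows "f x \<in> points C"
  using assms by (auto simp: morphism_def continuous_map_def topspace_zariski_topology)

lemma morphism_euclidean_continuous:
  fixes B :: "('a, 'i :: finite) atlas" and C :: "('b, 'j :: finite) atlas"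
  assumes var: "variety \<real> B" and f: "morphism \<real> B C f"
  shows "continuous_map (euclidean_topology B) (euclidean_topology C) f"
  unfolding euclidean_topology_def[of C]
proof (rule continuous_on_generated_topo)
  fix S assume "S \<in> {{x \<in> V. \<psi> x \<in> W} | V \<psi> W. (V, \<psi>) \<in> C \<and> open W}"
  then obtain V \<psi> W where S: "S = {x \<in> V. \<psi> x \<in> W}" "(V, \<psi>) \<in> C" "open W" by blast
  show "openin (euclidean_topology B) (f -` S \<inter> topspace (euclidean_topology B))"
  proof (subst openin_subopen, intro ballI)
    fix x assume "x \<in> f -` S \<inter> topspace (euclidean_topology B)"
    then have x: "f x \<in> V" "\<psi> (f x) \<in> W" "x \<in> points B"
      by (auto simp: S(1) topspace_euclidean_topology)
    then obtain U \<phi> where U: "(U, \<phi>) \<in> B" "x \<in> U" by (auto simp: points_def)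
    obtain r n d where lf: "local_form U \<phi> V \<psi> f r n d" "r (\<phi> x) \<noteq> 0"
      using morphism_local_form[OF var f U(1) S(2) U(2) x(1)] by blast
    obtain W' where W': "open W'" "\<phi> x \<in> W'" "\<forall>y\<in>U. \<phi> y \<in> W' \<longrightarrow> f y \<in> V \<and> \<psi> (f y) \<in> W"
      using local_form_open[OF lf(1) S(3) U(2) lf(2) x(2)] by blast
    have "{y \<in> U. \<phi> y \<in> W'} \<subseteq> f -` S \<inter> topspace (euclidean_topology B)"
      using W'(3) U(1) by (auto simp: S(1) topspace_euclidean_topology points_def)
    then show "\<exists>T. openin (euclidean_topology B) T \<and> x \<in> T \<and>
        T \<subseteq> f -` S \<inter> topspace (euclidean_topology B)"
      using openin_euclidean_chart[OF U(1) W'(1)] U(2) W'(2) by blast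
  qed
next
  have "\<Union>{{x \<in> V. \<psi> x \<in> W} | V \<psi> W. (V, \<psi>) \<in> C \<and> open W} = points C"
    using topspace_euclidean_topology[of C]
    by (simp add: euclidean_topology_def topology_generated_by_topspace)
  then show "f ` topspace (euclidean_topology B) \<subseteq> \<Union>{{x \<in> V. \<psi> x \<in> W} | V \<psi> W. (V, \<psi>) \<in> C \<and> open W}"
    using morphism_maps_points[OF f] by (auto simp: topspace_euclidean_topology simp del: Union_iff)
qed

text \<open>Real coordinates are demanded in one chart only. They carry over to every other chart at
  the point because transition maps are quotients of polynomials with real coefficients.\<close>

lemma real_points_chart:
  fixes B :: "('a, 'i :: finite) atlas"
  assumes "variety \<real> B" "(V, \<psi>) \<in> B" "x \<in> V" "x \<in> real_points B"
  shows "real_vec (\<psi> x)"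
proof -
  obtain U \<phi> where U: "(U, \<phi>) \<in> B" "x \<in> U" "real_vec (\<phi> x)"
    using assms(4) by (auto simp: real_points_def real_vec_def)
  obtain r n d where "local_form U \<phi> V \<psi> (\<lambda>x. x) r n d" "r (\<phi> x) \<noteq> 0"
    using transition_local_form[OF assms(1) U(1) assms(2) U(2) assms(3)] by blast
  from local_form_real[OF this(1) U(2) this(2) U(3)] show ?thesis .
qed

lemma real_points_subset: "real_points B \<subseteq> points B"
  by (auto simp: real_points_def points_def)

text \<open>Modelled on the inclusion of a slice into a product. The preimage of a chart is a chart
  or empty, and polynomials pull back to polynomials, so that fractions can be pulled back in
  numerator and denominator separately.\<close>

definition chartwise_polynomial ::
  "('c, 'k :: finite) atlas \<Rightarrow> ('a, 'i :: finite) atlas \<Rightarrow> ('c \<Rightarrow> 'a) \<Rightarrow> bool"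
where
  "chartwise_polynomial A B s \<longleftrightarrow>
     (\<forall>(W, \<theta>)\<in>B. s -` W \<inter> points A = {} \<or> (\<exists>(U, \<phi>)\<in>A. s -` W \<inter> points A = U \<and>
        (\<forall>p\<in>polyfun \<real>. \<exists>q\<in>polyfun \<real>. \<forall>x\<in>U. p (\<theta> (s x)) = q (\<phi> x)))) \<and>
     (\<forall>(U, \<phi>)\<in>A. \<exists>(W, \<theta>)\<in>B. s ` U \<subseteq> W \<and>
        (\<forall>p\<in>polyfun \<real>. \<exists>q\<in>polyfun \<real>. \<forall>x\<in>U. p (\<theta> (s x)) = q (\<phi> x)))"

lemma chartwise_polynomial_preimage:
  assumes "chartwise_polynomial A B s" "(W, \<theta>) \<in> B" "s -` W \<inter> points A \<noteq> {}"
  obtains U \<phi> where "(U, \<phi>) \<in> A" "s -` W \<inter> points A = U"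
    "\<And>p. p \<in> polyfun \<real> \<Longrightarrow> \<exists>q\<in>polyfun \<real>. \<forall>x\<in>U. p (\<theta> (s x)) = q (\<phi> x)"
proof -
  have "\<exists>(U, \<phi>)\<in>A. s -` W \<inter> points A = U \<and>
      (\<forall>p\<in>polyfun \<real>. \<exists>q\<in>polyfun \<real>. \<forall>x\<in>U. p (\<theta> (s x)) = q (\<phi> x))"
    using bspec[OF assms(1)[unfolded chartwise_polynomial_def, THEN conjunct1] assms(2), unfolded prod.case]
      assms(3) by simp
  then show ?thesis using that by auto
qed

lemma chartwise_polynomial_image:
  assumes "chartwise_polynomial A B s" "(U, \<phi>) \<in> A"
  obtains W \<theta> where "(W, \<theta>) \<in> B" "s ` U \<subseteq> W"
    "\<And>p. p \<in> polyfun \<real> \<Longrightarrow> \<exists>q\<in>polyfun \<real>. \<forall>x\<in>U. p (\<theta> (s x)) = q (\<phi> x)"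
  using bspec[OF assms(1)[unfolded chartwise_polynomial_def, THEN conjunct2] assms(2), unfolded prod.case]
    that by auto

lemma morphism_comp_chartwise_polynomial:
  assumes s: "chartwise_polynomial A B s" and f: "morphism \<real> B C f"
  shows "morphism \<real> A C (\<lambda>x. f (s x))"
  unfolding morphism_def
proof
  have pts: "s x \<in> points B" if x: "x \<in> points A" for x
  proof -
    obtain U \<phi> where U: "(U, \<phi>) \<in> A" "x \<in> U" using x by (auto simp: points_def)
    obtain W \<theta> where "(W, \<theta>) \<in> B" "s ` U \<subseteq> W"
      by (rule chartwise_polynomial_image[OF s U(1)])
    then show ?thesis using U(2) by (auto simp: points_def)
  qed
  have "continuous_map (zariski_topology \<real> A) (zariski_topology \<real> B) s"
    unfolding zariski_topology_def[of \<real> B]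
  proof (rule continuous_on_generated_topo)
    fix S assume "S \<in> {{x \<in> U. p (\<phi> x) \<noteq> 0} | U \<phi> p. (U, \<phi>) \<in> B \<and> p \<in> polyfun \<real>}"
    then obtain W \<theta> p where S: "S = {x \<in> W. p (\<theta> x) \<noteq> 0}" "(W, \<theta>) \<in> B" "p \<in> polyfun \<real>" by blast
    show "openin (zariski_topology \<real> A) (s -` S \<inter> topspace (zariski_topology \<real> A))"
    proof (cases "s -` W \<inter> points A = {}")
      case True
      then have "s -` S \<inter> topspace (zariski_topology \<real> A) = {}"
        by (auto simp: S(1) topspace_zariski_topology)
      then show ?thesis by simp
    next
      case False
      obtain U \<phi> where U: "(U, \<phi>) \<in> A" "s -` W \<inter> points A = U"
        "\<And>p. p \<in> polyfun \<real> \<Longrightarrow> \<exists>q\<in>polyfun \<real>. \<forall>x\<in>U. p (\<theta> (s x)) = q (\<phi> x)"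
        by (rule chartwise_polynomial_preimage[OF s S(2) False]) blast
      obtain q where q: "q \<in> polyfun \<real>" "\<forall>x\<in>U. p (\<theta> (s x)) = q (\<phi> x)" using U(3)[OF S(3)] by blast
      have "s -` S \<inter> topspace (zariski_topology \<real> A) = {x \<in> U. q (\<phi> x) \<noteq> 0}"
        using U(2) q(2) by (auto simp: S(1) topspace_zariski_topology)
      then show ?thesis using openin_zariski_chart[OF U(1) q(1)] by simp
    qed
  next
    have "\<Union>{{x \<in> U. p (\<phi> x) \<noteq> 0} | U \<phi> p. (U, \<phi>) \<in> B \<and> p \<in> polyfun \<real>} = points B"
      using topspace_zariski_topology[of \<real> B]
      by (simp add: zariski_topology_def topology_generated_by_topspace)
    then show "s ` topspace (zariski_topology \<real> A) \<subseteq>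
        \<Union>{{x \<in> U. p (\<phi> x) \<noteq> 0} | U \<phi> p. (U, \<phi>) \<in> B \<and> p \<in> polyfun \<real>}"
      using pts by (auto simp: topspace_zariski_topology simp del: Union_iff)
  qed
  then have "continuous_map (zariski_topology \<real> A) (zariski_topology \<real> C) (f \<circ> s)"
    using f unfolding morphism_def by (blast intro: continuous_map_compose)
  then show "continuous_map (zariski_topology \<real> A) (zariski_topology \<real> C) (\<lambda>x. f (s x))"
    by (simp add: comp_def)
  have "regular_on \<real> A {x \<in> points A. f (s x) \<in> V} (\<lambda>x. \<psi> (f (s x)) $ k)"
    if V: "(V, \<psi>) \<in> C" for V \<psi> k
    unfolding regular_on_def
  proof safe
    fix U \<phi> x assume U: "(U, \<phi>) \<in> A" "x \<in> U" "x \<in> points A" "f (s x) \<in> V"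
    obtain W \<theta> where W: "(W, \<theta>) \<in> B" "s ` U \<subseteq> W"
      "\<And>p. p \<in> polyfun \<real> \<Longrightarrow> \<exists>q\<in>polyfun \<real>. \<forall>x\<in>U. p (\<theta> (s x)) = q (\<phi> x)"
      by (rule chartwise_polynomial_image[OF s U(1)]) blast
    have "regular_on \<real> B {x \<in> points B. f x \<in> V} (\<lambda>x. \<psi> (f x) $ k)"
      using bspec[OF f[unfolded morphism_def, THEN conjunct2] V, unfolded prod.case] by blast
    from bspec[OF this[unfolded regular_on_def] W(1), unfolded prod.case, rule_format, of "s x"]
    obtain p q where pq: "p \<in> polyfun \<real>" "q \<in> polyfun \<real>" "q (\<theta> (s x)) \<noteq> 0"
      "\<forall>z\<in>W \<inter> {x \<in> points B. f x \<in> V}. q (\<theta> z) \<noteq> 0 \<longrightarrow> \<psi> (f z) $ k = p (\<theta> z) / q (\<theta> z)"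
      using U W(2) pts by auto
    obtain p' q' where p': "p' \<in> polyfun \<real>" "\<forall>x\<in>U. p (\<theta> (s x)) = p' (\<phi> x)"
      and q': "q' \<in> polyfun \<real>" "\<forall>x\<in>U. q (\<theta> (s x)) = q' (\<phi> x)"
      using W(3)[OF pq(1)] W(3)[OF pq(2)] by blast
    have "\<forall>y\<in>U \<inter> {x \<in> points A. f (s x) \<in> V}. q' (\<phi> y) \<noteq> 0 \<longrightarrow> \<psi> (f (s y)) $ k = p' (\<phi> y) / q' (\<phi> y)"
    proof (intro ballI impI)
      fix y assume y: "y \<in> U \<inter> {x \<in> points A. f (s x) \<in> V}" "q' (\<phi> y) \<noteq> 0"
      then have "s y \<in> W \<inter> {x \<in> points B. f x \<in> V}" using W(2) pts by auto
      then show "\<psi> (f (s y)) $ k = p' (\<phi> y) / q' (\<phi> y)"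
        using bspec[OF pq(4), of "s y"] p'(2) q'(2) y by simp
    qed
    moreover have "q' (\<phi> x) \<noteq> 0" using pq(3) q'(2) U(2) by simp
    ultimately show "\<exists>p\<in>polyfun \<real>. \<exists>q\<in>polyfun \<real>. q (\<phi> x) \<noteq> 0 \<and>
        (\<forall>y\<in>U \<inter> {x \<in> points A. f (s x) \<in> V}. q (\<phi> y) \<noteq> 0 \<longrightarrow> \<psi> (f (s y)) $ k = p (\<phi> y) / q (\<phi> y))"
      using p'(1) q'(1) by (intro bexI[of _ p', OF bexI[of _ q']] conjI)
  qed
  then show "\<forall>(V, \<psi>)\<in>C. \<forall>k. regular_on \<real> A {x \<in> points A. f (s x) \<in> V} (\<lambda>x. \<psi> (f (s x)) $ k)" by auto
qed

lemma product_atlasE: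
  assumes "(W, \<theta>) \<in> product_atlas A B"
  obtains U \<phi> V \<psi> where "(U, \<phi>) \<in> A" "(V, \<psi>) \<in> B" "W = U \<times> V"
    "\<theta> = (\<lambda>(x, y). join_vec (\<phi> x) (\<psi> y))"
  using assms unfolding product_atlas_def by blast

text \<open>Fixing \<open>y\<close> substitutes its coordinates into polynomials. These are real
  numbers because \<open>y\<close> is a real point, and the coefficients stay real.\<close>

lemma chartwise_polynomial_slice_left:
  fixes A :: "('g, 'i :: finite) atlas" and B :: "('x, 'j :: finite) atlas"
  assumes var: "variety \<real> B" and y: "y \<in> real_points B"
  shows "chartwise_polynomial A (product_atlas A B) (\<lambda>g. (g, y))"
proof -
  have poly: "\<exists>q\<in>polyfun \<real>. \<forall>g\<in>U. p (join_vec (\<phi> g) (\<psi> y)) = q (\<phi> g)"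
    if "p \<in> polyfun \<real>" "(V, \<psi>) \<in> B" "y \<in> V" for p V \<psi> U and \<phi> :: "'g \<Rightarrow> complex ^ 'i"
    using polyfun_join_left[OF that(1) real_points_chart[OF var that(2,3) y]]
    by (intro bexI[of _ "\<lambda>z. p (join_vec z (\<psi> y))"]) auto
  have preimage: "(\<lambda>g. (g, y)) -` W \<inter> points A = {} \<or> (\<exists>(U, \<phi>)\<in>A. (\<lambda>g. (g, y)) -` W \<inter> points A = U \<and>
      (\<forall>p\<in>polyfun \<real>. \<exists>q\<in>polyfun \<real>. \<forall>x\<in>U. p (\<theta> (x, y)) = q (\<phi> x)))"
    if W: "(W, \<theta>) \<in> product_atlas A B" for W \<theta>
  proof (subst disj_imp, rule impI)
    assume ne: "(\<lambda>g. (g, y)) -` W \<inter> points A \<noteq> {}"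
    obtain U \<phi> V \<psi> where UV: "(U, \<phi>) \<in> A" "(V, \<psi>) \<in> B" "W = U \<times> V"
      "\<theta> = (\<lambda>(x, y). join_vec (\<phi> x) (\<psi> y))" by (rule product_atlasE[OF W]) (rule that)
    have yV: "y \<in> V" using ne by (auto simp: UV(3))
    have "(\<lambda>g. (g, y)) -` W \<inter> points A = U" using yV UV(1) by (auto simp: UV(3) points_def)
    then show "\<exists>(U, \<phi>)\<in>A. (\<lambda>g. (g, y)) -` W \<inter> points A = U \<and>
        (\<forall>p\<in>polyfun \<real>. \<exists>q\<in>polyfun \<real>. \<forall>x\<in>U. p (\<theta> (x, y)) = q (\<phi> x))"
      by (intro bexI[OF _ UV(1)]) (simp add: UV(4) poly[OF _ UV(2) yV])
  qed
  have image: "\<exists>(W, \<theta>)\<in>product_atlas A B. (\<lambda>g. (g, y)) ` U \<subseteq> W \<and>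
      (\<forall>p\<in>polyfun \<real>. \<exists>q\<in>polyfun \<real>. \<forall>x\<in>U. p (\<theta> (x, y)) = q (\<phi> x))"
    if U: "(U, \<phi>) \<in> A" for U \<phi>
  proof -
    obtain V \<psi> where V: "(V, \<psi>) \<in> B" "y \<in> V"
      using subsetD[OF real_points_subset y] by (auto simp: points_def)
    have "(U \<times> V, \<lambda>(x, y). join_vec (\<phi> x) (\<psi> y)) \<in> product_atlas A B"
      unfolding product_atlas_def using U V(1) by blast
    then show ?thesis
      by (rule bexI[rotated]) (use V poly[OF _ V] in auto)
  qed
  show ?thesis
    unfolding chartwise_polynomial_def
    by ((intro conjI ballI case_prodI2; hypsubst), erule preimage, erule image)
qed

lemma chartwise_polynomial_slice_right:
  fixes A :: "('g, 'i :: finite) atlas" and B :: "('x, 'j :: finite) atlas"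
  assumes var: "variety \<real> A" and y: "y \<in> real_points A"
  shows "chartwise_polynomial B (product_atlas A B) (\<lambda>x. (y, x))"
proof -
  have poly: "\<exists>q\<in>polyfun \<real>. \<forall>g\<in>U. p (join_vec (\<psi> y) (\<phi> g)) = q (\<phi> g)"
    if "p \<in> polyfun \<real>" "(V, \<psi>) \<in> A" "y \<in> V" for p V \<psi> U and \<phi> :: "'x \<Rightarrow> complex ^ 'j"
    using polyfun_join_right[OF that(1) real_points_chart[OF var that(2,3) y]]
    by (intro bexI[of _ "\<lambda>z. p (join_vec (\<psi> y) z)"]) auto
  have preimage: "Pair y -` W \<inter> points B = {} \<or> (\<exists>(U, \<phi>)\<in>B. Pair y -` W \<inter> points B = U \<and>
      (\<forall>p\<in>polyfun \<real>. \<exists>q\<in>polyfun \<real>. \<forall>x\<in>U. p (\<theta> (y, x)) = q (\<phi> x)))"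
    if W: "(W, \<theta>) \<in> product_atlas A B" for W \<theta>
  proof (subst disj_imp, rule impI)
    assume ne: "Pair y -` W \<inter> points B \<noteq> {}"
    obtain V \<psi> U \<phi> where UV: "(V, \<psi>) \<in> A" "(U, \<phi>) \<in> B" "W = V \<times> U"
      "\<theta> = (\<lambda>(x, y). join_vec (\<psi> x) (\<phi> y))" by (rule product_atlasE[OF W]) (rule that)
    have yV: "y \<in> V" using ne by (auto simp: UV(3))
    have "Pair y -` W \<inter> points B = U" using yV UV(2) by (auto simp: UV(3) points_def)
    then show "\<exists>(U, \<phi>)\<in>B. Pair y -` W \<inter> points B = U \<and>
        (\<forall>p\<in>polyfun \<real>. \<exists>q\<in>polyfun \<real>. \<forall>x\<in>U. p (\<theta> (y, x)) = q (\<phi> x))"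
      by (intro bexI[OF _ UV(2)]) (simp add: UV(4) poly[OF _ UV(1) yV])
  qed
  have image: "\<exists>(W, \<theta>)\<in>product_atlas A B. Pair y ` U \<subseteq> W \<and>
      (\<forall>p\<in>polyfun \<real>. \<exists>q\<in>polyfun \<real>. \<forall>x\<in>U. p (\<theta> (y, x)) = q (\<phi> x))"
    if U: "(U, \<phi>) \<in> B" for U \<phi>
  proof -
    obtain V \<psi> where V: "(V, \<psi>) \<in> A" "y \<in> V"
      using subsetD[OF real_points_subset y] by (auto simp: points_def)
    have "(V \<times> U, \<lambda>(x, y). join_vec (\<psi> x) (\<phi> y)) \<in> product_atlas A B"
      unfolding product_atlas_def using U V(1) by blast
    then show ?thesis
      by (rule bexI[rotated]) (use V poly[OF _ V] in auto)
  qed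
  show ?thesis
    unfolding chartwise_polynomial_def
    by ((intro conjI ballI case_prodI2; hypsubst), erule preimage, erule image)
qed

text \<open>For an action \<open>a\<close> these are the orbit maps of real points.\<close>

lemma morphism_slice_left:
  assumes "morphism \<real> (product_atlas A B) C (\<lambda>(g, x). a g x)" "variety \<real> B" "y \<in> real_points B"
  shows "morphism \<real> A C (\<lambda>g. a g y)"
  using morphism_comp_chartwise_polynomial[OF chartwise_polynomial_slice_left[OF assms(2,3)] assms(1)]
  by simp

text \<open>For an action \<open>a\<close> these are the translations by real group
  elements.\<close>

lemma morphism_slice_right:
  assumes "morphism \<real> (product_atlas A B) C (\<lambda>(g, x). a g x)" "variety \<real> A" "y \<in> real_points A"
  shows "morphism \<real> B C (\<lambda>x. a y x)"
  using morphism_comp_chartwise_polynomial[OF chartwise_polynomial_slice_right[OF assms(2,3)] assms(1)]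
  by simp

section \<open>Orbits and their closures\<close>

definition complex_vec :: "('i \<Rightarrow> real) \<Rightarrow> complex ^ 'i" where
  "complex_vec w = (\<chi> k. of_real (w k))"

lemma real_vec_complex_vec [simp]: "real_vec (complex_vec w)"
  by (simp add: real_vec_def complex_vec_def)

lemma real_coords_complex_vec [simp]: "real_coords (complex_vec w) = w"
  by (simp add: real_coords_def complex_vec_def)

lemma complex_vec_real_coords: "real_vec z \<Longrightarrow> complex_vec (real_coords z) = z"
  by (simp add: real_coords_eq_iff[symmetric])

lemma continuous_complex_vec: "continuous_on S (complex_vec :: ('i :: finite \<Rightarrow> real) \<Rightarrow> _)"
  unfolding complex_vec_def
  by (intro continuous_on_vec_lambda continuous_intros
      continuous_on_subset[OF continuous_on_product_coordinates]) auto

lemma continuous_real_coords: "continuous_on S (real_coords :: complex ^ 'i :: finite \<Rightarrow> _)"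
  unfolding real_coords_def
  by (intro continuous_on_coordinatewise_then_product continuous_intros)

text \<open>The defining equations may be infinite in number; the basis theorem extracts finitely
  many real polynomial functions with the same real zeros.\<close>

lemma semialg_real_algebraic_set:
  fixes Z :: "(complex ^ 'i :: finite) set"
  assumes "algebraic_set \<real> Z"
  shows "semialg (rpoly UNIV) {w. complex_vec w \<in> Z}"
proof -
  obtain P where P: "P \<subseteq> polyfun \<real>" "Z = {z. \<forall>p\<in>P. p z = 0}"
    using assms by (auto simp: algebraic_set_def)
  define R where "R = {f \<in> rpoly UNIV. \<exists>p\<in>P. \<forall>z. real_vec z \<longrightarrow> p z = of_real (f (real_coords z))}"
  have "R \<subseteq> rpoly UNIV" by (auto simp: R_def)
  from noetherian_finite_zero_set[OF noetherian_rpoly[OF finite] this]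
  obtain Q where Q: "Q \<subseteq> R" "finite Q" "\<forall>x. (\<forall>p\<in>Q. p x = 0) \<longrightarrow> (\<forall>p\<in>R. p x = 0)"
    by (elim exE conjE)
  have "complex_vec w \<in> Z \<longleftrightarrow> (\<forall>f\<in>Q. f w = 0)" for w
  proof
    assume w: "complex_vec w \<in> Z"
    show "\<forall>f\<in>Q. f w = 0"
    proof
      fix f assume "f \<in> Q"
      then obtain p where "p \<in> P" "\<forall>z. real_vec z \<longrightarrow> p z = of_real (f (real_coords z))"
        using Q(1) by (auto simp: R_def)
      then have "of_real (f w) = (0 :: complex)"
        using w P(2) by (metis (mono_tags, lifting) mem_Collect_eq real_coords_complex_vec real_vec_complex_vec)
      then show "f w = 0" by simp
    qed
  next
    assume w: "\<forall>f\<in>Q. f w = 0"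
    have "p (complex_vec w) = 0" if p: "p \<in> P" for p
    proof -
      obtain f where f: "f \<in> rpoly UNIV" "\<forall>z. real_vec z \<longrightarrow> p z = of_real (f (real_coords z))"
        using polyfun_real[of p] P(1) p by blast
      then have "f \<in> R" using p by (auto simp: R_def)
      then have "f w = 0" using Q(3) w by blast
      then show ?thesis using f(2) by simp
    qed
    then show "complex_vec w \<in> Z" using P(2) by blast
  qed
  then have "{w. complex_vec w \<in> Z} = (\<Inter>f\<in>Q. {w. f w = 0})" by auto
  moreover have "semialg (rpoly UNIV) (\<Inter>f\<in>Q. {w. f w = 0})"
    using Q(1,2) by (intro semialg_INT semialg_zero_set) (auto simp: R_def)
  ultimately show ?thesis by simp
qed

text \<open>The real locus has a finite cover by connected semialgebraic sets. A component contains
  each member of the cover that it meets, so it is the union of these members.\<close>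

lemma semialg_real_component:
  fixes A :: "('g, 'i :: finite) atlas"
  assumes var: "variety \<real> A" and A: "A = {(points A, \<gamma>)}"
  shows "semialg (rpoly UNIV) ((\<lambda>g. real_coords (\<gamma> g)) ` connected_component_of_set (real_locus A) e)"
proof -
  define L where "L = connected_component_of_set (real_locus A) e"
  have chart: "(points A, \<gamma>) \<in> A" by (metis A insertI1)
  have inj: "inj_on \<gamma> (points A)" and alg: "algebraic_set \<real> (\<gamma> ` points A)"
    using bspec[OF var[unfolded variety_def, THEN conjunct2, THEN conjunct1] chart, unfolded prod.case]
    by blast+
  define G where "G = {w. complex_vec w \<in> \<gamma> ` points A}"
  \<comment> \<open>The inverse of the real coordinate map. Its continuity on \<open>G\<close>
    carries connected sets of coordinates to connected sets of real points.\<close>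
  define \<iota> where "\<iota> w = inv_into (points A) \<gamma> (complex_vec w)" for w
  have \<iota>: "\<iota> w \<in> points A" "\<gamma> (\<iota> w) = complex_vec w" if "w \<in> G" for w
    using that by (auto simp: \<iota>_def G_def intro: inv_into_into f_inv_into_f)
  have \<iota>_real: "\<iota> w \<in> real_points A" if "w \<in> G" for w
    unfolding real_points_def
    by (rule CollectI, rule bexI[OF _ chart])
       (use \<iota>[OF that] real_vec_complex_vec[of w] in \<open>simp add: real_vec_def\<close>)
  have top: "topspace (real_locus A) = real_points A"
    using real_points_subset[of A] by (auto simp: topspace_euclidean_topology)
  have rc: "real_coords (\<gamma> g) \<in> G" "\<iota> (real_coords (\<gamma> g)) = g" if "g \<in> real_points A" for g
  proof -
    have gA: "g \<in> points A" by (rule subsetD[OF real_points_subset that])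
    then have g: "g \<in> points A" "real_vec (\<gamma> g)"
      using real_points_chart[OF var chart _ that] by simp_all
    then show "real_coords (\<gamma> g) \<in> G" by (simp add: G_def complex_vec_real_coords)
    show "\<iota> (real_coords (\<gamma> g)) = g"
      using g inj by (simp add: \<iota>_def complex_vec_real_coords)
  qed
  have "continuous_map (top_of_set G) (euclidean_topology A) \<iota>"
    unfolding euclidean_topology_def
  proof (rule continuous_on_generated_topo)
    fix S assume "S \<in> {{x \<in> U. \<phi> x \<in> W} | U \<phi> W. (U, \<phi>) \<in> A \<and> open W}"
    then obtain U \<phi> W where UW: "S = {x \<in> U. \<phi> x \<in> W}" "(U, \<phi>) \<in> A" "open W" by blast
    then have "(U, \<phi>) \<in> {(points A, \<gamma>)}" using A by metis
    then have "U = points A" "\<phi> = \<gamma>" by auto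
    then have S: "S = {x \<in> points A. \<gamma> x \<in> W}" using UW(1) by simp
    have "\<iota> -` S \<inter> topspace (top_of_set G) = G \<inter> complex_vec -` W"
      using \<iota> by (auto simp: S)
    moreover have "open ((complex_vec :: ('i \<Rightarrow> real) \<Rightarrow> _) -` W)"
      using open_vimage[OF UW(3) continuous_complex_vec] .
    ultimately show "openin (top_of_set G) (\<iota> -` S \<inter> topspace (top_of_set G))"
      by (simp add: openin_open_Int)
  next
    have "points A \<in> {{x \<in> U. \<phi> x \<in> W} | U \<phi> W. (U, \<phi>) \<in> A \<and> open W}"
      using chart by (intro CollectI exI[of _ "points A"] exI[of _ \<gamma>] exI[of _ UNIV]) auto
    then show "\<iota> ` topspace (top_of_set G) \<subseteq> \<Union>{{x \<in> U. \<phi> x \<in> W} | U \<phi> W. (U, \<phi>) \<in> A \<and> open W}"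
      using \<iota>(1) by (intro subset_trans[OF _ Union_upper]) auto
  qed
  then have cont: "continuous_map (top_of_set G) (real_locus A) \<iota>"
    using \<iota>_real by (auto simp: continuous_map_in_subtopology)
  from semialg_connected_cover[OF finite semialg_real_algebraic_set[OF alg], folded G_def]
  obtain \<C> where \<C>: "finite \<C>" "\<forall>C\<in>\<C>. connected C \<and> semialg (rpoly UNIV) C" "G = \<Union>\<C>"
    by (elim exE conjE)
  have in_L: "\<iota> ` C \<subseteq> L" if C: "C \<in> \<C>" "\<iota> ` C \<inter> L \<noteq> {}" for C
  proof -
    have "connectedin (top_of_set G) C"
      using \<C>(2,3) C(1) by (auto simp: connectedin_subtopology)
    then have conn: "connectedin (real_locus A) (\<iota> ` C)"
      by (rule connectedin_continuous_map_image[OF cont])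
    obtain x where x: "x \<in> \<iota> ` C" "x \<in> L" using C(2) by blast
    have "connected_component_of_set (real_locus A) x = L"
    proof -
      have "connected_component_of (real_locus A) e x" using x(2) by (simp add: L_def)
      then show ?thesis unfolding L_def by (simp add: connected_component_of_equiv)
    qed
    then show ?thesis using connected_component_of_maximal[OF conn x(1)] by simp
  qed
  have L_real: "L \<subseteq> real_points A"
    using connected_component_of_subset_topspace[of "real_locus A" e] unfolding L_def top .
  have "(\<lambda>g. real_coords (\<gamma> g)) ` L = \<Union>{C \<in> \<C>. \<iota> ` C \<inter> L \<noteq> {}}"
  proof (intro subset_antisym subsetI)
    fix w assume "w \<in> (\<lambda>g. real_coords (\<gamma> g)) ` L"
    then obtain g where g: "g \<in> L" "w = real_coords (\<gamma> g)" by blast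
    then have w: "w \<in> G" "\<iota> w = g" using rc[of g] L_real by auto
    then obtain C where C: "C \<in> \<C>" "w \<in> C" using \<C>(3) by blast
    then have "\<iota> ` C \<inter> L \<noteq> {}" using w(2) g(1) by blast
    then show "w \<in> \<Union>{C \<in> \<C>. \<iota> ` C \<inter> L \<noteq> {}}" using C by blast
  next
    fix w assume "w \<in> \<Union>{C \<in> \<C>. \<iota> ` C \<inter> L \<noteq> {}}"
    then obtain C where C: "C \<in> \<C>" "\<iota> ` C \<inter> L \<noteq> {}" "w \<in> C" by blast
    then have "\<iota> w \<in> L" "w \<in> G" using in_L[OF C(1,2)] \<C>(3) by auto
    moreover have "w = real_coords (\<gamma> (\<iota> w))" using \<iota>(2)[OF \<open>w \<in> G\<close>] by simp
    ultimately show "w \<in> (\<lambda>g. real_coords (\<gamma> g)) ` L" by blast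
  qed
  moreover have "semialg (rpoly UNIV) (\<Union>{C \<in> \<C>. \<iota> ` C \<inter> L \<noteq> {}})"
    using \<C>(1,2) by (intro semialg_Union) auto
  ultimately show ?thesis by (simp add: L_def)
qed

text \<open>In a chart, the polynomial functions vanishing on the real points of \<open>C n\<close>
  grow with \<open>n\<close>. Finitely many of them have the same zeros as all together, so from
  some stage on no real point of the chart is lost. The finite atlas then gives a common
  stage.\<close>

lemma zariski_descending_chain:
  fixes B :: "('a, 'i :: finite) atlas"
  assumes var: "variety \<real> B" and closed: "\<And>n. closedin (zariski_topology \<real> B) (C n)"
    and decr: "\<And>n. C (Suc n) \<subseteq> C n"
  shows "\<exists>N. C (Suc N) \<inter> real_points B = C N \<inter> real_points B"
proof -
  have anti: "C m \<subseteq> C n" if "n \<le> m" for n m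
    using lift_Suc_antimono_le[of C, OF decr that] .
  have "\<exists>N. \<forall>n\<ge>N. C N \<inter> fst c \<inter> real_points B \<subseteq> C n" if c: "c \<in> B" for c
  proof -
    obtain U \<phi> where U: "c = (U, \<phi>)" by (cases c)
    define P where "P n = {f \<in> rpoly UNIV. \<forall>x\<in>C n \<inter> U \<inter> real_points B. f (real_coords (\<phi> x)) = 0}" for n
    have P_mono: "P n \<subseteq> P m" if "n \<le> m" for n m
      using anti[OF that] by (auto simp: P_def)
    have "(\<Union>n. P n) \<subseteq> rpoly UNIV" by (auto simp: P_def)
    from noetherian_finite_zero_set[OF noetherian_rpoly[OF finite] this]
    obtain Q where Q: "Q \<subseteq> (\<Union>n. P n)" "finite Q"
      "\<forall>x. (\<forall>p\<in>Q. p x = 0) \<longrightarrow> (\<forall>p\<in>(\<Union>n. P n). p x = 0)"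
      by (elim exE conjE)
    have "\<exists>N. Q \<subseteq> P N"
      using Q(2,1)
    proof (induction rule: finite_induct)
      case (insert q Q)
      then obtain N m where "Q \<subseteq> P N" "q \<in> P m" by blast
      then have "insert q Q \<subseteq> P (max N m)"
        using P_mono[of N "max N m"] P_mono[of m "max N m"] by auto
      then show ?case by blast
    qed simp
    then obtain N where N: "Q \<subseteq> P N" ..
    have "x \<in> C n" if n: "N \<le> n" and x: "x \<in> C N" "x \<in> U" "x \<in> real_points B" for n x
    proof (rule ccontr)
      assume "x \<notin> C n"
      moreover have "x \<in> points B" by (rule subsetD[OF real_points_subset x(3)])
      ultimately have "x \<in> topspace (zariski_topology \<real> B) - C n"
        by (simp add: topspace_zariski_topology)
      moreover have "openin (zariski_topology \<real> B) (topspace (zariski_topology \<real> B) - C n)"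
        using closed[of n] by (simp add: closedin_def)
      \<comment> \<open>A point outside the closed set \<open>C n\<close> is separated from it by a
        polynomial of the chart. Its real form belongs to \<open>P n\<close> and must vanish at the
        point after all, by the choice of \<open>Q\<close>.\<close>
      ultimately obtain r where r: "r \<in> polyfun \<real>" "r (\<phi> x) \<noteq> 0"
        "\<forall>y\<in>U. r (\<phi> y) \<noteq> 0 \<longrightarrow> y \<in> topspace (zariski_topology \<real> B) - C n"
        using zariski_basis[OF var _ _ x(2), of \<phi>] c U by blast
      obtain f where f: "f \<in> rpoly UNIV" "\<forall>z. real_vec z \<longrightarrow> r z = of_real (f (real_coords z))"
        using polyfun_real[OF r(1)] by blast
      have real: "real_vec (\<phi> y)" if "y \<in> U" "y \<in> real_points B" for y
        using real_points_chart[OF var _ that(1,2)] c U by blast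
      have "f (real_coords (\<phi> y)) = 0" if "y \<in> C n \<inter> U \<inter> real_points B" for y
        using r(3) f(2) real[of y] that by auto
      then have "f \<in> (\<Union>n. P n)" using f(1) by (auto simp: P_def)
      moreover have "\<forall>q\<in>Q. q (real_coords (\<phi> x)) = 0" using N x by (auto simp: P_def)
      ultimately have "f (real_coords (\<phi> x)) = 0" using Q(3) by blast
      then show False using f(2) real[OF x(2,3)] r(2) by simp
    qed
    then show ?thesis unfolding U by (intro exI[of _ N]) auto
  qed
  then have "\<exists>N. \<forall>c\<in>B. \<forall>n\<ge>N c. C (N c) \<inter> fst c \<inter> real_points B \<subseteq> C n"
    by (intro bchoice ballI)
  then obtain N where N: "\<forall>c\<in>B. \<forall>n\<ge>N c. C (N c) \<inter> fst c \<inter> real_points B \<subseteq> C n" ..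
  have fin: "finite B" using var by (simp add: variety_def)
  define M where "M = Max (insert 0 (N ` B))"
  have M: "N c \<le> M" if "c \<in> B" for c using that fin by (auto simp: M_def)
  have "x \<in> C (Suc M)" if x: "x \<in> C M" "x \<in> real_points B" for x
  proof -
    obtain c where c: "c \<in> B" "x \<in> fst c" using x(2) by (auto simp: real_points_def)
    have "x \<in> C (N c)" using anti[OF M[OF c(1)]] x(1) by blast
    then show ?thesis using N c x(2) M[OF c(1)] by (meson IntI le_SucI subsetD)
  qed
  then show ?thesis using decr[of M] by (intro exI[of _ M]) auto
qed

text \<open>Otherwise dependent choice produces a descending chain of closed sets that loses real
  points at every stage.\<close>

lemma zariski_minimal_closed:
  fixes B :: "('a, 'i :: finite) atlas"
  assumes var: "variety \<real> B" and closed: "\<And>x. x \<in> X \<Longrightarrow> closedin (zariski_topology \<real> B) (C x)"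
    and "X \<noteq> {}"
  shows "\<exists>x\<in>X. \<forall>y\<in>X. C y \<subseteq> C x \<longrightarrow> C y \<inter> real_points B = C x \<inter> real_points B"
proof (rule ccontr)
  assume neg: "\<not> ?thesis"
  have "\<exists>s. \<forall>n. s n \<in> X \<and> (C (s (Suc n)) \<subseteq> C (s n) \<and>
      C (s (Suc n)) \<inter> real_points B \<noteq> C (s n) \<inter> real_points B)"
    by (rule dependent_nat_choice) (use assms(3) neg in blast)+
  then obtain s where s: "\<And>n. s n \<in> X" "\<And>n. C (s (Suc n)) \<subseteq> C (s n)"
    "\<And>n. C (s (Suc n)) \<inter> real_points B \<noteq> C (s n) \<inter> real_points B" by blast
  show False
    using zariski_descending_chain[OF var, of "\<lambda>n. C (s n)"] closed s by blast
qed

text \<open>A basic semialgebraic set in a form that makes sense without coordinates: equations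
  contribute the Zariski closed set \<open>E\<close>, strict inequalities the Euclidean open set
  \<open>D\<close>.\<close>

definition basic_piece :: "'a topology \<Rightarrow> 'a topology \<Rightarrow> 'a set \<Rightarrow> 'a set \<Rightarrow> bool" where
  "basic_piece Z T R B \<longleftrightarrow> (\<exists>E D. closedin Z E \<and> openin T D \<and> B = E \<inter> D \<inter> R)"

text \<open>In a minimal subfamily of the pieces that is still dense in \<open>S\<close>, no piece lies in the closure
  of the others; off that closure, the piece is relatively open.\<close>

lemma basic_pieces_interior:
  assumes ZT: "\<And>W. openin Z W \<Longrightarrow> openin T W"
    and fin: "finite \<B>" and pieces: "\<And>B. B \<in> \<B> \<Longrightarrow> basic_piece Z T R B"
    and S: "S = \<Union>\<B>" "S \<noteq> {}" "S \<subseteq> topspace Z"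
  shows "\<exists>s\<in>S. \<exists>W. openin T W \<and> s \<in> W \<and> W \<inter> R \<inter> Z closure_of S \<subseteq> S"
proof -
  define Q where "Q \<D> \<longleftrightarrow> \<D> \<subseteq> \<B> \<and> Z closure_of \<Union>\<D> = Z closure_of S" for \<D>
  have "Q \<B>" using S by (simp add: Q_def)
  then obtain \<D> where \<D>: "Q \<D>" "\<And>\<E>. Q \<E> \<Longrightarrow> card \<D> \<le> card \<E>"
    using ex_has_least_nat[of Q \<B> card] by blast
  have finD: "finite \<D>" and sub: "\<D> \<subseteq> \<B>" using \<D>(1) fin finite_subset by (auto simp: Q_def)
  have "\<D> \<noteq> {}"
  proof
    assume "\<D> = {}"
    then have "Z closure_of S = {}" using \<D>(1) by (simp add: Q_def)
    then show False using closure_of_subset[OF S(3)] S(2) by blast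
  qed
  then obtain B where B: "B \<in> \<D>" by blast
  define rest where "rest = \<Union>(\<D> - {B})"
  have split: "\<Union>\<D> = B \<union> rest" using B by (auto simp: rest_def)
  have clS: "Z closure_of S = Z closure_of B \<union> Z closure_of rest"
    using \<D>(1) by (simp add: Q_def split)
  have not_sub: "\<not> B \<subseteq> Z closure_of rest"
  proof
    assume "B \<subseteq> Z closure_of rest"
    then have "Z closure_of B \<subseteq> Z closure_of rest"
      by (intro closure_of_minimal) auto
    then have "Z closure_of rest = Z closure_of S" using clS by blast
    then have "Q (\<D> - {B})" using sub by (auto simp: Q_def rest_def)
    then have "card \<D> \<le> card (\<D> - {B})" by (rule \<D>(2))
    then show False using B finD by (metis card_Diff1_less not_le)
  qed
  then obtain s where s: "s \<in> B" "s \<notin> Z closure_of rest" by blast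
  obtain E D where ED: "closedin Z E" "openin T D" "B = E \<inter> D \<inter> R"
    using pieces B sub unfolding basic_piece_def by blast
  have sS: "s \<in> S" using s(1) B sub S(1) by blast
  \<comment> \<open>On \<open>W\<close> a point of the closure of \<open>S\<close> must lie in the
    closure of \<open>B\<close>, hence in \<open>E\<close>. With \<open>D\<close> and
    \<open>R\<close> this puts it into \<open>B\<close>.\<close>
  define W where "W = D \<inter> (topspace Z - Z closure_of rest)"
  have "openin Z (topspace Z - Z closure_of rest)" by (simp add: openin_diff)
  then have "openin T W" unfolding W_def using ZT ED(2) by blast
  moreover have "s \<in> W" using s ED(3) sS S(3) by (auto simp: W_def)
  moreover have "W \<inter> R \<inter> Z closure_of S \<subseteq> S"
  proof
    fix z assume z: "z \<in> W \<inter> R \<inter> Z closure_of S"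
    then have "z \<in> Z closure_of B" using clS by (auto simp: W_def)
    moreover have "Z closure_of B \<subseteq> E" using ED by (intro closure_of_minimal) auto
    ultimately have "z \<in> B" using z ED(3) by (auto simp: W_def)
    then show "z \<in> S" using B sub S(1) by blast
  qed
  ultimately show ?thesis using sS by blast
qed

lemma open_sgn_eq:
  fixes f :: "'a :: topological_space \<Rightarrow> real"
  assumes "continuous_on UNIV f" "s \<noteq> 0"
  shows "open {x. sgn (f x) = s}"
proof -
  consider "s = 1" | "s = -1" | "s \<noteq> 1" "s \<noteq> -1" by blast
  then show ?thesis
  proof cases
    case 1
    then have "{x. sgn (f x) = s} = {x. 0 < f x}" by (auto simp: sgn_1_pos)
    then show ?thesis using assms(1) by (simp add: open_Collect_less continuous_on_const)
  next
    case 2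
    then have "{x. sgn (f x) = s} = {x. f x < 0}" by (auto simp: sgn_1_neg)
    then show ?thesis using assms(1) by (simp add: open_Collect_less continuous_on_const)
  next
    case 3
    then have "{x. sgn (f x) = s} = {}" using assms(2) by (auto simp: sgn_real_def)
    then show ?thesis by simp
  qed
qed

lemma semialg_chart_pieces:
  fixes B :: "('a, 'i :: finite) atlas"
  assumes var: "variety \<real> B" and chart: "(U, \<psi>) \<in> B" and T: "semialg (rpoly UNIV) T"
  shows "\<exists>\<B>. finite \<B> \<and>
    (\<forall>P\<in>\<B>. basic_piece (zariski_topology \<real> B) (euclidean_topology B) (real_points B) P) \<and>
    {x \<in> U \<inter> real_points B. real_coords (\<psi> x) \<in> T} = \<Union>\<B>"
proof -
  obtain A where A: "A \<subseteq> rpoly UNIV" "finite A" "T = \<Union>{C \<in> sign_classes A. C \<subseteq> T}"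
    using semialg_sign_classes[OF T] by blast
  define pc where "pc C = {x \<in> U \<inter> real_points B. real_coords (\<psi> x) \<in> C}" for C
  have "basic_piece (zariski_topology \<real> B) (euclidean_topology B) (real_points B) (pc C)"
    if C: "C \<in> sign_classes A" for C
  proof -
    obtain \<sigma> where \<sigma>: "C = sign_class A \<sigma>" using C by (auto simp: sign_classes_def)
    have "\<exists>p. \<forall>a\<in>A. p a \<in> polyfun \<real> \<and> (\<forall>z. real_vec z \<longrightarrow> p a z = of_real (a (real_coords z)))"
      using rpoly_polyfun A(1) by (intro bchoice ballI) blast
    then obtain p where p: "\<forall>a\<in>A. p a \<in> polyfun \<real> \<and>
        (\<forall>z. real_vec z \<longrightarrow> p a z = of_real (a (real_coords z)))" ..
    \<comment> \<open>Points outside \<open>U\<close> are kept in \<open>E\<close>, which makes it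
      closed in the whole variety; the restriction to \<open>U\<close> is left to
      \<open>D\<close>.\<close>
    define E where "E = topspace (zariski_topology \<real> B) - (\<Union>a\<in>{a \<in> A. \<sigma> a = 0}. {x \<in> U. p a (\<psi> x) \<noteq> 0})"
    define D where "D = {x \<in> U. \<psi> x \<in> (\<Inter>a\<in>{a \<in> A. \<sigma> a \<noteq> 0}. {z. sgn (a (real_coords z)) = \<sigma> a})}"
    have "closedin (zariski_topology \<real> B) E"
      unfolding E_def using p openin_zariski_chart[OF chart] by (intro closedin_diff openin_Union) auto
    moreover have "openin (euclidean_topology B) D"
      unfolding D_def
    proof (rule openin_euclidean_chart[OF chart], intro open_INT ballI)
      show "finite {a \<in> A. \<sigma> a \<noteq> 0}" using A(2) by simp
      fix a assume a: "a \<in> {a \<in> A. \<sigma> a \<noteq> 0}"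
      have "continuous_on UNIV (\<lambda>z. a (real_coords z))"
        using rpoly_continuous[of a UNIV UNIV] A(1) a
        by (intro continuous_on_compose2[OF _ continuous_real_coords]) auto
      then show "open {z. sgn (a (real_coords z)) = \<sigma> a}" using a by (intro open_sgn_eq) auto
    qed
    moreover have "pc C = E \<inter> D \<inter> real_points B"
    proof (intro Set.set_eqI)
      fix x
      show "x \<in> pc C \<longleftrightarrow> x \<in> E \<inter> D \<inter> real_points B"
      proof (cases "x \<in> U \<inter> real_points B")
        case True
        have "real_vec (\<psi> x)" using real_points_chart[OF var chart] True by blast
        then have p0: "p a (\<psi> x) = 0 \<longleftrightarrow> a (real_coords (\<psi> x)) = 0" if "a \<in> A" for a
          using p that by simp
        have "x \<in> topspace (zariski_topology \<real> B)"
          using True real_points_subset[of B] by (auto simp: topspace_zariski_topology)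
        then have xE: "x \<in> E \<longleftrightarrow> (\<forall>a\<in>A. \<sigma> a = 0 \<longrightarrow> sgn (a (real_coords (\<psi> x))) = \<sigma> a)"
          using True p0 by (auto simp: E_def sgn_eq_0_iff)
        have "x \<in> D \<longleftrightarrow> (\<forall>a\<in>A. \<sigma> a \<noteq> 0 \<longrightarrow> sgn (a (real_coords (\<psi> x))) = \<sigma> a)"
          using True by (auto simp: D_def)
        with xE show ?thesis using True unfolding pc_def \<sigma> sign_class_def by blast
      qed (auto simp: pc_def D_def)
    qed
    ultimately show ?thesis unfolding basic_piece_def by blast
  qed
  moreover have "{x \<in> U \<inter> real_points B. real_coords (\<psi> x) \<in> T} = \<Union>(pc ` {C \<in> sign_classes A. C \<subseteq> T})"
    unfolding pc_def by (subst A(3)) auto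
  moreover have "finite (pc ` {C \<in> sign_classes A. C \<subseteq> T})"
    using finite_sign_classes[OF A(2)] by simp
  ultimately show ?thesis
    by (intro exI[of _ "pc ` {C \<in> sign_classes A. C \<subseteq> T}"] conjI) auto
qed

text \<open>The graph is written with denominators cleared, and the source coordinates, the summand
  \<open>Inl\<close>, are eliminated. The equations determine \<open>w\<close> only where no
  \<open>\<delta> k u\<close> vanishes, which \<open>\<rho> u \<noteq> 0\<close> secures for the
  fractions of a local form.\<close>

lemma semialg_rational_image:
  fixes H :: "('i :: finite \<Rightarrow> real) set" and \<nu> \<delta> :: "'j :: finite \<Rightarrow> ('i \<Rightarrow> real) \<Rightarrow> real"
  assumes H: "semialg (rpoly UNIV) H" and \<rho>: "\<rho> \<in> rpoly UNIV"
    and \<nu>: "\<And>k. \<nu> k \<in> rpoly UNIV" and \<delta>: "\<And>k. \<delta> k \<in> rpoly UNIV"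
  shows "semialg (rpoly UNIV) {w. \<exists>u\<in>H. \<rho> u \<noteq> 0 \<and> (\<forall>k. w k * \<delta> k u = \<nu> k u)}"
proof -
  define l where "l y = (\<lambda>i. y (Inl i))" for y :: "'i + 'j \<Rightarrow> real"
  have l: "(\<lambda>y. f (l y)) \<in> rpoly UNIV" if "f \<in> rpoly UNIV" for f
    using that by (rule rpoly_compose) (auto simp: l_def intro: rpoly.coord)
  define g where "g k = (\<lambda>y. y (Inr k) * \<delta> k (l y) - \<nu> k (l y))" for k
  have g: "g k \<in> rpoly UNIV" for k
    unfolding g_def
    by (intro function_ring_diff function_ring_rpoly rpoly.mult l \<nu> \<delta> rpoly.coord UNIV_I)
  define S where "S = {y. l y \<in> H} \<inter> - {y. \<rho> (l y) = 0} \<inter> (\<Inter>k\<in>UNIV. {y. g k y = 0})"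
  have "semialg (rpoly UNIV) S"
    unfolding S_def
    by (intro semialg_Int semialg_INT semialg_Compl semialg_zero_set l g \<rho> semialg_vimage[OF H]) auto
  moreover have "range Inl \<union> range Inr = (UNIV :: ('i + 'j) set)" using UNIV_sum by auto
  ultimately have "semialg (rpoly (range Inr)) {x. \<exists>y\<in>S. \<forall>k. k \<notin> range Inl \<longrightarrow> y k = x k}"
    by (intro semialg_project_finite) auto
  \<comment> \<open>The eliminated coordinates receive the dummy value 0, which brings the set back
    to functions of the target coordinates alone.\<close>
  then have "semialg (rpoly UNIV) {w. case_sum (\<lambda>_. 0) w \<in> {x. \<exists>y\<in>S. \<forall>k. k \<notin> range Inl \<longrightarrow> y k = x k}}"
    by (rule semialg_vimage) (auto elim!: rpoly_compose intro: rpoly.coord[OF UNIV_I])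
  moreover have "case_sum (\<lambda>_. 0) w \<in> {x. \<exists>y\<in>S. \<forall>k. k \<notin> range Inl \<longrightarrow> y k = x k} \<longleftrightarrow>
      (\<exists>u\<in>H. \<rho> u \<noteq> 0 \<and> (\<forall>k. w k * \<delta> k u = \<nu> k u))" for w
  proof
    assume "case_sum (\<lambda>_. 0) w \<in> {x. \<exists>y\<in>S. \<forall>k. k \<notin> range Inl \<longrightarrow> y k = x k}"
    then obtain y where y: "y \<in> S" "\<forall>k. k \<notin> range Inl \<longrightarrow> y k = case_sum (\<lambda>_. 0) w k" by blast
    have "y (Inr k) = w k" for k using y(2)[rule_format, of "Inr k"] by auto
    then show "\<exists>u\<in>H. \<rho> u \<noteq> 0 \<and> (\<forall>k. w k * \<delta> k u = \<nu> k u)"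
      using y(1) by (intro bexI[of _ "l y"]) (auto simp: S_def g_def)
  next
    assume "\<exists>u\<in>H. \<rho> u \<noteq> 0 \<and> (\<forall>k. w k * \<delta> k u = \<nu> k u)"
    then obtain u where u: "u \<in> H" "\<rho> u \<noteq> 0" "\<forall>k. w k * \<delta> k u = \<nu> k u" by blast
    have "l (case_sum u w) = u" by (simp add: l_def)
    then have "case_sum u w \<in> S" using u by (simp add: S_def g_def)
    moreover have "case_sum u w k = case_sum (\<lambda>_. 0) w k" if "k \<notin> range Inl" for k
      using that by (cases k) auto
    ultimately show "case_sum (\<lambda>_. 0) w \<in> {x. \<exists>y\<in>S. \<forall>k. k \<notin> range Inl \<longrightarrow> y k = x k}" by blast
  qed
  ultimately show ?thesis by simp
qed

lemma local_form_image:
  fixes A :: "('g, 'i :: finite) atlas" and B :: "('x, 'j :: finite) atlas"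
  assumes varA: "variety \<real> A" and A: "(points A, \<gamma>) \<in> A" and varB: "variety \<real> B" and chart: "(U, \<psi>) \<in> B"
    and L: "L \<subseteq> real_points A" "semialg (rpoly UNIV) ((\<lambda>g. real_coords (\<gamma> g)) ` L)"
    and fL: "f ` L \<subseteq> real_points B"
    and lf: "local_form (points A) \<gamma> U \<psi> f r n d"
  shows "\<exists>T. semialg (rpoly UNIV) T \<and>
    f ` {g \<in> L. r (\<gamma> g) \<noteq> 0} = {x \<in> U \<inter> real_points B. real_coords (\<psi> x) \<in> T}"
proof -
  have nd: "n k \<in> polyfun \<real>" "d k \<in> polyfun \<real>" and r: "r \<in> polyfun \<real>" for k
    using lf by (auto simp: local_form_def)
  obtain \<rho> where \<rho>: "\<rho> \<in> rpoly UNIV" "\<forall>z. real_vec z \<longrightarrow> r z = of_real (\<rho> (real_coords z))"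
    using polyfun_real[OF r] by blast
  have "\<exists>\<nu>. \<forall>k. \<nu> k \<in> rpoly UNIV \<and> (\<forall>z. real_vec z \<longrightarrow> n k z = of_real (\<nu> k (real_coords z)))"
    using polyfun_real[OF nd(1)] by (intro choice allI) blast
  then obtain \<nu> where \<nu>: "\<forall>k. \<nu> k \<in> rpoly UNIV \<and> (\<forall>z. real_vec z \<longrightarrow> n k z = of_real (\<nu> k (real_coords z)))" ..
  have "\<exists>\<delta>. \<forall>k. \<delta> k \<in> rpoly UNIV \<and> (\<forall>z. real_vec z \<longrightarrow> d k z = of_real (\<delta> k (real_coords z)))"
    using polyfun_real[OF nd(2)] by (intro choice allI) blast
  then obtain \<delta> where \<delta>: "\<forall>k. \<delta> k \<in> rpoly UNIV \<and> (\<forall>z. real_vec z \<longrightarrow> d k z = of_real (\<delta> k (real_coords z)))" ..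
  define H where "H = (\<lambda>g. real_coords (\<gamma> g)) ` L"
  define T where "T = {w. \<exists>u\<in>H. \<rho> u \<noteq> 0 \<and> (\<forall>k. w k * \<delta> k u = \<nu> k u)}"
  have "semialg (rpoly UNIV) T"
    unfolding T_def using \<nu> \<delta> L(2) by (intro semialg_rational_image \<rho>) (auto simp: H_def)
  have inj: "inj_on \<psi> U"
    using bspec[OF varB[unfolded variety_def, THEN conjunct2, THEN conjunct1] chart, unfolded prod.case]
    by blast
  have point: "real_vec (\<gamma> g)" "g \<in> points A" "f g \<in> real_points B" if "g \<in> L" for g
  proof -
    have gR: "g \<in> real_points A" using that L(1) by blast
    then show gA: "g \<in> points A" by (rule subsetD[OF real_points_subset])
    show "real_vec (\<gamma> g)" by (rule real_points_chart[OF varA A gA gR])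
    show "f g \<in> real_points B" using that fL by blast
  qed
  have vals: "f g \<in> U" "\<delta> k (real_coords (\<gamma> g)) \<noteq> 0"
      "\<psi> (f g) $ k = of_real (\<nu> k (real_coords (\<gamma> g)) / \<delta> k (real_coords (\<gamma> g)))"
    if g: "g \<in> L" "r (\<gamma> g) \<noteq> 0" for g k
  proof -
    have "f g \<in> U \<and> d k (\<gamma> g) \<noteq> 0 \<and> \<psi> (f g) $ k = n k (\<gamma> g) / d k (\<gamma> g)"
      using lf point(2)[OF g(1)] g(2) unfolding local_form_def by blast
    then show "f g \<in> U" "\<delta> k (real_coords (\<gamma> g)) \<noteq> 0"
      "\<psi> (f g) $ k = of_real (\<nu> k (real_coords (\<gamma> g)) / \<delta> k (real_coords (\<gamma> g)))"
      using \<nu> \<delta> point(1)[OF g(1)] by auto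
  qed
  have "f ` {g \<in> L. r (\<gamma> g) \<noteq> 0} = {x \<in> U \<inter> real_points B. real_coords (\<psi> x) \<in> T}"
  proof (intro subset_antisym subsetI)
    fix x assume "x \<in> f ` {g \<in> L. r (\<gamma> g) \<noteq> 0}"
    then obtain g where g: "g \<in> L" "r (\<gamma> g) \<noteq> 0" "x = f g" by blast
    have "\<rho> (real_coords (\<gamma> g)) \<noteq> 0" using \<rho>(2) point(1)[OF g(1)] g(2) by auto
    moreover have "real_coords (\<psi> x) k * \<delta> k (real_coords (\<gamma> g)) = \<nu> k (real_coords (\<gamma> g))" for k
      using vals(2,3)[OF g(1,2), of k] by (simp add: real_coords_def g(3))
    ultimately have "real_coords (\<psi> x) \<in> T" using g(1) by (auto simp: T_def H_def)
    then show "x \<in> {x \<in> U \<inter> real_points B. real_coords (\<psi> x) \<in> T}"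
      using vals(1)[OF g(1,2)] point(3)[OF g(1)] by (simp add: g(3))
  next
    fix x assume "x \<in> {x \<in> U \<inter> real_points B. real_coords (\<psi> x) \<in> T}"
    then have x: "x \<in> U" "x \<in> real_points B" "real_coords (\<psi> x) \<in> T" by auto
    then obtain g where g: "g \<in> L" "\<rho> (real_coords (\<gamma> g)) \<noteq> 0"
      "\<forall>k. real_coords (\<psi> x) k * \<delta> k (real_coords (\<gamma> g)) = \<nu> k (real_coords (\<gamma> g))"
      by (auto simp: T_def H_def)
    have rg: "r (\<gamma> g) \<noteq> 0" using \<rho>(2) point(1)[OF g(1)] g(2) by auto
    have "\<psi> x $ k = \<psi> (f g) $ k" for k
    proof -
      have "real_coords (\<psi> x) k = \<nu> k (real_coords (\<gamma> g)) / \<delta> k (real_coords (\<gamma> g))"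
        using g(3) vals(2)[OF g(1) rg, of k] by (simp add: eq_divide_eq)
      then show ?thesis
        using vals(3)[OF g(1) rg, of k] real_vec_nth[OF real_points_chart[OF varB chart x(1,2)], of k]
        by simp
    qed
    then have "\<psi> x = \<psi> (f g)" by (simp add: vec_eq_iff)
    then have "x = f g" using inj_onD[OF inj] x(1) vals(1)[OF g(1) rg] by blast
    then show "x \<in> f ` {g \<in> L. r (\<gamma> g) \<noteq> 0}" using g(1) rg by blast
  qed
  then show ?thesis using \<open>semialg (rpoly UNIV) T\<close> by blast
qed

text \<open>The loci where \<open>f\<close> has a local form cover \<open>L\<close>; by the basis theorem finitely many suffice.\<close>

lemma morphism_image_pieces:
  fixes A :: "('g, 'i :: finite) atlas" and B :: "('x, 'j :: finite) atlas"
  assumes varA: "variety \<real> A" and A: "(points A, \<gamma>) \<in> A" and varB: "variety \<real> B"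
    and L: "L \<subseteq> real_points A" "semialg (rpoly UNIV) ((\<lambda>g. real_coords (\<gamma> g)) ` L)"
    and f: "morphism \<real> A B f" and fL: "f ` L \<subseteq> real_points B"
  shows "\<exists>\<B>. finite \<B> \<and>
    (\<forall>P\<in>\<B>. basic_piece (zariski_topology \<real> B) (euclidean_topology B) (real_points B) P) \<and> f ` L = \<Union>\<B>"
proof -
  \<comment> \<open>\<open>\<rho>\<close> is the real form of a polynomial \<open>r\<close> on whose
    nonvanishing locus \<open>f\<close> has a local form. That these loci cover \<open>L\<close>
    means that the functions in \<open>P\<close> have no common zero on it.\<close>
  define good where "good \<rho> r \<longleftrightarrow> (\<forall>z. real_vec z \<longrightarrow> r z = of_real (\<rho> (real_coords z))) \<and>
      (\<exists>U \<psi> n d. (U, \<psi>) \<in> B \<and> local_form (points A) \<gamma> U \<psi> f r n d)"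
    for \<rho> :: "('i \<Rightarrow> real) \<Rightarrow> real" and r
  define P where "P = {\<rho> \<in> rpoly UNIV. \<exists>r. good \<rho> r}"
  have real: "real_vec (\<gamma> g)" if "g \<in> L" for g
  proof -
    have gR: "g \<in> real_points A" using that L(1) by blast
    show ?thesis by (rule real_points_chart[OF varA A subsetD[OF real_points_subset gR] gR])
  qed
  have cover: "\<exists>\<rho>\<in>P. \<rho> (real_coords (\<gamma> g)) \<noteq> 0" if g: "g \<in> L" for g
  proof -
    have gA: "g \<in> points A" using subsetD[OF real_points_subset] subsetD[OF L(1) g] .
    obtain U \<psi> where U: "(U, \<psi>) \<in> B" "f g \<in> U"
      using morphism_maps_points[OF f gA] by (auto simp: points_def)
    obtain r n d where lf: "local_form (points A) \<gamma> U \<psi> f r n d" "r (\<gamma> g) \<noteq> 0"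
      using morphism_local_form[OF varA f A U(1) gA U(2)] by blast
    have "r \<in> polyfun \<real>" using lf(1) by (simp add: local_form_def)
    then obtain \<rho> where \<rho>: "\<rho> \<in> rpoly UNIV" "\<forall>z. real_vec z \<longrightarrow> r z = of_real (\<rho> (real_coords z))"
      using polyfun_real by blast
    have "good \<rho> r" unfolding good_def using \<rho>(2) U(1) lf(1) by blast
    then have "\<rho> \<in> P" using \<rho>(1) by (auto simp: P_def)
    moreover have "\<rho> (real_coords (\<gamma> g)) \<noteq> 0" using \<rho>(2) real[OF g] lf(2) by auto
    ultimately show ?thesis by blast
  qed
  have "P \<subseteq> rpoly UNIV" by (auto simp: P_def)
  from noetherian_finite_zero_set[OF noetherian_rpoly[OF finite] this]
  obtain Q where Q: "Q \<subseteq> P" "finite Q" "\<forall>x. (\<forall>p\<in>Q. p x = 0) \<longrightarrow> (\<forall>p\<in>P. p x = 0)"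
    by (elim exE conjE)
  define piece where "piece \<rho> = f ` {g \<in> L. \<rho> (real_coords (\<gamma> g)) \<noteq> 0}" for \<rho> :: "('i \<Rightarrow> real) \<Rightarrow> real"
  have "\<exists>\<B>. finite \<B> \<and>
      (\<forall>P\<in>\<B>. basic_piece (zariski_topology \<real> B) (euclidean_topology B) (real_points B) P) \<and>
      piece \<rho> = \<Union>\<B>" if \<rho>: "\<rho> \<in> Q" for \<rho>
  proof -
    obtain r where "good \<rho> r" using \<rho> Q(1) by (auto simp: P_def)
    then obtain U \<psi> n d where U: "\<forall>z. real_vec z \<longrightarrow> r z = of_real (\<rho> (real_coords z))"
      "(U, \<psi>) \<in> B" "local_form (points A) \<gamma> U \<psi> f r n d"
      unfolding good_def by blast
    have "piece \<rho> = f ` {g \<in> L. r (\<gamma> g) \<noteq> 0}"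
      unfolding piece_def using U(1) real by (intro arg_cong[where f = "image f"]) auto
    moreover obtain T where "semialg (rpoly UNIV) T"
      "f ` {g \<in> L. r (\<gamma> g) \<noteq> 0} = {x \<in> U \<inter> real_points B. real_coords (\<psi> x) \<in> T}"
      using local_form_image[OF varA A varB U(2) L fL U(3)] by blast
    ultimately show ?thesis using semialg_chart_pieces[OF varB U(2)] by simp
  qed
  then have "\<exists>\<B>. \<forall>\<rho>\<in>Q. finite (\<B> \<rho>) \<and>
      (\<forall>P\<in>\<B> \<rho>. basic_piece (zariski_topology \<real> B) (euclidean_topology B) (real_points B) P) \<and>
      piece \<rho> = \<Union>(\<B> \<rho>)"
    by (intro bchoice ballI)
  then obtain \<B> where \<B>: "\<forall>\<rho>\<in>Q. finite (\<B> \<rho>) \<and>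
      (\<forall>P\<in>\<B> \<rho>. basic_piece (zariski_topology \<real> B) (euclidean_topology B) (real_points B) P) \<and>
      piece \<rho> = \<Union>(\<B> \<rho>)" ..
  have "f ` L = (\<Union>\<rho>\<in>Q. piece \<rho>)"
  proof (intro subset_antisym subsetI)
    fix x assume "x \<in> f ` L"
    then obtain g where g: "g \<in> L" "x = f g" by blast
    have "\<not> (\<forall>p\<in>Q. p (real_coords (\<gamma> g)) = 0)" using Q(3) cover[OF g(1)] by blast
    then show "x \<in> (\<Union>\<rho>\<in>Q. piece \<rho>)" using g by (auto simp: piece_def)
  qed (auto simp: piece_def)
  also have "\<dots> = \<Union>(\<Union>\<rho>\<in>Q. \<B> \<rho>)" using \<B> by auto
  finally show ?thesis
    using \<B> Q(2) by (intro exI[of _ "\<Union>\<rho>\<in>Q. \<B> \<rho>"]) auto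
qed

theorem proposition2:
  fixes LL :: "('g, 'm) monoid_scheme"
    and A :: "('g, 'i :: finite) atlas"
    and XX :: "('x, 'j :: finite) atlas"
    and L :: "'g set" and X :: "'x set"
    and \<phi> :: "'g \<Rightarrow> 'x \<Rightarrow> 'x"
  assumes "algebraic_group \<real> LL A"
    and "affine_variety \<real> A"
    and "connected_space (zariski_topology UNIV A)"
    and "L = real_identity_component LL A"
    and "variety \<real> XX"
    and "irreducible_space (zariski_topology UNIV XX)"
    and "X \<in> connected_components_of (real_locus XX)"
    and "group_action (LL\<lparr>carrier := L\<rparr>) X \<phi>"
    and "\<exists>a. algebraic_action \<real> LL A XX a \<and> (\<forall>g\<in>L. \<forall>x\<in>X. \<phi> g x = a g x)"
  shows "\<exists>x0\<in>X. closedin (subtopology (euclidean_topology XX) X)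
                   (orbit (LL\<lparr>carrier := L\<rparr>) \<phi> x0)"
proof -
  define Z where "Z = zariski_topology \<real> XX"
  define T where "T = euclidean_topology XX"
  define R where "R = real_points XX"
  define Orb where "Orb x = orbit (LL\<lparr>carrier := L\<rparr>) \<phi> x" for x
  interpret act: group_action "LL\<lparr>carrier := L\<rparr>" X \<phi> by fact
  obtain a where alg: "algebraic_action \<real> LL A XX a" and a: "\<And>g x. g \<in> L \<Longrightarrow> x \<in> X \<Longrightarrow> \<phi> g x = a g x"
    using assms(9) by blast
  have mor: "morphism \<real> (product_atlas A XX) XX (\<lambda>(g, x). a g x)"
    using alg by (simp add: algebraic_action_def)
  have varA: "variety \<real> A" using assms(2) by (simp add: affine_variety_def)
  obtain \<gamma> where \<gamma>: "A = {(points A, \<gamma>)}" using assms(2) unfolding affine_variety_def by blast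
  then have chartA: "(points A, \<gamma>) \<in> A" by (metis insertI1)
  have L_real: "L \<subseteq> real_points A"
    using connected_component_of_subset_topspace[of "real_locus A" "\<one>\<^bsub>LL\<^esub>"] assms(4)
    by (auto simp: real_identity_component_def)
  have X_real: "X \<subseteq> R"
    using connected_components_of_subset[OF assms(7)] by (auto simp: R_def)
  have topZ: "topspace Z = points XX" and topT: "topspace T = points XX"
    by (simp_all add: Z_def T_def topspace_zariski_topology topspace_euclidean_topology)
  have X_points: "X \<subseteq> points XX" using X_real real_points_subset[of XX] by (auto simp: R_def)
  have semialgL: "semialg (rpoly UNIV) ((\<lambda>g. real_coords (\<gamma> g)) ` L)"
    unfolding assms(4) real_identity_component_def by (rule semialg_real_component[OF varA \<gamma>])
  have ZT: "openin Z W \<Longrightarrow> openin T W" for W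
    unfolding Z_def T_def by (rule zariski_open_imp_euclidean_open)
  \<comment> \<open>Orbits are defined by \<open>\<phi>\<close>, which lives on \<open>L\<close> and
    \<open>X\<close> only. Expressed through \<open>a\<close>, they become images of
    \<open>L\<close> under morphisms of varieties.\<close>
  have Orb_image: "Orb x = (\<lambda>g. a g x) ` L" if "x \<in> X" for x
  proof -
    have "Orb x = (\<lambda>g. \<phi> g x) ` L" by (auto simp: Orb_def orbit_def)
    also have "\<dots> = (\<lambda>g. a g x) ` L" by (intro image_cong refl a that)
    finally show ?thesis .
  qed
  have Orb_X: "Orb x \<subseteq> X" if "x \<in> X" for x
    using act.element_image that by (auto simp: Orb_def orbit_def)
  have trans: "morphism \<real> XX XX (a g)" if "g \<in> L" for g
    using morphism_slice_right[OF mor varA] L_real that by blast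
  have trans_Orb: "a g z \<in> Orb x" if "g \<in> L" "z \<in> Orb x" "x \<in> X" for g z x
  proof -
    have z: "z \<in> X" using Orb_X that by blast
    have "\<phi> g z \<in> Orb z" using that(1) by (auto simp: Orb_def orbit_def)
    moreover have "\<phi> g z \<in> X" using Orb_X[OF z] calculation by blast
    ultimately show ?thesis
      using act.orbit_trans[OF that(3) z] that(2) a[OF that(1) z] unfolding Orb_def by simp
  qed
  have "X \<noteq> {}" using nonempty_connected_components_of[OF assms(7)] .
  then obtain x0 where x0: "x0 \<in> X" and min: "\<And>y. y \<in> X \<Longrightarrow>
      Z closure_of Orb y \<subseteq> Z closure_of Orb x0 \<Longrightarrow> Z closure_of Orb y \<inter> R = Z closure_of Orb x0 \<inter> R"
    using zariski_minimal_closed[OF assms(5), of X "\<lambda>x. Z closure_of Orb x"]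
    unfolding Z_def R_def by auto
  have "y \<in> Orb x0" if y: "y \<in> subtopology T X closure_of Orb x0" for y
  proof -
    have yX: "y \<in> X" using y by (auto simp: in_closure_of)
    have near: "\<exists>z\<in>Orb x0. z \<in> W" if "openin T W" "y \<in> W" for W
    proof -
      have "openin (subtopology T X) (W \<inter> X)" using that(1) by (rule openin_subtopology_Int)
      then show ?thesis using y yX that(2) unfolding in_closure_of by blast
    qed
    \<comment> \<open>Zariski open sets are Euclidean open, so the Euclidean closure is contained in
      the Zariski closure.\<close>
    have y_cl: "y \<in> Z closure_of Orb x0"
      unfolding in_closure_of topZ using near ZT yX X_points by blast
    \<comment> \<open>Translations by \<open>L\<close> are Zariski continuous and map
      \<open>Orb x0\<close> into itself, hence also its closure, which contains
      \<open>y\<close>.\<close>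
    have "Orb y \<subseteq> Z closure_of Orb x0"
    proof
      fix z assume "z \<in> Orb y"
      then obtain g where g: "g \<in> L" "z = a g y" using Orb_image[OF yX] by blast
      have "continuous_map Z Z (a g)" using trans[OF g(1)] by (simp add: morphism_def Z_def)
      then have "a g ` (Z closure_of Orb x0) \<subseteq> Z closure_of (a g ` Orb x0)"
        by (rule continuous_map_image_closure_subset)
      moreover have "Z closure_of (a g ` Orb x0) \<subseteq> Z closure_of Orb x0"
        using trans_Orb[OF g(1) _ x0] by (intro closure_of_mono) auto
      ultimately show "z \<in> Z closure_of Orb x0" using y_cl g(2) by blast
    qed
    then have "Z closure_of Orb y \<subseteq> Z closure_of Orb x0" by (intro closure_of_minimal) auto
    then have cl_eq: "Z closure_of Orb y \<inter> R = Z closure_of Orb x0 \<inter> R" by (rule min[OF yX])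
    have "(\<lambda>g. a g y) ` L \<subseteq> R" using Orb_image[OF yX] Orb_X[OF yX] X_real by blast
    moreover have "morphism \<real> A XX (\<lambda>g. a g y)"
      using morphism_slice_left[OF mor assms(5)] yX X_real by (auto simp: R_def)
    ultimately obtain \<B> where "finite \<B>" "\<forall>P\<in>\<B>. basic_piece Z T R P" "Orb y = \<Union>\<B>"
      using morphism_image_pieces[OF varA chartA assms(5) L_real semialgL, of "\<lambda>g. a g y"] Orb_image[OF yX]
      unfolding Z_def T_def R_def by auto
    then obtain s W where s: "s \<in> Orb y" "openin T W" "s \<in> W" "W \<inter> R \<inter> Z closure_of Orb y \<subseteq> Orb y"
      using basic_pieces_interior[where Z = Z and T = T and R = R and \<B> = \<B> and S = "Orb y", OF ZT] act.orbit_refl[OF yX] Orb_X[OF yX] X_points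
      unfolding Orb_def topZ by blast
    \<comment> \<open>Since \<open>s\<close> is the translate of \<open>y\<close> by
      \<open>g\<close>, the preimage of \<open>W\<close> under this translation is a neighbourhood
      of \<open>y\<close> and must meet \<open>Orb x0\<close>.\<close>
    obtain g where g: "g \<in> L" "s = a g y" using s(1) Orb_image[OF yX] by blast
    have "continuous_map T T (a g)"
      unfolding T_def by (rule morphism_euclidean_continuous[OF assms(5) trans[OF g(1)]])
    then have "openin T {x \<in> topspace T. a g x \<in> W}" using s(2) by (rule openin_continuous_map_preimage)
    then obtain z where z: "z \<in> Orb x0" "a g z \<in> W"
      using near[of "{x \<in> topspace T. a g x \<in> W}"] yX X_points s(3) g(2) by (auto simp: topT)
    have gz: "a g z \<in> Orb x0" using trans_Orb[OF g(1) z(1) x0] .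
    then have gzX: "a g z \<in> X" using Orb_X[OF x0] by blast
    have "a g z \<in> Z closure_of Orb x0"
      using closure_of_subset[of "Orb x0" Z] gz Orb_X[OF x0] X_points by (auto simp: topZ)
    \<comment> \<open>The point of \<open>Orb x0\<close> found in \<open>W\<close> is real, so by
      \<open>cl_eq\<close> it lies in the closure of \<open>Orb y\<close>, and the choice of
      \<open>W\<close> puts it into \<open>Orb y\<close>. The two orbits thus share a point.\<close>
    then have "a g z \<in> Orb y" using s(4) z(2) gzX X_real cl_eq by blast
    then have "y \<in> Orb (a g z)" using act.orbit_sym[OF yX gzX] by (simp add: Orb_def)
    then show ?thesis using act.orbit_trans[OF x0 gzX yX] gz by (simp add: Orb_def)
  qed
  then have "closedin (subtopology T X) (Orb x0)"
    using closure_of_subset_eq[of "Orb x0" "subtopology T X"] Orb_X[OF x0] X_points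
    by (auto simp: topT)
  then show ?thesis using x0 by (auto simp: Orb_def T_def)
qed

end
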